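(* Let $P$ be a finite solvable transitive permutation group on a finite set $\Omega$. Then $P$ has an abundant subset, that is, there exists $\Delta\subseteq\Omega$ such that $|P:P_\Delta|\ge\nu(P_\Delta)$.
   Context: $P_\Delta$ denotes the setwise stabiliser of $\Delta$ in $P$. For a finite group $X$, $\nu(X)$ denotes the maximum order of a nilpotent subgroup of $X$. A subset $\Delta$ is abundant if its abundance ratio $\rho_P(\Delta)=|P:P_\Delta|/\nu(P_\Delta)$ is at least $1$. *)

theory Defs
  imports Complex_Main "HOL-Algebra.Solvable_Groups" "HOL-Algebra.Group_Action"
begin

text \<open>A permutation group on \<open>\<Omega>\<close> is a subgroup of the group \<^term>\<open>BijGroup \<Omega>\<close> of all
  bijections of \<open>\<Omega>\<close>, acting on \<open>\<Omega>\<close> by evaluation.\<close>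

abbreviation perm_group :: "'a set \<Rightarrow> ('a \<Rightarrow> 'a) set \<Rightarrow> ('a \<Rightarrow> 'a) monoid"
  where "perm_group \<Omega> P \<equiv> (BijGroup \<Omega>) \<lparr> carrier := P \<rparr>"

text \<open>The lower central series starts with index 0, so that \<open>lower_central G n\<close> is usually
  written \<open>\<gamma>\<close> with subscript \<open>n + 1\<close>. The commutator convention is that of
  \<^const>\<open>derived\<close>.\<close>

primrec lower_central :: "('a, 'b) monoid_scheme \<Rightarrow> nat \<Rightarrow> 'a set" where
  "lower_central G 0 = carrier G"
| "lower_central G (Suc n) =
     generate G (\<Union>x \<in> lower_central G n. \<Union>y \<in> carrier G.
       { x \<otimes>\<^bsub>G\<^esub> y \<otimes>\<^bsub>G\<^esub> (inv\<^bsub>G\<^esub> x) \<otimes>\<^bsub>G\<^esub> (inv\<^bsub>G\<^esub> y) })"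

definition nilpotent_group :: "('a, 'b) monoid_scheme \<Rightarrow> bool"
  where "nilpotent_group G \<longleftrightarrow> (\<exists>n. lower_central G n = { \<one>\<^bsub>G\<^esub> })"

text \<open>The invariant \<open>\<nu>\<close>. It is meaningful only for a finite group, where the set of orders is
  finite and nonempty.\<close>

definition max_nilpotent_order :: "('a, 'b) monoid_scheme \<Rightarrow> nat"
  where "max_nilpotent_order X =
    Max { card H | H. subgroup H X \<and> nilpotent_group (X \<lparr> carrier := H \<rparr>) }"

definition setwise_stabilizer :: "('a \<Rightarrow> 'a) monoid \<Rightarrow> 'a set \<Rightarrow> ('a \<Rightarrow> 'a) set"
  where "setwise_stabilizer G \<Delta> = stabilizer G (\<lambda>g D. g ` D) \<Delta>"

definition abundance_ratio :: "('a \<Rightarrow> 'a) monoid \<Rightarrow> 'a set \<Rightarrow> real"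
  where "abundance_ratio G \<Delta> =
    real (card (rcosets\<^bsub>G\<^esub> (setwise_stabilizer G \<Delta>)))
      / real (max_nilpotent_order (G \<lparr> carrier := setwise_stabilizer G \<Delta> \<rparr>))"

definition abundant :: "('a \<Rightarrow> 'a) monoid \<Rightarrow> 'a set \<Rightarrow> bool"
  where "abundant G \<Delta> \<longleftrightarrow> abundance_ratio G \<Delta> \<ge> 1"

lemma (in group) max_nilpotent_order_pos:
  assumes fin: "finite (carrier G)"
  shows "max_nilpotent_order G > 0"
proof -
  let ?S = "{ card H | H. subgroup H G \<and> nilpotent_group (G \<lparr> carrier := H \<rparr>) }"
  have "?S \<subseteq> card ` Pow (carrier G)"
    by (auto dest: subgroup.subset)
  hence "finite ?S" using fin by (meson finite_Pow_iff finite_imageI finite_subset)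
  have "lower_central (G \<lparr> carrier := {\<one>} \<rparr>) 0 = {\<one>}" by simp
  hence "nilpotent_group (G \<lparr> carrier := {\<one>} \<rparr>)"
    unfolding nilpotent_group_def by (intro exI[of _ 0]) simp
  hence "card {\<one>} \<in> ?S"
    using triv_subgroup by (intro CollectI exI[of _ "{\<one>}"]) simp
  hence "card {\<one>} \<le> Max ?S" using \<open>finite ?S\<close> by (intro Max_ge) auto
  thus ?thesis unfolding max_nilpotent_order_def by simp
qed

lemma setwise_stabilizer_subgroup:
  assumes P: "subgroup P (BijGroup \<Omega>)" and D: "\<Delta> \<subseteq> \<Omega>"
  shows "subgroup (setwise_stabilizer (perm_group \<Omega> P) \<Delta>) (perm_group \<Omega> P)"
proof -
  let ?G = "perm_group \<Omega> P"
  let ?S = "setwise_stabilizer ?G \<Delta>"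
  interpret B: group "BijGroup \<Omega>" by (rule group_BijGroup)
  interpret G: group ?G by (rule B.subgroup_imp_group[OF P])
  have PB: "P \<subseteq> Bij \<Omega>" using subgroup.subset[OF P] by (simp add: BijGroup_def)
  have S: "?S = {g \<in> P. g ` \<Delta> = \<Delta>}"
    by (simp add: setwise_stabilizer_def stabilizer_def)
  have mult: "(g \<otimes>\<^bsub>?G\<^esub> h) ` \<Delta> = g ` h ` \<Delta>" if "g \<in> P" "h \<in> P" for g h
    using that PB D by (auto simp: BijGroup_def compose_def image_image subset_iff)
  have one: "\<one>\<^bsub>?G\<^esub> ` \<Delta> = \<Delta>" using D by (auto simp: BijGroup_def image_iff subset_iff)
  show ?thesis
  proof (rule G.subgroupI)
    show "?S \<subseteq> carrier ?G" by (auto simp: S)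
    show "?S \<noteq> {}" using one G.one_closed by (auto simp: S)
  next
    fix g assume "g \<in> ?S"
    hence g: "g \<in> P" "g ` \<Delta> = \<Delta>" by (auto simp: S)
    have ig: "inv\<^bsub>?G\<^esub> g \<in> P" using G.inv_closed[of g] g by simp
    have "(inv\<^bsub>?G\<^esub> g) ` g ` \<Delta> = \<Delta>"
      using mult[OF ig g(1)] one G.l_inv[of g] g by simp
    thus "inv\<^bsub>?G\<^esub> g \<in> ?S" using g ig by (simp add: S)
  next
    fix g h assume "g \<in> ?S" "h \<in> ?S"
    thus "g \<otimes>\<^bsub>?G\<^esub> h \<in> ?S"
      using mult[of g h] G.m_closed[of g h] by (auto simp: S)
  qed
qed

lemma abundant_iff:
  assumes fin: "finite \<Omega>" and P: "subgroup P (BijGroup \<Omega>)" and D: "\<Delta> \<subseteq> \<Omega>"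
  shows "abundant (perm_group \<Omega> P) \<Delta> \<longleftrightarrow>
    card (rcosets\<^bsub>perm_group \<Omega> P\<^esub> (setwise_stabilizer (perm_group \<Omega> P) \<Delta>))
      \<ge> max_nilpotent_order (perm_group \<Omega> (setwise_stabilizer (perm_group \<Omega> P) \<Delta>))"
proof -
  let ?G = "perm_group \<Omega> P"
  let ?S = "setwise_stabilizer ?G \<Delta>"
  interpret B: group "BijGroup \<Omega>" by (rule group_BijGroup)
  interpret G: group ?G by (rule B.subgroup_imp_group[OF P])
  interpret S: group "?G \<lparr> carrier := ?S \<rparr>"
    by (rule G.subgroup_imp_group[OF setwise_stabilizer_subgroup[OF P D]])
  have "Bij \<Omega> \<subseteq> \<Omega> \<rightarrow>\<^sub>E \<Omega>"
    by (auto simp: Bij_def PiE_def dest: bij_betw_imp_funcset)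
  hence "finite (Bij \<Omega>)" using finite_PiE[OF fin, of "\<lambda>_. \<Omega>"] fin finite_subset by blast
  moreover have "?S \<subseteq> Bij \<Omega>"
    using subgroup.subset[OF P]
    by (auto simp: setwise_stabilizer_def stabilizer_def BijGroup_def)
  ultimately have "finite ?S" by (rule finite_subset[rotated])
  hence "max_nilpotent_order (?G \<lparr> carrier := ?S \<rparr>) > 0"
    using S.max_nilpotent_order_pos by simp
  thus ?thesis by (simp add: abundant_def abundance_ratio_def field_simps)
qed

end

theory Submission
  imports Defs "HOL-Algebra.Sylow"
begin

text \<open>
  Induct on the degree. Let \<open>M\<close> be a nontrivial abelian normal subgroup of \<open>P\<close>, of exponent 2 or
  of odd order, let \<open>K\<close> be the kernel of the action of \<open>P\<close> on the set of \<open>M\<close>-orbits, and let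
  \<open>\<Sigma>\<close> be a set of \<open>M\<close>-orbits that is abundant for \<open>P/K\<close>. Since \<open>\<nu>(X) \<le> \<nu>(N) \<nu>(X/N)\<close>, it
  suffices to find a set \<open>\<Delta>\<close> that is abundant for \<open>K\<close> and whose stabiliser in \<open>P\<close> preserves
  \<open>\<Sigma>\<close>. The group \<open>K\<close> is treated one orbit at a time, passing each time to the pointwise stabiliser
  of the orbit. On an orbit \<open>b\<close> we meet a group \<open>X\<close> that is normalised by a regular abelian group
  \<open>V\<close> and normalises it. With \<open>W = X \<inter> V\<close>, take a base point together with its images under
  generators of \<open>W\<close> and under generators of \<open>V\<close> modulo \<open>W\<close>: the stabiliser of this set meets \<open>W\<close>
  trivially and acts faithfully on the \<open>l + 1\<close> points in the orbit of \<open>W\<close>, where \<open>2\<^sup>l \<le> \<bar>W\<bar>\<close>. As a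
  nilpotent permutation group of degree \<open>n\<close> has order at most \<open>2\<^sup>n\<^sup>-\<^sup>1\<close>, the set is abundant for \<open>X\<close>.
  Its size is not \<open>\<bar>b\<bar>/2\<close> unless \<open>\<bar>b\<bar>\<close> is 2 or 8, so that replacing it by its complement in \<open>b\<close>
  if necessary makes its size record whether \<open>b\<close> belongs to \<open>\<Sigma>\<close>. For \<open>\<bar>b\<bar> = 8\<close> sets of size 3
  work. For \<open>\<bar>b\<bar> = 2\<close> take one point from each orbit in \<open>\<Sigma>\<close>, or one from each orbit not in
  \<open>\<Sigma>\<close>; the two stabilisers in \<open>K\<close> intersect trivially, so that one of them has order at most
  \<open>\<bar>K\<bar>\<^sup>1\<^sup>/\<^sup>2\<close>.
\<close>

section \<open>Homomorphisms, the lower central series and nilpotent subgroups\<close>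

text \<open>Every nonempty fibre of \<open>h\<close> on \<open>N\<close> is a left coset of the
  kernel in \<open>N\<close>. The map need only be a homomorphism on \<open>L\<close>, so that one
  \<open>h\<close> serves \<open>L\<close> and all its subgroups.\<close>

lemma card_hom_image_kernel:
  assumes G: "group G" and H: "group H" and h: "h \<in> hom (G\<lparr>carrier := L\<rparr>) H"
    and L: "subgroup L G" and N: "subgroup N G" "N \<subseteq> L" and fin: "finite L"
  shows "card N = card (h ` N) * card {g \<in> N. h g = \<one>\<^bsub>H\<^esub>}"
proof -
  interpret G: group G by fact
  interpret H: group H by fact
  interpret h: group_hom "G\<lparr>carrier := L\<rparr>" H h
    using G.subgroup_imp_group[OF L] H h by (simp add: group_hom_def group_hom_axioms_def)
  have finN: "finite N" using fin N(2) finite_subset by blast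
  have inv: "h (inv\<^bsub>G\<^esub> x) = inv\<^bsub>H\<^esub> (h x)" if "x \<in> N" for x
    using h.hom_inv[of x] that N(2) G.m_inv_consistent[OF L, of x] by auto
  have mul: "h (x \<otimes>\<^bsub>G\<^esub> y) = h x \<otimes>\<^bsub>H\<^esub> h y" if "x \<in> N" "y \<in> N" for x y
    using h.hom_mult[of x y] that N(2) by auto
  have hc: "h x \<in> carrier H" if "x \<in> N" for x using h.hom_closed[of x] that N(2) by auto
  have Nc: "x \<in> carrier G" if "x \<in> N" for x using subgroup.mem_carrier[OF N(1) that] .
  let ?K = "{g \<in> N. h g = \<one>\<^bsub>H\<^esub>}"
  have fib: "card {g \<in> N. h g = y} = card ?K" if y: "y \<in> h ` N" for y
  proof -
    obtain a where a: "a \<in> N" "h a = y" using y by auto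
    have "bij_betw (\<lambda>g. a \<otimes>\<^bsub>G\<^esub> g) ?K {g \<in> N. h g = y}"
    proof (rule bij_betw_byWitness[where f' = "\<lambda>g. inv\<^bsub>G\<^esub> a \<otimes>\<^bsub>G\<^esub> g"])
      show "\<forall>g\<in>?K. inv\<^bsub>G\<^esub> a \<otimes>\<^bsub>G\<^esub> (a \<otimes>\<^bsub>G\<^esub> g) = g"
        using a Nc by (simp add: G.m_assoc[symmetric])
      show "\<forall>g\<in>{g \<in> N. h g = y}. a \<otimes>\<^bsub>G\<^esub> (inv\<^bsub>G\<^esub> a \<otimes>\<^bsub>G\<^esub> g) = g"
        using a Nc by (simp add: G.m_assoc[symmetric])
      show "(\<otimes>\<^bsub>G\<^esub>) a ` ?K \<subseteq> {g \<in> N. h g = y}"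
        using a mul hc subgroup.m_closed[OF N(1)] by auto
      show "(\<lambda>g. inv\<^bsub>G\<^esub> a \<otimes>\<^bsub>G\<^esub> g) ` {g \<in> N. h g = y} \<subseteq> ?K"
        using a mul hc inv subgroup.m_closed[OF N(1)] subgroup.m_inv_closed[OF N(1)] by auto
    qed
    thus ?thesis by (simp add: bij_betw_same_card)
  qed
  have "N = (\<Union>y\<in>h ` N. {g \<in> N. h g = y})" by auto
  hence "card N = card (\<Union>y\<in>h ` N. {g \<in> N. h g = y})" by simp
  also have "\<dots> = (\<Sum>y\<in>h ` N. card {g \<in> N. h g = y})"
    using finN by (intro card_UN_disjoint) auto
  also have "\<dots> = card (h ` N) * card ?K" using fib by simp
  finally show ?thesis .
qed

lemma (in group) lower_central_in_carrier: "lower_central G n \<subseteq> carrier G"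
proof (induction n)
  case (Suc n)
  show ?case unfolding lower_central.simps
    by (rule generate_incl) (use Suc in blast)
qed simp

text \<open>Commutators go to commutators, and surjectivity lets the second entry run through the
  whole of \<open>H\<close>.\<close>

lemma (in group_hom) lower_central_img:
  assumes "h ` carrier G = carrier H"
  shows "lower_central H n = h ` lower_central G n"
proof (induction n)
  case 0 thus ?case using assms by simp
next
  case (Suc n)
  note c = G.lower_central_in_carrier[of n]
  let ?U = "\<Union>x \<in> lower_central G n. \<Union>y \<in> carrier G. {x \<otimes> y \<otimes> inv x \<otimes> inv y}"
  have U: "?U \<subseteq> carrier G" using c by blast
  have eq: "h (x \<otimes> y \<otimes> inv x \<otimes> inv y) = h x \<otimes>\<^bsub>H\<^esub> h y \<otimes>\<^bsub>H\<^esub> inv\<^bsub>H\<^esub> h x \<otimes>\<^bsub>H\<^esub> inv\<^bsub>H\<^esub> h y"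
    if "x \<in> lower_central G n" "y \<in> carrier G" for x y
    using that c by (simp add: subset_iff)
  have "(\<Union>x \<in> lower_central H n. \<Union>y \<in> carrier H.
      {x \<otimes>\<^bsub>H\<^esub> y \<otimes>\<^bsub>H\<^esub> inv\<^bsub>H\<^esub> x \<otimes>\<^bsub>H\<^esub> inv\<^bsub>H\<^esub> y}) = h ` ?U"
    unfolding Suc assms[symmetric] image_UN by (auto simp: eq[symmetric] simp del: hom_mult)
  thus ?case using generate_img[OF U] by simp
qed

lemma (in group) lower_central_subgroup_mono:
  assumes "subgroup M G"
  shows "lower_central (G\<lparr>carrier := M\<rparr>) n \<subseteq> lower_central G n"
proof (induction n)
  case 0 show ?case using subgroup.subset[OF assms] by simp
next
  case (Suc n)
  interpret M: group "G\<lparr>carrier := M\<rparr>" using assms by (rule subgroup_imp_group)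
  let ?M = "G\<lparr>carrier := M\<rparr>"
  let ?U = "\<Union>x \<in> lower_central ?M n. \<Union>y \<in> M. {x \<otimes> y \<otimes> inv\<^bsub>?M\<^esub> x \<otimes> inv\<^bsub>?M\<^esub> y}"
  have c: "lower_central ?M n \<subseteq> M" using M.lower_central_in_carrier[of n] by simp
  have U: "?U \<subseteq> M" using c M.m_closed M.inv_closed by auto
  have "?U \<subseteq> (\<Union>x \<in> lower_central G n. \<Union>y \<in> carrier G. {x \<otimes> y \<otimes> inv x \<otimes> inv y})"
    using Suc c subgroup.subset[OF assms] m_inv_consistent[OF assms] by fastforce
  hence "generate G ?U \<subseteq> lower_central G (Suc n)" unfolding lower_central.simps by (rule mono_generate)
  moreover have "generate ?M ?U = generate G ?U" using generate_consistent[OF U assms] by simp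
  ultimately show ?case by simp
qed

lemma (in group) nilpotent_subgroup:
  assumes "nilpotent_group G" "subgroup M G"
  shows "nilpotent_group (G\<lparr>carrier := M\<rparr>)"
proof -
  interpret M: group "G\<lparr>carrier := M\<rparr>" using assms(2) by (rule subgroup_imp_group)
  obtain n where "lower_central G n = {\<one>}" using assms by (auto simp: nilpotent_group_def)
  hence le: "lower_central (G\<lparr>carrier := M\<rparr>) n \<subseteq> {\<one>}"
    using lower_central_subgroup_mono[OF assms(2), of n] by simp
  \<comment> \<open>Comparing the two series gives only an inclusion, while
    \<open>nilpotent_group\<close> asks for equality with the trivial subgroup.\<close>
  have "\<one> \<in> lower_central (G\<lparr>carrier := M\<rparr>) n"
    using M.one_closed by (cases n) (auto intro: generate.one[of "G\<lparr>carrier := M\<rparr>", simplified])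
  thus ?thesis using le by (auto simp: nilpotent_group_def)
qed

lemma nilpotent_hom_image:
  assumes G: "group G" and H: "group H" and L: "subgroup L G" and h: "h \<in> hom (G\<lparr>carrier := L\<rparr>) H"
    and N: "subgroup N G" "N \<subseteq> L" and nil: "nilpotent_group (G\<lparr>carrier := N\<rparr>)"
  shows "subgroup (h ` N) H" and "nilpotent_group (H\<lparr>carrier := h ` N\<rparr>)"
proof -
  interpret G: group G by fact
  interpret H: group H by fact
  interpret h: group_hom "G\<lparr>carrier := N\<rparr>" H h
    using G.subgroup_imp_group[OF N(1)] H h N(2)
    by (auto simp: group_hom_def group_hom_axioms_def hom_def Pi_def subset_iff)
  show sub: "subgroup (h ` N) H" using h.img_is_subgroup by simp
  interpret h': group_hom "G\<lparr>carrier := N\<rparr>" "H\<lparr>carrier := h ` N\<rparr>" h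
    using h.group_hom_axioms H.subgroup_imp_group[OF sub]
    by (auto simp: group_hom_def group_hom_axioms_def hom_def)
  obtain n where n: "lower_central (G\<lparr>carrier := N\<rparr>) n = {\<one>\<^bsub>G\<^esub>}"
    using nil by (auto simp: nilpotent_group_def)
  have "lower_central (H\<lparr>carrier := h ` N\<rparr>) n = {h \<one>\<^bsub>G\<^esub>}"
    using h'.lower_central_img[of n] n by simp
  thus "nilpotent_group (H\<lparr>carrier := h ` N\<rparr>)"
    using h.hom_one by (auto simp: nilpotent_group_def)
qed

text \<open>The last nontrivial term of the lower central series is central: its commutators with
  the whole group lie in the next term, which is trivial.\<close>

lemma (in group) nilpotent_nontrivial_center:
  assumes nil: "nilpotent_group G" and nt: "carrier G \<noteq> {\<one>}"
  obtains z where "z \<in> carrier G" "z \<noteq> \<one>" "\<And>y. y \<in> carrier G \<Longrightarrow> z \<otimes> y = y \<otimes> z"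
proof -
  obtain n where n: "lower_central G n = {\<one>}" "\<And>m. m < n \<Longrightarrow> lower_central G m \<noteq> {\<one>}"
    using nil exists_least_iff[of "\<lambda>n. lower_central G n = {\<one>}"]
    by (auto simp: nilpotent_group_def)
  then obtain m where m: "n = Suc m" using nt by (cases n) auto
  have "\<one> \<in> lower_central G m" by (cases m) (auto intro: generate.one)
  then obtain z where z: "z \<in> lower_central G m" "z \<noteq> \<one>" using n(2)[of m] m by auto
  have zc: "z \<in> carrier G" using z lower_central_in_carrier by blast
  have "z \<otimes> y = y \<otimes> z" if y: "y \<in> carrier G" for y
  proof -
    have "z \<otimes> y \<otimes> inv z \<otimes> inv y \<in> lower_central G (Suc m)"
      unfolding lower_central.simps using z(1) y by (intro generate.incl) blast
    hence "z \<otimes> y \<otimes> inv z \<otimes> inv y = \<one>" using n m by simp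
    hence "z \<otimes> y \<otimes> inv z = y"
      using y zc by (metis inv_closed inv_equality inv_inv m_closed)
    thus ?thesis using y zc by (metis inv_closed inv_solve_right m_closed)
  qed
  thus ?thesis using that z zc by blast
qed

text \<open>For finite subgroups \<open>S \<subseteq> L\<close>, \<open>tame G L S\<close> says \<open>\<bar>L : S\<bar> \<ge> \<nu>(S)\<close>.\<close>

definition tame :: "('g, 'm) monoid_scheme \<Rightarrow> 'g set \<Rightarrow> 'g set \<Rightarrow> bool" where
  "tame G L S \<longleftrightarrow> (\<forall>N. subgroup N G \<and> N \<subseteq> S \<and> nilpotent_group (G\<lparr>carrier := N\<rparr>) \<longrightarrow>
    card N * card S \<le> card L)"

lemma tameD:
  "tame G L S \<Longrightarrow> subgroup N G \<Longrightarrow> N \<subseteq> S \<Longrightarrow> nilpotent_group (G\<lparr>carrier := N\<rparr>) \<Longrightarrow>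
    card N * card S \<le> card L"
  by (auto simp: tame_def)

text \<open>This is \<nu>(X) \<le> \<nu>(N) \<nu>(X/N) in product form: the orders of
  \<open>N\<close>, \<open>S\<close> and \<open>L\<close> each split into the order of an image
  under \<open>h\<close> and that of a kernel, and the two given inequalities multiply. Since
  \<open>S'\<close> has only to contain the image of \<open>S\<close>, the stabiliser of a set may
  induce less than the full stabiliser in the quotient.\<close>

lemma tame_extension:
  assumes G: "group G" and H: "group H" and h: "h \<in> hom (G\<lparr>carrier := L\<rparr>) H"
    and L: "subgroup L G" and S: "subgroup S G" "S \<subseteq> L" and fin: "finite L"
    and img: "tame H (h ` L) S'" "h ` S \<subseteq> S'" "finite S'"
    and ker: "tame G {g \<in> L. h g = \<one>\<^bsub>H\<^esub>} {g \<in> S. h g = \<one>\<^bsub>H\<^esub>}"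
  shows "tame G L S"
  unfolding tame_def
proof (intro allI impI, elim conjE)
  fix N assume N: "subgroup N G" "N \<subseteq> S" "nilpotent_group (G\<lparr>carrier := N\<rparr>)"
  interpret G: group G by fact
  interpret N: group "G\<lparr>carrier := N\<rparr>" using N(1) by (rule G.subgroup_imp_group)
  interpret hN: group_hom "G\<lparr>carrier := N\<rparr>" H h
    using H h N(2) S N.group_axioms
    by (auto simp: group_hom_def group_hom_axioms_def hom_def Pi_def subset_iff)
  let ?k = "\<lambda>A. {g \<in> A. h g = \<one>\<^bsub>H\<^esub>}"
  have kN: "subgroup (?k N) (G\<lparr>carrier := N\<rparr>)"
    using hN.subgroup_kernel by (simp add: kernel_def)
  have kN': "subgroup (?k N) G" using G.incl_subgroup[OF N(1) kN] .
  have "nilpotent_group (G\<lparr>carrier := ?k N\<rparr>)"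
    using N.nilpotent_subgroup[OF N(3) kN] by simp
  hence 1: "card (?k N) * card (?k S) \<le> card (?k L)"
    using tameD[OF ker kN'] N(2) by auto
  have NL: "N \<subseteq> L" using N S by blast
  note nh = nilpotent_hom_image[OF G H L h N(1) NL N(3)]
  have "card (h ` N) * card (h ` S) \<le> card (h ` N) * card S'"
    using img by (simp add: card_mono)
  also have "\<dots> \<le> card (h ` L)" using tameD[OF img(1) nh(1) _ nh(2)] img(2) N(2) by blast
  finally have 2: "card (h ` N) * card (h ` S) \<le> card (h ` L)" .
  have "card N * card S = (card (h ` N) * card (h ` S)) * (card (?k N) * card (?k S))"
    using card_hom_image_kernel[OF G H h L N(1) NL fin]
      card_hom_image_kernel[OF G H h L S fin] by (simp add: algebra_simps)
  also have "\<dots> \<le> card (h ` L) * card (?k L)" using 1 2 by (rule mult_le_mono[rotated])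
  also have "\<dots> = card L"
    using card_hom_image_kernel[OF G H h L L _ fin] by simp
  finally show "card N * card S \<le> card L" .
qed

section \<open>Permutation groups and their orbits\<close>

lemma carrier_BijGroup [simp]: "carrier (BijGroup S) = Bij S"
  by (simp add: BijGroup_def)

lemma Bij_group_closed [simp]:
  "f \<in> Bij S \<Longrightarrow> inv\<^bsub>BijGroup S\<^esub> f \<in> Bij S"
  "f \<in> Bij S \<Longrightarrow> g \<in> Bij S \<Longrightarrow> f \<otimes>\<^bsub>BijGroup S\<^esub> g \<in> Bij S"
  "\<one>\<^bsub>BijGroup S\<^esub> \<in> Bij S"
  using group.inv_closed[OF group_BijGroup, of f S]
    monoid.m_closed[OF group.is_monoid[OF group_BijGroup], of f S g]
    monoid.one_closed[OF group.is_monoid[OF group_BijGroup], of S] by simp_all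

lemma BijGroup_mult_apply:
  "f \<in> Bij S \<Longrightarrow> g \<in> Bij S \<Longrightarrow> x \<in> S \<Longrightarrow> (f \<otimes>\<^bsub>BijGroup S\<^esub> g) x = f (g x)"
  by (simp add: BijGroup_def compose_def)

lemma BijGroup_one_apply: "x \<in> S \<Longrightarrow> \<one>\<^bsub>BijGroup S\<^esub> x = x"
  by (simp add: BijGroup_def)

lemma Bij_closed: "f \<in> Bij S \<Longrightarrow> x \<in> S \<Longrightarrow> f x \<in> S"
  using Bij_imp_funcset by fast

lemma Bij_eqI:
  "f \<in> Bij S \<Longrightarrow> g \<in> Bij S \<Longrightarrow> (\<And>x. x \<in> S \<Longrightarrow> f x = g x) \<Longrightarrow> f = g"
  using Bij_imp_extensional extensionalityI by metis

lemma Bij_inj_on: "f \<in> Bij S \<Longrightarrow> inj_on f S"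
  by (simp add: Bij_def bij_betw_def)

lemma Bij_image: "f \<in> Bij S \<Longrightarrow> f ` S = S"
  by (simp add: Bij_def bij_betw_def)

lemma BijGroup_inv_apply:
  assumes "f \<in> Bij S" "x \<in> S"
  shows "f ((inv\<^bsub>BijGroup S\<^esub> f) x) = x" "(inv\<^bsub>BijGroup S\<^esub> f) (f x) = x"
proof -
  interpret group "BijGroup S" by (rule group_BijGroup)
  have "inv\<^bsub>BijGroup S\<^esub> f \<in> Bij S" using inv_closed[of f] assms by simp
  thus "f ((inv\<^bsub>BijGroup S\<^esub> f) x) = x" "(inv\<^bsub>BijGroup S\<^esub> f) (f x) = x"
    using r_inv[of f] l_inv[of f] assms BijGroup_one_apply[of x S]
      BijGroup_mult_apply[of f S "inv\<^bsub>BijGroup S\<^esub> f" x]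
      BijGroup_mult_apply[of "inv\<^bsub>BijGroup S\<^esub> f" S f x] by simp_all
qed

lemma Bij_eq_one_iff: "f \<in> Bij S \<Longrightarrow> f = \<one>\<^bsub>BijGroup S\<^esub> \<longleftrightarrow> (\<forall>x\<in>S. f x = x)"
  by (metis BijGroup_one_apply Bij_eqI BijGroup_def id_Bij monoid.select_convs(2))

lemma finite_Bij: "finite S \<Longrightarrow> finite (Bij S)"
proof -
  assume fin: "finite S"
  have "Bij S \<subseteq> S \<rightarrow>\<^sub>E S" by (auto simp: Bij_def PiE_def dest: bij_betw_imp_funcset)
  thus ?thesis using finite_PiE[OF fin, of "\<lambda>_. S"] fin finite_subset by blast
qed

lemma subgroup_BijD:
  assumes "subgroup P (BijGroup S)"
  shows "P \<subseteq> Bij S" "f \<in> P \<Longrightarrow> f \<in> Bij S" "\<one>\<^bsub>BijGroup S\<^esub> \<in> P"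
    "f \<in> P \<Longrightarrow> g \<in> P \<Longrightarrow> f \<otimes>\<^bsub>BijGroup S\<^esub> g \<in> P"
    "f \<in> P \<Longrightarrow> inv\<^bsub>BijGroup S\<^esub> f \<in> P"
    "f \<in> P \<Longrightarrow> x \<in> S \<Longrightarrow> f x \<in> S"
  using subgroup.subset[OF assms] subgroup.one_closed[OF assms] subgroup.m_closed[OF assms]
    subgroup.m_inv_closed[OF assms] Bij_closed[of f S x] by auto

lemma subgroup_BijI:
  assumes "N \<subseteq> P" "subgroup P (BijGroup S)" "\<one>\<^bsub>BijGroup S\<^esub> \<in> N"
    and "\<And>f g. f \<in> N \<Longrightarrow> g \<in> N \<Longrightarrow> f \<otimes>\<^bsub>BijGroup S\<^esub> g \<in> N"
    and "\<And>f. f \<in> N \<Longrightarrow> inv\<^bsub>BijGroup S\<^esub> f \<in> N"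
  shows "subgroup N (BijGroup S)"
  using assms subgroup_BijD(1)[OF assms(2)]
  by (intro group.subgroupI[OF group_BijGroup]) auto

lemma image_eq_subset_card:
  assumes "f \<in> Bij S" "D \<subseteq> S" "finite S" "f ` D \<subseteq> D"
  shows "f ` D = D"
  by (rule card_subset_eq)
    (use assms card_image[OF inj_on_subset[OF Bij_inj_on]] finite_subset in auto)

section \<open>Setwise stabilisers and restriction to an invariant set\<close>

text \<open>Taken for a plain set of permutations, so that stabilisers in \<open>P\<close>, in a
  kernel and in their restrictions to an orbit are written alike.\<close>

definition stab :: "('a \<Rightarrow> 'a) set \<Rightarrow> 'a set \<Rightarrow> ('a \<Rightarrow> 'a) set" where
  "stab P D = {g \<in> P. g ` D = D}"

lemma subgroup_stab:
  assumes "subgroup P (BijGroup S)" "D \<subseteq> S"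
  shows "subgroup (stab P D) (BijGroup S)"
proof (rule subgroup_BijI[OF _ assms(1)])
  note P = subgroup_BijD[OF assms(1)]
  show "stab P D \<subseteq> P" by (auto simp: stab_def)
  show "\<one>\<^bsub>BijGroup S\<^esub> \<in> stab P D"
    using assms P(3) by (auto simp: stab_def BijGroup_one_apply image_iff subset_iff)
  fix f assume f: "f \<in> stab P D"
  show "inv\<^bsub>BijGroup S\<^esub> f \<in> stab P D"
  proof -
    have fP: "f \<in> P" "f ` D = D" using f by (auto simp: stab_def)
    have "(inv\<^bsub>BijGroup S\<^esub> f) ` f ` D = D"
      unfolding image_image using BijGroup_inv_apply(2)[of f S] fP(1) P(2) assms(2)
      by (auto simp: image_iff subset_iff)
    thus ?thesis using fP P(5) by (simp add: stab_def)
  qed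
  fix g assume g: "g \<in> stab P D"
  have "(f \<otimes>\<^bsub>BijGroup S\<^esub> g) ` D = f ` g ` D"
    unfolding image_image
    by (rule image_cong) (use f g assms(2) P(2) in \<open>auto simp: stab_def BijGroup_mult_apply\<close>)
  thus "f \<otimes>\<^bsub>BijGroup S\<^esub> g \<in> stab P D"
    using f g P(4) by (auto simp: stab_def)
qed

lemma restrict_Bij:
  assumes "f \<in> Bij S" "D \<subseteq> S" "f ` D = D"
  shows "restrict f D \<in> Bij D"
  using inj_on_subset[OF Bij_inj_on[OF assms(1)] assms(2)] assms(3)
  by (auto simp: Bij_def bij_betw_def)

text \<open>\<open>Bij\<close> consists of extensional functions, so the restricted map has to be
  \<open>undefined\<close> off \<open>D\<close>; multiplicativity is then checked pointwise on
  \<open>D\<close>.\<close>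

lemma restrict_hom:
  assumes "subgroup P (BijGroup S)" "D \<subseteq> S" "\<And>g. g \<in> P \<Longrightarrow> g ` D = D"
  shows "(\<lambda>g. restrict g D) \<in> hom (BijGroup S\<lparr>carrier := P\<rparr>) (BijGroup D)"
proof (rule homI)
  note P = subgroup_BijD[OF assms(1)]
  fix g assume g: "g \<in> carrier (BijGroup S\<lparr>carrier := P\<rparr>)"
  show r: "restrict g D \<in> carrier (BijGroup D)"
    using restrict_Bij[of g S D] g assms P by auto
  fix h assume h: "h \<in> carrier (BijGroup S\<lparr>carrier := P\<rparr>)"
  show "restrict (g \<otimes>\<^bsub>BijGroup S\<lparr>carrier := P\<rparr>\<^esub> h) D = restrict g D \<otimes>\<^bsub>BijGroup D\<^esub> restrict h D"
  proof (rule Bij_eqI[of _ D])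
    show "restrict (g \<otimes>\<^bsub>BijGroup S\<lparr>carrier := P\<rparr>\<^esub> h) D \<in> Bij D"
      using restrict_Bij[of _ S D] g h assms P by auto
    show "restrict g D \<otimes>\<^bsub>BijGroup D\<^esub> restrict h D \<in> Bij D"
      using restrict_Bij[of _ S D] g h assms P
        group.subgroup_self[OF group_BijGroup[of D], THEN subgroup.m_closed] by auto
    fix x assume "x \<in> D"
    thus "restrict (g \<otimes>\<^bsub>BijGroup S\<lparr>carrier := P\<rparr>\<^esub> h) D x = (restrict g D \<otimes>\<^bsub>BijGroup D\<^esub> restrict h D) x"
      using g h assms(2,3) P restrict_Bij[of _ S D]
      by (auto simp: BijGroup_mult_apply subset_iff image_iff)
  qed
qed

lemma restrict_eq_one_iff:
  "restrict g D = \<one>\<^bsub>BijGroup D\<^esub> \<longleftrightarrow> (\<forall>x\<in>D. g x = x)"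
  by (auto simp: BijGroup_def restrict_def fun_eq_iff)

section \<open>Orbits of a normal subgroup and the action on them\<close>

definition porb :: "('a \<Rightarrow> 'a) set \<Rightarrow> 'a \<Rightarrow> 'a set" where
  "porb M x = (\<lambda>m. m x) ` M"

text \<open>The choice depends only on the set \<open>porb M x\<close>, so it is constant on orbits.
  Representatives stand for orbits in order that the quotient group again permutes elements of type
  \<open>'a\<close>, as an induction on the degree requires.\<close>

definition prep :: "('a \<Rightarrow> 'a) set \<Rightarrow> 'a \<Rightarrow> 'a" where
  "prep M x = (SOME y. y \<in> porb M x)"

text \<open>The permutation of orbits induced by \<open>g\<close>, carried over to the
  representatives and made extensional there.\<close>

definition pquot :: "('a \<Rightarrow> 'a) set \<Rightarrow> 'a set \<Rightarrow> ('a \<Rightarrow> 'a) \<Rightarrow> 'a \<Rightarrow> 'a" where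
  "pquot M S g = (\<lambda>x \<in> prep M ` S. prep M (g x))"

context
  fixes M :: "('a \<Rightarrow> 'a) set" and S :: "'a set"
  assumes M: "subgroup M (BijGroup S)"
begin

lemma porb_self: "x \<in> S \<Longrightarrow> x \<in> porb M x"
  unfolding porb_def using subgroup_BijD(3)[OF M] BijGroup_one_apply[of x S] by (metis image_eqI)

lemma porb_subset: "x \<in> S \<Longrightarrow> porb M x \<subseteq> S"
  using subgroup_BijD(6)[OF M] by (auto simp: porb_def)

lemma porb_eq:
  assumes "x \<in> S" "y \<in> porb M x"
  shows "porb M y = porb M x"
proof -
  note P = subgroup_BijD[OF M]
  have sub: "porb M y \<subseteq> porb M x" if xy: "x \<in> S" "y \<in> porb M x" for x y
  proof
    fix z assume "z \<in> porb M y"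
    then obtain m where m: "m \<in> M" "z = m y" by (auto simp: porb_def)
    obtain n where "n \<in> M" "y = n x" using xy(2) unfolding porb_def by blast
    note mn = m(1) this m(2)
    hence "z = (m \<otimes>\<^bsub>BijGroup S\<^esub> n) x" "m \<otimes>\<^bsub>BijGroup S\<^esub> n \<in> M"
      using P(2,4) xy(1) mn by (simp_all add: BijGroup_mult_apply)
    thus "z \<in> porb M x" by (auto simp: porb_def)
  qed
  obtain m where m: "m \<in> M" "y = m x" using assms by (auto simp: porb_def)
  hence "x = (inv\<^bsub>BijGroup S\<^esub> m) y" using assms P by (simp add: BijGroup_inv_apply)
  hence "x \<in> porb M y" using m P by (auto simp: porb_def)
  thus ?thesis using sub assms porb_subset by blast
qed

lemma porb_eq_iff: "x \<in> S \<Longrightarrow> y \<in> S \<Longrightarrow> porb M x = porb M y \<longleftrightarrow> y \<in> porb M x"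
  using porb_eq porb_self by blast

lemma porb_disjoint: "x \<in> S \<Longrightarrow> y \<in> S \<Longrightarrow> porb M x \<noteq> porb M y \<Longrightarrow> porb M x \<inter> porb M y = {}"
  using porb_eq by blast

lemma prep_in: "x \<in> S \<Longrightarrow> prep M x \<in> porb M x"
  unfolding prep_def using porb_self by (metis someI)

lemma prep_in_S: "x \<in> S \<Longrightarrow> prep M x \<in> S"
  using prep_in porb_subset by blast

lemma porb_prep: "x \<in> S \<Longrightarrow> porb M (prep M x) = porb M x"
  using porb_eq prep_in by blast

lemma prep_eq_iff: "x \<in> S \<Longrightarrow> y \<in> S \<Longrightarrow> prep M x = prep M y \<longleftrightarrow> porb M x = porb M y"
  by (metis porb_prep prep_def)

lemma prep_prep: "x \<in> S \<Longrightarrow> prep M (prep M x) = prep M x"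
  by (simp add: prep_eq_iff prep_in_S porb_prep)

lemma porb_mem_image: "m \<in> M \<Longrightarrow> x \<in> S \<Longrightarrow> m ` porb M x = porb M x"
proof -
  note P = subgroup_BijD[OF M]
  assume m: "m \<in> M" and x: "x \<in> S"
  have sub: "m ` porb M x \<subseteq> porb M x" if "m \<in> M" for m
  proof
    fix z assume "z \<in> m ` porb M x"
    then obtain y where y: "y \<in> porb M x" "z = m y" by auto
    hence "z \<in> porb M y" using that by (auto simp: porb_def)
    thus "z \<in> porb M x" using porb_eq[OF x y(1)] by simp
  qed
  have "porb M x \<subseteq> m ` porb M x"
  proof
    fix y assume y: "y \<in> porb M x"
    have "(inv\<^bsub>BijGroup S\<^esub> m) y \<in> porb M x" using sub[of "inv\<^bsub>BijGroup S\<^esub> m"] P m y by blast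
    moreover have "y = m ((inv\<^bsub>BijGroup S\<^esub> m) y)"
      using BijGroup_inv_apply(1)[of m S y] P(2)[OF m] y porb_subset[OF x] by (simp add: subset_iff)
    ultimately show "y \<in> m ` porb M x" by blast
  qed
  thus ?thesis using sub[OF m] by blast
qed

context
  fixes P :: "('a \<Rightarrow> 'a) set"
  assumes P: "subgroup P (BijGroup S)"
    and nrm: "\<forall>g\<in>P. \<forall>m\<in>M.
      g \<otimes>\<^bsub>BijGroup S\<^esub> m \<otimes>\<^bsub>BijGroup S\<^esub> inv\<^bsub>BijGroup S\<^esub> g \<in> M"
begin

text \<open>Normality rewrites g m x as (g m g^-1)(g x); the reverse inclusion is the same fact for
  the inverse of g.\<close>

lemma porb_image:
  assumes "g \<in> P" "x \<in> S"
  shows "g ` porb M x = porb M (g x)"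
proof -
  note Q = subgroup_BijD[OF P] and MM = subgroup_BijD[OF M]
  interpret G: group "BijGroup S" by (rule group_BijGroup)
  have sub: "g ` porb M x \<subseteq> porb M (g x)" if "g \<in> P" "x \<in> S" for g x
  proof
    fix y assume "y \<in> g ` porb M x"
    then obtain m where m: "m \<in> M" "y = g (m x)" by (auto simp: porb_def)
    let ?n = "g \<otimes>\<^bsub>BijGroup S\<^esub> m \<otimes>\<^bsub>BijGroup S\<^esub> inv\<^bsub>BijGroup S\<^esub> g"
    have "?n \<otimes>\<^bsub>BijGroup S\<^esub> g = g \<otimes>\<^bsub>BijGroup S\<^esub> m"
      using Q(2)[OF that(1)] MM(2)[OF m(1)] by (simp add: G.m_assoc)
    moreover have "(?n \<otimes>\<^bsub>BijGroup S\<^esub> g) x = ?n (g x)" "(g \<otimes>\<^bsub>BijGroup S\<^esub> m) x = y"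
      using Q(2)[OF that(1)] MM(2)[OF m(1)] m that(2)
        BijGroup_mult_apply[of ?n S g x] by (simp_all add: BijGroup_mult_apply[of g S m x])
    ultimately have "?n (g x) = y" by simp
    thus "y \<in> porb M (g x)" unfolding porb_def using nrm[rule_format, OF that(1) m(1)] by (metis image_eqI)
  qed
  have "porb M (g x) \<subseteq> g ` porb M x"
  proof
    fix y assume y: "y \<in> porb M (g x)"
    have yS: "y \<in> S" using y porb_subset[OF Q(6)[OF assms]] by blast
    have "(inv\<^bsub>BijGroup S\<^esub> g) y \<in> porb M ((inv\<^bsub>BijGroup S\<^esub> g) (g x))"
      by (rule subsetD[OF sub[OF Q(5)[OF assms(1)] Q(6)[OF assms]]]) (use y in simp)
    hence "(inv\<^bsub>BijGroup S\<^esub> g) y \<in> porb M x"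
      unfolding BijGroup_inv_apply(2)[OF Q(2)[OF assms(1)] assms(2)] .
    moreover have "y = g ((inv\<^bsub>BijGroup S\<^esub> g) y)"
      using BijGroup_inv_apply(1)[OF Q(2)[OF assms(1)] yS] by simp
    ultimately show "y \<in> g ` porb M x" by blast
  qed
  thus ?thesis using sub[OF assms] by blast
qed

lemma prep_apply_prep: "g \<in> P \<Longrightarrow> x \<in> S \<Longrightarrow> prep M (g (prep M x)) = prep M (g x)"
  using porb_image[of g x] porb_image[of g "prep M x"] porb_prep[of x] prep_in_S[of x]
    subgroup_BijD(6)[OF P] by (simp add: prep_eq_iff)

lemma pquot_prep: "g \<in> P \<Longrightarrow> x \<in> S \<Longrightarrow> pquot M S g (prep M x) = prep M (g x)"
  by (simp add: pquot_def prep_apply_prep)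

lemma pquot_hom: "pquot M S \<in> hom (BijGroup S\<lparr>carrier := P\<rparr>) (BijGroup (prep M ` S))"
proof (rule homI)
  note Q = subgroup_BijD[OF P]
  interpret G: group "BijGroup S" by (rule group_BijGroup)
  interpret H: group "BijGroup (prep M ` S)" by (rule group_BijGroup)
  have closed: "pquot M S g \<in> Bij (prep M ` S)" if g: "g \<in> P" for g
  proof -
    have "inj_on (pquot M S g) (prep M ` S)"
    proof (rule inj_onI)
      fix x y assume "x \<in> prep M ` S" "y \<in> prep M ` S" and e: "pquot M S g x = pquot M S g y"
      then obtain u v where uv: "u \<in> S" "v \<in> S" "x = prep M u" "y = prep M v" by auto
      have "porb M (g u) = porb M (g v)"
        using e uv g Q(6) by (simp add: pquot_prep prep_eq_iff)
      hence "g ` porb M u = g ` porb M v" using porb_image g uv by simp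
      hence "porb M u = porb M v"
        using inj_on_image_eq_iff[OF Bij_inj_on[OF Q(2)[OF g]]] porb_subset uv by blast
      thus "x = y" using uv by (simp add: prep_eq_iff)
    qed
    moreover have "pquot M S g ` prep M ` S = prep M ` S"
    proof -
      have "pquot M S g ` prep M ` S = prep M ` g ` S" using pquot_prep g by (auto simp: image_iff)
      thus ?thesis using Bij_image[OF Q(2)[OF g]] by simp
    qed
    ultimately show ?thesis by (auto simp: Bij_def bij_betw_def pquot_def)
  qed
  fix g assume "g \<in> carrier (BijGroup S\<lparr>carrier := P\<rparr>)"
  hence g: "g \<in> P" by simp
  show "pquot M S g \<in> carrier (BijGroup (prep M ` S))" using closed g by simp
  fix h assume "h \<in> carrier (BijGroup S\<lparr>carrier := P\<rparr>)"
  hence h: "h \<in> P" by simp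
  have "pquot M S (g \<otimes>\<^bsub>BijGroup S\<^esub> h) = pquot M S g \<otimes>\<^bsub>BijGroup (prep M ` S)\<^esub> pquot M S h"
  proof (rule Bij_eqI)
    show "pquot M S (g \<otimes>\<^bsub>BijGroup S\<^esub> h) \<in> Bij (prep M ` S)" using closed Q(4) g h by simp
    show "pquot M S g \<otimes>\<^bsub>BijGroup (prep M ` S)\<^esub> pquot M S h \<in> Bij (prep M ` S)"
      using closed[OF g] closed[OF h] H.m_closed by simp
    fix x assume "x \<in> prep M ` S"
    then obtain u where u: "u \<in> S" "x = prep M u" by auto
    show "pquot M S (g \<otimes>\<^bsub>BijGroup S\<^esub> h) x = (pquot M S g \<otimes>\<^bsub>BijGroup (prep M ` S)\<^esub> pquot M S h) x"
      using u g h Q by (simp add: BijGroup_mult_apply closed pquot_prep)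
  qed
  thus "pquot M S (g \<otimes>\<^bsub>BijGroup S\<lparr>carrier := P\<rparr>\<^esub> h) = pquot M S g \<otimes>\<^bsub>BijGroup (prep M ` S)\<^esub> pquot M S h" by simp
qed

lemma pquot_eq_one_iff:
  assumes "g \<in> P"
  shows "pquot M S g = \<one>\<^bsub>BijGroup (prep M ` S)\<^esub> \<longleftrightarrow> (\<forall>x\<in>S. g x \<in> porb M x)"
proof -
  have "pquot M S g = \<one>\<^bsub>BijGroup (prep M ` S)\<^esub> \<longleftrightarrow> (\<forall>y\<in>prep M ` S. pquot M S g y = y)"
    using hom_in_carrier[OF pquot_hom, of g] assms by (intro Bij_eq_one_iff) simp
  also have "\<dots> \<longleftrightarrow> (\<forall>x\<in>S. prep M (g x) = prep M x)"
    using assms by (simp add: pquot_prep)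
  also have "\<dots> \<longleftrightarrow> (\<forall>x\<in>S. g x \<in> porb M x)"
    using assms subgroup_BijD(6)[OF P] by (metis porb_eq_iff prep_eq_iff)
  finally show ?thesis .
qed

end

end

section \<open>The order of a nilpotent permutation group\<close>

text \<open>Induct on the degree n through the orbits of the centre Z of \<open>N\<close>. If there
  are r of them, the action on them contributes at most 2^(r-1). An element preserving every Z-orbit
  commutes with Z, so it is determined by the images of r representatives, each inside its own
  orbit; as k \<le> 2^(k-1), this contributes at most 2^(n-r).\<close>

lemma nilpotent_perm_group_card_le:
  assumes "finite E" "E \<noteq> {}" "subgroup N (BijGroup E)"
    "nilpotent_group (BijGroup E\<lparr>carrier := N\<rparr>)"
  shows "card N \<le> 2 ^ (card E - 1)"
  using assms
proof (induction "card E" arbitrary: E N rule: less_induct)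
  case less
  note fin = less.prems(1) and N = less.prems(3)
  note NB = subgroup_BijD[OF N]
  interpret G: group "BijGroup E" by (rule group_BijGroup)
  interpret N: group "BijGroup E\<lparr>carrier := N\<rparr>" by (rule G.subgroup_imp_group[OF N])
  show ?case
  proof (cases "N = {\<one>\<^bsub>BijGroup E\<^esub>}")
    case False
    obtain z where z: "z \<in> N" "z \<noteq> \<one>\<^bsub>BijGroup E\<^esub>"
      "\<And>y. y \<in> N \<Longrightarrow> z \<otimes>\<^bsub>BijGroup E\<^esub> y = y \<otimes>\<^bsub>BijGroup E\<^esub> z"
      using N.nilpotent_nontrivial_center[OF less.prems(4)] False by auto
    define Z where "Z = {z \<in> N. \<forall>y\<in>N. z \<otimes>\<^bsub>BijGroup E\<^esub> y = y \<otimes>\<^bsub>BijGroup E\<^esub> z}"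
    have ZN: "Z \<subseteq> N" by (auto simp: Z_def)
    have Z: "subgroup Z (BijGroup E)"
    proof (rule subgroup_BijI[OF ZN N])
      show "\<one>\<^bsub>BijGroup E\<^esub> \<in> Z" using NB(2,3) by (auto simp: Z_def)
      fix f g assume "f \<in> Z" "g \<in> Z"
      show "f \<otimes>\<^bsub>BijGroup E\<^esub> g \<in> Z"
      proof -
        have c: "f \<in> Bij E" "g \<in> Bij E" using \<open>f \<in> Z\<close> \<open>g \<in> Z\<close> NB(2) by (auto simp: Z_def)
        have "f \<otimes>\<^bsub>BijGroup E\<^esub> g \<otimes>\<^bsub>BijGroup E\<^esub> y = y \<otimes>\<^bsub>BijGroup E\<^esub> (f \<otimes>\<^bsub>BijGroup E\<^esub> g)"
          if y: "y \<in> N" for y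
        proof -
          have e: "f \<otimes>\<^bsub>BijGroup E\<^esub> y = y \<otimes>\<^bsub>BijGroup E\<^esub> f" "g \<otimes>\<^bsub>BijGroup E\<^esub> y = y \<otimes>\<^bsub>BijGroup E\<^esub> g"
            using \<open>f \<in> Z\<close> \<open>g \<in> Z\<close> y by (auto simp only: Z_def)
          have "f \<otimes>\<^bsub>BijGroup E\<^esub> g \<otimes>\<^bsub>BijGroup E\<^esub> y = f \<otimes>\<^bsub>BijGroup E\<^esub> (g \<otimes>\<^bsub>BijGroup E\<^esub> y)"
            using c NB(2)[OF y] by (simp add: G.m_assoc)
          also have "\<dots> = (f \<otimes>\<^bsub>BijGroup E\<^esub> y) \<otimes>\<^bsub>BijGroup E\<^esub> g"
            unfolding e(2) using c NB(2)[OF y] by (simp add: G.m_assoc)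
          also have "\<dots> = y \<otimes>\<^bsub>BijGroup E\<^esub> (f \<otimes>\<^bsub>BijGroup E\<^esub> g)"
            unfolding e(1) using c NB(2)[OF y] by (simp add: G.m_assoc)
          finally show ?thesis .
        qed
        thus ?thesis using \<open>f \<in> Z\<close> \<open>g \<in> Z\<close> NB(4)[of f g] unfolding Z_def by blast
      qed
    next
      fix f assume f: "f \<in> Z"
      have "inv\<^bsub>BijGroup E\<^esub> f \<otimes>\<^bsub>BijGroup E\<^esub> y = y \<otimes>\<^bsub>BijGroup E\<^esub> inv\<^bsub>BijGroup E\<^esub> f" if "y \<in> N" for y
      proof -
        have c: "f \<in> Bij E" "y \<in> Bij E" using f that NB(2) by (auto simp: Z_def)
        have e: "f \<otimes>\<^bsub>BijGroup E\<^esub> y = y \<otimes>\<^bsub>BijGroup E\<^esub> f" using f that unfolding Z_def by blast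
        have "inv\<^bsub>BijGroup E\<^esub> f \<otimes>\<^bsub>BijGroup E\<^esub> y
          = inv\<^bsub>BijGroup E\<^esub> f \<otimes>\<^bsub>BijGroup E\<^esub> (y \<otimes>\<^bsub>BijGroup E\<^esub> f) \<otimes>\<^bsub>BijGroup E\<^esub> inv\<^bsub>BijGroup E\<^esub> f"
          using c by (simp add: G.m_assoc)
        also have "\<dots> = y \<otimes>\<^bsub>BijGroup E\<^esub> inv\<^bsub>BijGroup E\<^esub> f"
          unfolding e[symmetric] using c by (simp add: G.m_assoc[symmetric])
        finally show ?thesis .
      qed
      thus "inv\<^bsub>BijGroup E\<^esub> f \<in> Z" using f NB(5)[of f] unfolding Z_def by blast
    qed
    have "g \<otimes>\<^bsub>BijGroup E\<^esub> m \<otimes>\<^bsub>BijGroup E\<^esub> inv\<^bsub>BijGroup E\<^esub> g \<in> Z"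
      if "g \<in> N" "m \<in> Z" for g m
    proof -
      have "g \<otimes>\<^bsub>BijGroup E\<^esub> m \<otimes>\<^bsub>BijGroup E\<^esub> inv\<^bsub>BijGroup E\<^esub> g
        = m \<otimes>\<^bsub>BijGroup E\<^esub> (g \<otimes>\<^bsub>BijGroup E\<^esub> inv\<^bsub>BijGroup E\<^esub> g)"
      proof -
        have "m \<otimes>\<^bsub>BijGroup E\<^esub> g = g \<otimes>\<^bsub>BijGroup E\<^esub> m" using that unfolding Z_def by blast
        thus ?thesis using that NB(2) ZN G.m_assoc[of m g "inv\<^bsub>BijGroup E\<^esub> g"] by (simp add: subset_iff)
      qed
      thus ?thesis using that NB(2) ZN by (simp add: subset_iff)
    qed
    hence nrm: "\<forall>g\<in>N. \<forall>m\<in>Z. g \<otimes>\<^bsub>BijGroup E\<^esub> m \<otimes>\<^bsub>BijGroup E\<^esub> inv\<^bsub>BijGroup E\<^esub> g \<in> Z" by blast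
    let ?R = "prep Z ` E" and ?h = "pquot Z E"
    note hom = pquot_hom[OF Z N nrm]
    have pE: "?R \<subseteq> E" using prep_in_S[OF Z] by blast
    have finR: "finite ?R" using fin by simp
    \<comment> \<open>A nontrivial central element moves a point, so there are fewer orbits than
      points and the induction hypothesis applies.\<close>
    have "z \<in> Z" using z by (simp add: Z_def)
    obtain x where x: "x \<in> E" "z x \<noteq> x" using Bij_eq_one_iff NB(2) z by blast
    have "z x \<in> porb Z x" using \<open>z \<in> Z\<close> by (auto simp: porb_def)
    hence "prep Z (z x) = prep Z x"
      using porb_eq[OF Z x(1)] prep_def by metis
    hence "\<not> inj_on (prep Z) E" using x NB(6)[OF z(1) x(1)] by (auto simp: inj_on_def)
    hence lt: "card ?R < card E"
      using fin card_image_le[OF fin, of "prep Z"] eq_card_imp_inj_on[OF fin, of "prep Z"] by fastforce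
    have "card (?h ` N) \<le> 2 ^ (card ?R - 1)"
      using less.hyps[OF lt finR]
        nilpotent_hom_image[OF group_BijGroup group_BijGroup N hom N order_refl less.prems(4)]
        less.prems(2) by blast
    moreover have "card {g \<in> N. ?h g = \<one>\<^bsub>BijGroup ?R\<^esub>} \<le> 2 ^ (card E - card ?R)"
    proof -
      let ?L = "{g \<in> N. ?h g = \<one>\<^bsub>BijGroup ?R\<^esub>}"
      have L: "?L = {g \<in> N. \<forall>x\<in>E. g x \<in> porb Z x}"
        using pquot_eq_one_iff[OF Z N nrm] by blast
      \<comment> \<open>If m in \<open>Z\<close> takes the representative to x, commuting with m
        derives the value at x from the value at the representative.\<close>
      have "inj_on (\<lambda>g. restrict g ?R) ?L"
      proof (rule inj_onI)
        fix g g' assume g: "g \<in> ?L" "g' \<in> ?L" "restrict g ?R = restrict g' ?R"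
        have gN: "g \<in> N" "g' \<in> N" using g by auto
        show "g = g'"
        proof (rule Bij_eqI[of _ E])
          fix x assume x: "x \<in> E"
          have pr: "prep Z x \<in> E" using prep_in_S[OF Z x] .
          have "x \<in> porb Z (prep Z x)" using porb_prep[OF Z x] porb_self[OF Z x] by simp
          then obtain m where m: "m \<in> Z" "x = m (prep Z x)" by (auto simp: porb_def)
          have c: "k x = m (k (prep Z x))" if "k \<in> N" for k
          proof -
            have "(m \<otimes>\<^bsub>BijGroup E\<^esub> k) (prep Z x) = (k \<otimes>\<^bsub>BijGroup E\<^esub> m) (prep Z x)"
              using m(1) that unfolding Z_def by fastforce
            thus ?thesis
              using m NB(2)[OF that] NB(2)[of m] ZN pr
                BijGroup_mult_apply[of m E k "prep Z x"] BijGroup_mult_apply[of k E m "prep Z x"]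
              by (metis subsetD)
          qed
          have "g (prep Z x) = g' (prep Z x)" using g(3) x by (metis image_eqI restrict_apply')
          thus "g x = g' x" using c[OF gN(1)] c[OF gN(2)] by simp
        qed (use gN NB(2) in auto)
      qed
      moreover have "(\<lambda>g. restrict g ?R) ` ?L \<subseteq> (\<Pi>\<^sub>E r\<in>?R. porb Z r)"
        unfolding L using pE by (auto simp: PiE_def Pi_def subset_iff)
      moreover have finp: "finite (porb Z r)" if "r \<in> ?R" for r
        using that pE porb_subset[OF Z] fin by (meson finite_subset subsetD)
      ultimately have "card ?L \<le> card (\<Pi>\<^sub>E r\<in>?R. porb Z r)"
        by (intro card_inj_on_le[of "\<lambda>g. restrict g ?R"] finite_PiE finR) auto
      also have "\<dots> = (\<Prod>r\<in>?R. card (porb Z r))" by (rule card_PiE[OF finR])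
      also have "\<dots> \<le> (\<Prod>r\<in>?R. 2 ^ (card (porb Z r) - 1))"
      proof (rule prod_mono)
        fix r assume r: "r \<in> ?R"
        have "porb Z r \<noteq> {}" using r pE porb_self[OF Z] by blast
        hence "card (porb Z r) > 0" using finp[OF r] by (simp add: card_gt_0_iff)
        thus "0 \<le> card (porb Z r) \<and> card (porb Z r) \<le> 2 ^ (card (porb Z r) - 1)"
          using less_exp[of "card (porb Z r) - 1"] by linarith
      qed
      also have "\<dots> = 2 ^ (\<Sum>r\<in>?R. card (porb Z r) - 1)" by (simp add: power_sum)
      \<comment> \<open>The orbits partition \<open>E\<close>. They are nonempty, so the truncated
        subtraction may be pulled out of the sum.\<close>
      also have "(\<Sum>r\<in>?R. card (porb Z r) - 1) = card E - card ?R"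
      proof -
        have "E = (\<Union>r\<in>?R. porb Z r)"
          using porb_self[OF Z] porb_prep[OF Z] porb_subset[OF Z] pE by fastforce
        hence "card E = card (\<Union>r\<in>?R. porb Z r)" by simp
        also have "\<dots> = (\<Sum>r\<in>?R. card (porb Z r))"
        proof (rule card_UN_disjoint[OF finR])
          show "\<forall>i\<in>?R. \<forall>j\<in>?R. i \<noteq> j \<longrightarrow> porb Z i \<inter> porb Z j = {}"
          proof (intro ballI impI)
            fix i j assume ij: "i \<in> ?R" "j \<in> ?R" "i \<noteq> j"
            hence "prep Z i = i" "prep Z j = j" using prep_prep[OF Z] by auto
            thus "porb Z i \<inter> porb Z j = {}"
              using ij pE porb_disjoint[OF Z, of i j] prep_eq_iff[OF Z, of i j] by auto
          qed
        qed (use finp in blast)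
        finally have "card E = (\<Sum>r\<in>?R. card (porb Z r))" .
        moreover have "(\<Sum>r\<in>?R. card (porb Z r) - 1) = (\<Sum>r\<in>?R. card (porb Z r)) - (\<Sum>r\<in>?R. 1)"
        proof (rule sum_subtractf_nat)
          fix r assume r: "r \<in> ?R"
          hence "porb Z r \<noteq> {}" using pE porb_self[OF Z] by blast
          thus "1 \<le> card (porb Z r)" using finp[OF r] by (simp add: Suc_le_eq card_gt_0_iff)
        qed
        ultimately show ?thesis by simp
      qed
      finally show ?thesis .
    qed
    ultimately have "card (?h ` N) * card {g \<in> N. ?h g = \<one>\<^bsub>BijGroup ?R\<^esub>}
      \<le> 2 ^ (card ?R - 1) * 2 ^ (card E - card ?R)" by (rule mult_le_mono)
    moreover have "finite N" using finite_Bij[OF fin] NB(1) finite_subset by blast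
    moreover have "card ?R > 0" using less.prems(2) finR by (simp add: card_gt_0_iff)
    ultimately show ?thesis
      using card_hom_image_kernel[OF group_BijGroup group_BijGroup hom N N] lt
      by (simp flip: power_add)
  qed simp
qed

text \<open>Restriction to \<open>F\<close> is injective on \<open>N\<close>, so the exponent is
  governed by the size of \<open>F\<close> and not by the degree. This is what makes small sets
  \<open>F\<close> effective.\<close>

lemma nilpotent_card_le_of_faithful:
  assumes N: "subgroup N (BijGroup S)" "nilpotent_group (BijGroup S\<lparr>carrier := N\<rparr>)"
    and fin: "finite S" and F: "F \<subseteq> S" "F \<noteq> {}" "\<And>g. g \<in> N \<Longrightarrow> g ` F = F"
    and faithful: "\<And>g. g \<in> N \<Longrightarrow> (\<And>x. x \<in> F \<Longrightarrow> g x = x) \<Longrightarrow> g = \<one>\<^bsub>BijGroup S\<^esub>"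
  shows "card N \<le> 2 ^ (card F - 1)"
proof -
  note hom = restrict_hom[OF N(1) F(1,3)]
  note im = nilpotent_hom_image[OF group_BijGroup group_BijGroup N(1) hom N(1) order_refl N(2)]
  have "finite N" using finite_Bij[OF fin] subgroup_BijD(1)[OF N(1)] finite_subset by blast
  moreover have "{g \<in> N. restrict g F = \<one>\<^bsub>BijGroup F\<^esub>} = {\<one>\<^bsub>BijGroup S\<^esub>}"
  proof (intro equalityI subsetI)
    fix g assume "g \<in> {g \<in> N. restrict g F = \<one>\<^bsub>BijGroup F\<^esub>}"
    hence "g = \<one>\<^bsub>BijGroup S\<^esub>" unfolding restrict_eq_one_iff by (intro faithful) auto
    thus "g \<in> {\<one>\<^bsub>BijGroup S\<^esub>}" by simp
  next
    fix g assume "g \<in> {\<one>\<^bsub>BijGroup S\<^esub>}"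
    thus "g \<in> {g \<in> N. restrict g F = \<one>\<^bsub>BijGroup F\<^esub>}"
      using subgroup_BijD(3)[OF N(1)] F(1) unfolding restrict_eq_one_iff
      by (auto simp: BijGroup_one_apply)
  qed
  ultimately have "card N = card ((\<lambda>g. restrict g F) ` N)"
    using card_hom_image_kernel[OF group_BijGroup group_BijGroup hom N(1) N(1)] by simp
  thus ?thesis
    using nilpotent_perm_group_card_le[OF _ F(2) im] F(1) fin finite_subset by metis
qed

text \<open>If a b = c d, then c^-1 a = d b^-1 lies in both subgroups, so the product map on
  \<open>A \<times> B\<close> is injective.\<close>

lemma (in group) card_mult_le_of_trivial_Int:
  assumes "subgroup A G" "subgroup B G" "subgroup L G" "A \<subseteq> L" "B \<subseteq> L" "finite L"
    and "A \<inter> B = {\<one>}"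
  shows "card A * card B \<le> card L"
proof -
  have "inj_on (\<lambda>(a, b). a \<otimes> b) (A \<times> B)"
  proof (rule inj_onI, clarify)
    fix a b c d assume m: "a \<in> A" "c \<in> A" "b \<in> B" "d \<in> B" and e: "a \<otimes> b = c \<otimes> d"
    have G: "a \<in> carrier G" "b \<in> carrier G" "c \<in> carrier G" "d \<in> carrier G"
      using m subgroup.mem_carrier[OF assms(1)] subgroup.mem_carrier[OF assms(2)] by auto
    have "inv c \<otimes> a = inv c \<otimes> (a \<otimes> b) \<otimes> inv b" using G by (simp add: m_assoc)
    also have "\<dots> = d \<otimes> inv b" unfolding e using G by (simp add: m_assoc[symmetric])
    finally have eq: "inv c \<otimes> a = d \<otimes> inv b" .
    moreover have "inv c \<otimes> a \<in> A" "d \<otimes> inv b \<in> B"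
      using m assms(1,2) by (simp_all add: subgroup.m_closed subgroup.m_inv_closed)
    ultimately have "inv c \<otimes> a = \<one>" "d \<otimes> inv b = \<one>" using assms(7) by auto
    hence "inv a = inv c" "inv (inv b) = d"
      using inv_equality[of "inv c" a] inv_equality[of d "inv b"] G inv_closed by blast+
    thus "a = c \<and> b = d" using G inv_inv by metis
  qed
  moreover have "(\<lambda>(a, b). a \<otimes> b) ` (A \<times> B) \<subseteq> L"
    using assms(3-5) subgroup.m_closed[OF assms(3)] by auto
  ultimately have "card (A \<times> B) \<le> card L" using assms(6) by (rule card_inj_on_le)
  thus ?thesis by (simp add: card_cartesian_product)
qed

section \<open>Frames of a regular abelian group\<close>

text \<open>\<open>W\<close> and its coset W v are disjoint subsets of the enlarged subgroup, which
  gives the doubling. If \<open>V\<close> is abelian and v squares to the identity, their union is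
  already a subgroup, which gives equality.\<close>

lemma (in group) adjoin_element:
  assumes V: "subgroup V G" "finite V" and W: "subgroup W G" "W \<subseteq> V" and v: "v \<in> V" "v \<notin> W"
  shows "subgroup (generate G (insert v W)) G" "insert v W \<subseteq> generate G (insert v W)"
    "generate G (insert v W) \<subseteq> V" "2 * card W \<le> card (generate G (insert v W))"
    "\<forall>a\<in>V. \<forall>b\<in>V. a \<otimes> b = b \<otimes> a \<Longrightarrow> v \<otimes> v = \<one> \<Longrightarrow>
      card (generate G (insert v W)) = 2 * card W"
proof -
  let ?W1 = "generate G (insert v W)" and ?C = "(\<lambda>w. w \<otimes> v) ` W"
  have VG: "V \<subseteq> carrier G" and WG: "W \<subseteq> carrier G" using subgroup.subset[OF V(1)] subgroup.subset[OF W(1)] by auto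
  have vG: "v \<in> carrier G" using VG v by auto
  show sub: "subgroup ?W1 G" using generate_is_subgroup[of "insert v W"] vG WG by simp
  show inc: "insert v W \<subseteq> ?W1" by (intro subsetI generate.incl)
  show W1V: "?W1 \<subseteq> V" using generate_subgroup_incl[OF _ V(1), of "insert v W"] W v by simp
  have finW: "finite W" using W(2) V(2) finite_subset by blast
  have cC: "card ?C = card W" using vG WG by (intro card_image inj_onI) (auto simp: subset_iff)
  have dis: "W \<inter> ?C = {}"
  proof (rule ccontr)
    assume "W \<inter> ?C \<noteq> {}"
    then obtain w where w: "w \<in> W" "w \<otimes> v \<in> W" by auto
    hence "inv w \<otimes> (w \<otimes> v) \<in> W" using W(1) by (simp add: subgroup.m_closed subgroup.m_inv_closed)
    moreover have "inv w \<otimes> (w \<otimes> v) = v" using w vG WG by (simp add: m_assoc[symmetric] subset_iff)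
    ultimately show False using v by simp
  qed
  have cU: "card (W \<union> ?C) = 2 * card W"
    using card_Un_disjoint[OF finW _ dis] finW cC by simp
  have "W \<union> ?C \<subseteq> ?W1" using inc subgroup.m_closed[OF sub] by auto
  thus "2 * card W \<le> card ?W1" using cU W1V V(2) by (metis card_mono finite_subset)
  show "card ?W1 = 2 * card W"
    if comm': "\<forall>a\<in>V. \<forall>b\<in>V. a \<otimes> b = b \<otimes> a" and sq: "v \<otimes> v = \<one>"
  proof -
    have comm: "a \<otimes> b = b \<otimes> a" if "a \<in> V" "b \<in> V" for a b using comm' that by blast
    have "subgroup (W \<union> ?C) G"
    proof (rule subgroupI)
      show "W \<union> ?C \<subseteq> carrier G" using WG vG by auto
      show "W \<union> ?C \<noteq> {}" using subgroup.one_closed[OF W(1)] by auto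
      have vv: "v \<otimes> (w \<otimes> v) = w" if "w \<in> W" for w
      proof -
        have "v \<otimes> (w \<otimes> v) = v \<otimes> (v \<otimes> w)" using comm[of w v] that W(2) v by auto
        also have "\<dots> = (v \<otimes> v) \<otimes> w" using that vG WG by (simp add: m_assoc subset_iff)
        finally show ?thesis using sq that WG by auto
      qed
      have iv: "inv v = v" using inv_equality[OF sq vG vG] .
      show "inv a \<in> W \<union> ?C" if "a \<in> W \<union> ?C" for a
        using that
      proof
        assume "a \<in> ?C"
        then obtain w where w: "w \<in> W" "a = w \<otimes> v" by auto
        have "inv a = v \<otimes> inv w" using w vG WG iv by (simp add: inv_mult_group subset_iff)
        also have "\<dots> = inv w \<otimes> v"
          using w W(2) v subgroup.m_inv_closed[OF W(1)] by (intro comm) auto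
        finally show ?thesis using w subgroup.m_inv_closed[OF W(1)] by auto
      qed (use subgroup.m_inv_closed[OF W(1)] in auto)
      show "a \<otimes> b \<in> W \<union> ?C" if ab: "a \<in> W \<union> ?C" "b \<in> W \<union> ?C" for a b
      proof -
        obtain u where u: "u \<in> W" "a = u \<or> a = u \<otimes> v" using ab(1) by auto
        obtain w where w: "w \<in> W" "b = w \<or> b = w \<otimes> v" using ab(2) by auto
        have uw: "u \<otimes> w \<in> W" using u w subgroup.m_closed[OF W(1)] by simp
        have G: "u \<in> carrier G" "w \<in> carrier G" using u w WG by auto
        have "(u \<otimes> v) \<otimes> w = (u \<otimes> w) \<otimes> v"
          using comm[of w v] w(1) W(2) v(1) G vG by (simp add: m_assoc subset_iff)
        moreover have "u \<otimes> (w \<otimes> v) = (u \<otimes> w) \<otimes> v" using G vG by (simp add: m_assoc)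
        moreover have "(u \<otimes> v) \<otimes> (w \<otimes> v) = u \<otimes> w" using G vG vv[OF w(1)] by (simp add: m_assoc)
        ultimately show ?thesis using u(2) w(2) uw by auto
      qed
    qed
    moreover have "insert v W \<subseteq> W \<union> ?C"
      using subgroup.one_closed[OF W(1)] vG by (auto simp: image_iff intro!: bexI[of _ \<one>])
    ultimately have "?W1 \<subseteq> W \<union> ?C" by (rule generate_subgroup_incl[rotated])
    hence "?W1 = W \<union> ?C" using \<open>W \<union> ?C \<subseteq> ?W1\<close> by blast
    thus ?thesis using cU by simp
  qed
qed

text \<open>\<open>R\<close> arises by adjoining elements of \<open>V\<close> to \<open>W\<close>
  until \<open>V\<close> is reached, and every step at least doubles the order. The second
  conclusion says that no two elements of \<open>R\<close> share a coset of \<open>W\<close>, the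
  third that \<open>W\<close> and \<open>R\<close> together generate \<open>V\<close>.\<close>

lemma (in group) independent_generators:
  assumes V: "subgroup V G" "finite V" "\<forall>a\<in>V. \<forall>b\<in>V. a \<otimes> b = b \<otimes> a"
    and W: "subgroup W G" "W \<subseteq> V"
  obtains R where "R \<subseteq> V - W"
    "\<forall>r\<in>R. \<forall>r'\<in>R. \<forall>w\<in>W. r' = w \<otimes> r \<longrightarrow> r' = r"
    "\<forall>U. subgroup U G \<longrightarrow> W \<subseteq> U \<longrightarrow> R \<subseteq> U \<longrightarrow> V \<subseteq> U"
    "card W * 2 ^ card R \<le> card V"
    "(\<forall>v\<in>V. v \<otimes> v = \<one>) \<longrightarrow> card W * 2 ^ card R = card V"
proof -
  have "\<exists>R \<subseteq> V - W. (\<forall>r\<in>R. \<forall>r'\<in>R. \<forall>w\<in>W. r' = w \<otimes> r \<longrightarrow> r' = r) \<and>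
      (\<forall>U. subgroup U G \<longrightarrow> W \<subseteq> U \<longrightarrow> R \<subseteq> U \<longrightarrow> V \<subseteq> U) \<and> card W * 2 ^ card R \<le> card V \<and>
      ((\<forall>v\<in>V. v \<otimes> v = \<one>) \<longrightarrow> card W * 2 ^ card R = card V)"
    using W
  proof (induction "card V - card W" arbitrary: W rule: less_induct)
    case less
    note W = less.prems
    show ?case
    proof (cases "W = V")
      case True
      show ?thesis unfolding True by (rule exI[of _ "{}"]) auto
    next
      case False
      then obtain v where v: "v \<in> V" "v \<notin> W" using W by auto
      let ?W1 = "generate G (insert v W)"
      note ad = adjoin_element[OF V(1,2) W v]
      have "card W < card ?W1"
        using ad(2,3) v finite_subset[OF ad(3) V(2)] by (intro psubset_card_mono) auto
      moreover have "card ?W1 \<le> card V" using ad(3) V(2) by (rule card_mono[rotated])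
      ultimately have "card V - card ?W1 < card V - card W" by linarith
      from less.hyps[OF this ad(1,3)] obtain R where R: "R \<subseteq> V - ?W1"
        "\<forall>r\<in>R. \<forall>r'\<in>R. \<forall>w\<in>?W1. r' = w \<otimes> r \<longrightarrow> r' = r"
        "\<forall>U. subgroup U G \<longrightarrow> ?W1 \<subseteq> U \<longrightarrow> R \<subseteq> U \<longrightarrow> V \<subseteq> U" "card ?W1 * 2 ^ card R \<le> card V"
        "(\<forall>v\<in>V. v \<otimes> v = \<one>) \<longrightarrow> card ?W1 * 2 ^ card R = card V"
        by (elim exE conjE) (rule that; assumption)
      have vR: "v \<notin> R" using R(1) ad(2) by auto
      have finR: "finite R" using R(1) V(2) finite_subset by blast
      have cR: "card (insert v R) = Suc (card R)" using vR finR by simp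
      show ?thesis
      proof (intro exI[of _ "insert v R"] conjI ballI impI allI)
        show "insert v R \<subseteq> V - W" using R(1) ad(2) v by auto
        show "r' = r" if m: "r \<in> insert v R" "r' \<in> insert v R" "w \<in> W" "r' = w \<otimes> r" for r r' w
        proof -
          have w: "w \<in> ?W1" "w \<in> carrier G" using ad(2) m(3) subgroup.mem_carrier[OF W(1)] by auto
          have 1: "w \<otimes> v \<in> ?W1" using w ad(2) subgroup.m_closed[OF ad(1)] by auto
          \<comment> \<open>Later generators avoid the subgroup generated by \<open>W\<close> and v,
            so none of them shares a coset of \<open>W\<close> with v.\<close>
          have no: False if "r \<in> R" "v = w \<otimes> r"
          proof -
            have "r \<in> carrier G" using that R(1) subgroup.mem_carrier[OF V(1)] by auto
            hence "r = inv w \<otimes> v" using that w by (simp add: m_assoc[symmetric])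
            hence "r \<in> ?W1" using w ad(2) subgroup.m_closed[OF ad(1)] subgroup.m_inv_closed[OF ad(1)] by auto
            thus False using that R(1) by auto
          qed
          consider "r = v" "r' = v" | "r = v" "r' \<in> R" | "r \<in> R" "r' = v" | "r \<in> R" "r' \<in> R"
            using m(1,2) by auto
          thus ?thesis
          proof cases
            case 2 thus ?thesis using m(4) 1 R(1) by auto
          next
            case 3 thus ?thesis using no m(4) by auto
          next
            case 4 thus ?thesis using R(2) w(1) m(4) by auto
          qed simp
        qed
        show "V \<subseteq> U" if "subgroup U G" "W \<subseteq> U" "insert v R \<subseteq> U" for U
          using R(3) that generate_subgroup_incl[of "insert v W" U] by auto
        show "card W * 2 ^ card (insert v R) \<le> card V"
        proof -
          have "card W * 2 ^ card (insert v R) = (2 * card W) * 2 ^ card R" unfolding cR by simp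
          also have "\<dots> \<le> card ?W1 * 2 ^ card R" using ad(4) by (rule mult_le_mono1)
          finally show ?thesis using R(4) by simp
        qed
        show "card W * 2 ^ card (insert v R) = card V" if "\<forall>v\<in>V. v \<otimes> v = \<one>"
          using ad(5)[OF V(3)] R(5) that v unfolding cR by simp
      qed
    qed
  qed
  thus ?thesis by (elim exE conjE) (rule that; assumption)
qed

section \<open>A regular abelian group and a second group, each normalising the other\<close>

text \<open>In the application \<open>V\<close> is the abelian normal subgroup restricted to one of
  its orbits \<open>b\<close>, and \<open>X\<close> is the restriction of a group preserving its
  orbits. The base point \<open>z\<close> identifies \<open>V\<close> with \<open>b\<close>.\<close>

locale regular_pair =
  fixes b :: "'a set" and V X :: "('a \<Rightarrow> 'a) set" and z :: 'a
  assumes fin: "finite b" and z: "z \<in> b"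
    and V: "subgroup V (BijGroup b)" and X: "subgroup X (BijGroup b)"
    and comm: "v \<in> V \<Longrightarrow> w \<in> V \<Longrightarrow> v \<otimes>\<^bsub>BijGroup b\<^esub> w = w \<otimes>\<^bsub>BijGroup b\<^esub> v"
    and trans: "y \<in> b \<Longrightarrow> \<exists>v\<in>V. v z = y"
    and nX: "v \<in> V \<Longrightarrow> x \<in> X \<Longrightarrow> v \<otimes>\<^bsub>BijGroup b\<^esub> x \<otimes>\<^bsub>BijGroup b\<^esub> inv\<^bsub>BijGroup b\<^esub> v \<in> X"
    and nV: "x \<in> X \<Longrightarrow> v \<in> V \<Longrightarrow> x \<otimes>\<^bsub>BijGroup b\<^esub> v \<otimes>\<^bsub>BijGroup b\<^esub> inv\<^bsub>BijGroup b\<^esub> x \<in> V"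
begin

sublocale G: group "BijGroup b" by (rule group_BijGroup)

abbreviation mul (infixl "\<cdot>" 70) where "f \<cdot> g \<equiv> f \<otimes>\<^bsub>BijGroup b\<^esub> g"
abbreviation one' ("\<^bold>1") where "\<^bold>1 \<equiv> \<one>\<^bsub>BijGroup b\<^esub>"
abbreviation iv where "iv f \<equiv> inv\<^bsub>BijGroup b\<^esub> f"

lemma commV: "\<forall>v\<in>V. \<forall>w\<in>V. v \<cdot> w = w \<cdot> v"
  using comm by simp

lemmas VB = subgroup_BijD[OF V]
lemmas XB = subgroup_BijD[OF X]

lemma finV: "finite V" and finX: "finite X"
  using finite_Bij[OF fin] VB(1) XB(1) finite_subset by blast+

lemma ap: "f \<in> Bij b \<Longrightarrow> g \<in> Bij b \<Longrightarrow> y \<in> b \<Longrightarrow> (f \<cdot> g) y = f (g y)"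
  by (rule BijGroup_mult_apply)

lemma cancel: "f \<in> Bij b \<Longrightarrow> g \<in> Bij b \<Longrightarrow> iv f \<cdot> (f \<cdot> g) = g"
  by (simp add: G.m_assoc[symmetric])

text \<open>A transitive abelian group is regular: an element fixing one point commutes with
  elements that carry this point to any other.\<close>

lemma V_fixed_point: "v \<in> V \<Longrightarrow> y \<in> b \<Longrightarrow> v y = y \<Longrightarrow> v = \<^bold>1"
proof -
  assume v: "v \<in> V" and y: "y \<in> b" "v y = y"
  obtain u where u: "u \<in> V" "u z = y" using trans[OF y(1)] by auto
  have vz: "v z = z"
  proof -
    have "u (v z) = v (u z)"
      using comm[OF u(1) v] ap[OF VB(2)[OF u(1)] VB(2)[OF v] z] ap[OF VB(2)[OF v] VB(2)[OF u(1)] z] by simp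
    hence "u (v z) = u z" using u y by simp
    thus ?thesis using Bij_inj_on[OF VB(2)[OF u(1)]] VB(6)[OF v z] z by (meson inj_onD)
  qed
  have "v x = x" if x: "x \<in> b" for x
  proof -
    obtain t where t: "t \<in> V" "t z = x" using trans[OF x] by auto
    have "v (t z) = t (v z)"
      using comm[OF t(1) v] ap[OF VB(2)[OF t(1)] VB(2)[OF v] z] ap[OF VB(2)[OF v] VB(2)[OF t(1)] z] by simp
    thus ?thesis using vz t(2) by simp
  qed
  thus ?thesis using Bij_eq_one_iff[OF VB(2)[OF v]] by blast
qed

lemma V_eqI: "v \<in> V \<Longrightarrow> w \<in> V \<Longrightarrow> y \<in> b \<Longrightarrow> v y = w y \<Longrightarrow> v = w"
proof -
  assume m: "v \<in> V" "w \<in> V" "y \<in> b" "v y = w y"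
  have "(iv w \<cdot> v) y = y"
    using m VB ap[of "iv w" v y] BijGroup_inv_apply(2)[of w b y] by simp
  hence "iv w \<cdot> v = \<^bold>1" using V_fixed_point[of "iv w \<cdot> v" y] VB(4)[OF VB(5)] m by simp
  hence e: "iv v = iv w" using G.inv_equality[of "iv w" v] m VB(2) by simp
  have "iv (iv v) = v" "iv (iv w) = w" using VB(2)[OF m(1)] VB(2)[OF m(2)] by simp_all
  thus "v = w" unfolding e by simp
qed

text \<open>Under v \<mapsto> \<open>v z\<close> subsets of \<open>V\<close> become subsets of
  \<open>b\<close>, and the elements of \<open>V\<close> act as translations.\<close>

abbreviation pts where "pts D \<equiv> (\<lambda>v. v z) ` D"

lemma pts_iff: "v \<in> V \<Longrightarrow> D \<subseteq> V \<Longrightarrow> v z \<in> pts D \<longleftrightarrow> v \<in> D"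
proof
  assume D: "v \<in> V" "D \<subseteq> V" and "v z \<in> pts D"
  then obtain d where d: "d \<in> D" "v z = d z" by auto
  have "d \<in> V" using d D by auto
  have "v = d" by (rule V_eqI[OF D(1) \<open>d \<in> V\<close> z]) (rule d(2))
  thus "v \<in> D" using d by simp
qed simp

lemma pts_subset: "D \<subseteq> V \<Longrightarrow> pts D \<subseteq> b"
  by (rule image_subsetI) (rule VB(6)[OF _ z], blast)

lemma card_pts: "D \<subseteq> V \<Longrightarrow> card (pts D) = card D"
  by (intro card_image inj_onI) (rule V_eqI[OF _ _ z], blast+)

lemma pts_V: "pts V = b"
  using pts_subset[OF order_refl] trans by (auto simp: image_iff) metis

lemma card_V: "card V = card b"
  using card_pts[of V] pts_V by simp

abbreviation W where "W \<equiv> X \<inter> V"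

lemma W: "subgroup W (BijGroup b)"
  by (rule G.subgroups_Inter_pair[OF X V])

lemmas WB = subgroup_BijD[OF W]

lemma conj_apply: "x \<in> X \<Longrightarrow> v \<in> V \<Longrightarrow> y \<in> b \<Longrightarrow> x (v y) = (x \<cdot> v \<cdot> iv x) (x y)"
  using XB(2,6) VB(2,6) by (simp add: ap BijGroup_inv_apply)

text \<open>The commutator of x and v lies in \<open>X\<close> because \<open>V\<close> normalises
  \<open>X\<close>, and in \<open>V\<close> because \<open>X\<close> normalises
  \<open>V\<close>.\<close>

lemma conj_in_coset: "x \<in> X \<Longrightarrow> v \<in> V \<Longrightarrow> \<exists>w\<in>W. x \<cdot> v \<cdot> iv x = w \<cdot> v"
proof -
  assume x: "x \<in> X" and v: "v \<in> V"
  let ?w = "x \<cdot> v \<cdot> iv x \<cdot> iv v"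
  have "?w \<in> V" by (intro VB(4) nV[OF x v] VB(5) v)
  moreover have "?w = x \<cdot> (v \<cdot> iv x \<cdot> iv v)" using XB(2)[OF x] VB(2)[OF v] by (simp add: G.m_assoc)
  hence "?w \<in> X" using nX[OF v, of "iv x"] x XB by simp
  moreover have "x \<cdot> v \<cdot> iv x = ?w \<cdot> v" using XB(2)[OF x] VB(2)[OF v] by (simp add: G.m_assoc)
  ultimately show ?thesis by blast
qed

text \<open>With points read as elements of \<open>V\<close>, x is the translation by c up to a
  factor in \<open>W\<close> depending on the point. So \<open>X\<close> acts on the cosets of
  \<open>W\<close> by translations.\<close>

lemma apply_pt:
  assumes "x \<in> X" "v \<in> V" "c \<in> V" "x z = c z"
  obtains w where "w \<in> W" "x (v z) = (w \<cdot> v \<cdot> c) z"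
proof -
  obtain w where w: "w \<in> W" "x \<cdot> v \<cdot> iv x = w \<cdot> v" using conj_in_coset assms by blast
  have "x (v z) = (w \<cdot> v) (c z)" using conj_apply[OF assms(1,2) z] w assms(4) by simp
  also have "\<dots> = (w \<cdot> v \<cdot> c) z" using ap[of "w \<cdot> v" c z] w assms(2,3) VB(2) z by simp
  finally show ?thesis using w that by blast
qed

text \<open>An x fixing \<open>z\<close> fixes \<open>v z\<close> exactly when it commutes with v,
  so its fixed points form a subgroup of \<open>V\<close>. That \<open>D\<close> generates
  \<open>V\<close> is expressed by saying that every subgroup containing \<open>D\<close> contains
  \<open>V\<close>.\<close>

lemma eq_one_of_fixed:
  assumes x: "x \<in> X" "x z = z" and D: "D \<subseteq> V" "\<And>d. d \<in> D \<Longrightarrow> x (d z) = d z"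
    and gen: "\<forall>U. subgroup U (BijGroup b) \<longrightarrow> D \<subseteq> U \<longrightarrow> V \<subseteq> U"
  shows "x = \<^bold>1"
proof -
  let ?U = "{v \<in> V. x (v z) = v z}"
  \<comment> \<open>The conjugate and v both belong to the regular group \<open>V\<close> and agree
    at \<open>z\<close>.\<close>
  have cj: "x \<cdot> v \<cdot> iv x = v" if "v \<in> ?U" for v
  proof (rule V_eqI[OF nV[OF x(1)] _ z])
    show "(x \<cdot> v \<cdot> iv x) z = v z" using conj_apply[OF x(1) _ z, of v] that x(2) by simp
  qed (use that in auto)
  have U: "subgroup ?U (BijGroup b)"
  proof (rule subgroup_BijI[OF _ V])
    show "\<^bold>1 \<in> ?U" using VB(3) z x by (simp add: BijGroup_one_apply)
    fix f g assume f: "f \<in> ?U" and g: "g \<in> ?U"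
    have "x ((f \<cdot> g) z) = x (f (g z))" using f g ap VB(2) z by simp
    also have "\<dots> = f (x (g z))" using conj_apply[OF x(1), of f "g z"] cj[OF f] f g VB(6) z by simp
    also have "\<dots> = (f \<cdot> g) z" using f g ap VB(2) z by simp
    finally show "f \<cdot> g \<in> ?U" using f g VB(4) by simp
  next
    fix f assume f: "f \<in> ?U"
    let ?y = "x ((iv f) z)"
    have fb: "f \<in> Bij b" "iv f \<in> V" using f VB by auto
    have yb: "?y \<in> b" using XB(6)[OF x(1)] VB(6)[OF fb(2) z] .
    have "x (f ((iv f) z)) = f ?y"
      using conj_apply[OF x(1), of f "(iv f) z"] cj[OF f] f VB(6)[OF fb(2) z] by simp
    hence "f ?y = z" using BijGroup_inv_apply(1)[OF fb(1) z] x by simp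
    hence "?y = (iv f) z" using BijGroup_inv_apply(2)[OF fb(1) yb] by simp
    thus "iv f \<in> ?U" using fb by simp
  qed auto
  have "V \<subseteq> ?U" using gen[rule_format, OF U] D by auto
  hence "x y = y" if "y \<in> b" for y using trans[OF that] by auto
  thus ?thesis using Bij_eq_one_iff[OF XB(2)[OF x(1)]] by blast
qed

text \<open>A stabiliser meeting \<open>W\<close> trivially has index at least the order of
  \<open>W\<close> in \<open>X\<close>, so it suffices to bound its nilpotent subgroups by that
  order.\<close>

lemma tame_of_nilpotent_le_W:
  assumes D: "D \<subseteq> b" and triv: "\<And>w. w \<in> W \<Longrightarrow> w ` D = D \<Longrightarrow> w = \<^bold>1"
    and le: "\<And>N. subgroup N (BijGroup b) \<Longrightarrow> N \<subseteq> stab X D \<Longrightarrow>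
      nilpotent_group (BijGroup b\<lparr>carrier := N\<rparr>) \<Longrightarrow> card N \<le> card W"
  shows "tame (BijGroup b) X (stab X D)"
  unfolding tame_def
proof (intro allI impI, elim conjE)
  fix N assume N: "subgroup N (BijGroup b)" "N \<subseteq> stab X D" "nilpotent_group (BijGroup b\<lparr>carrier := N\<rparr>)"
  note S = subgroup_stab[OF X D]
  have "W \<inter> stab X D = {\<^bold>1}"
  proof
    show "W \<inter> stab X D \<subseteq> {\<^bold>1}" unfolding stab_def using triv by blast
    show "{\<^bold>1} \<subseteq> W \<inter> stab X D" using WB(3) subgroup_BijD(3)[OF S] by simp
  qed
  hence "card W * card (stab X D) \<le> card X"
    using G.card_mult_le_of_trivial_Int[OF W S X] finX by (auto simp: stab_def)
  thus "card N * card (stab X D) \<le> card X"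
    using le[OF N] by (meson le_trans mult_le_mono1)
qed

text \<open>The base point belongs to the set, so its image names a translation c in
  \<open>D\<close>; the image of any other d is the member of \<open>D\<close> in the same coset of
  \<open>W\<close> as d c that x selects.\<close>

lemma stab_pts_apply:
  assumes D: "D \<subseteq> V" "\<^bold>1 \<in> D" and x: "x \<in> stab X (pts D)"
  obtains c where "c \<in> D" "x z = c z"
    "\<And>d. d \<in> D \<Longrightarrow> \<exists>w\<in>W. w \<cdot> d \<cdot> c \<in> D \<and> x (d z) = (w \<cdot> d \<cdot> c) z"
proof -
  have xX: "x \<in> X" and xD: "x (d z) \<in> pts D" if "d \<in> D" for d
    using x that by (auto simp: stab_def)
  have x': "x \<in> X" using x by (simp add: stab_def)
  have "x z \<in> pts D" using xD[OF D(2)] BijGroup_one_apply[OF z] by simp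
  then obtain c where c: "c \<in> D" "x z = c z" by auto
  have cV: "c \<in> V" using c D by auto
  have "\<exists>w\<in>W. w \<cdot> d \<cdot> c \<in> D \<and> x (d z) = (w \<cdot> d \<cdot> c) z" if d: "d \<in> D" for d
  proof -
    obtain w where w: "w \<in> W" "x (d z) = (w \<cdot> d \<cdot> c) z"
      using apply_pt[OF x' _ cV c(2), of d] d D by blast
    moreover have "w \<cdot> d \<cdot> c \<in> V" using w d D cV VB(4) by auto
    ultimately show ?thesis using xD[OF d] pts_iff[OF _ D(1)] by auto
  qed
  thus ?thesis using that c by blast
qed

text \<open>Since \<open>[X, V] \<subseteq> W\<close>, the group \<open>X\<close> permutes the \<open>W\<close>-orbits like translations. A set with at
  least two points in the orbit of \<open>z\<close> and at most one point in every other orbit therefore pins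
  down every \<open>W\<close>-orbit.\<close>

lemma stab_frame:
  assumes F: "F \<subseteq> W" "\<^bold>1 \<in> F" "\<exists>f\<in>F. f \<noteq> \<^bold>1"
    and R: "R \<subseteq> V - W" "\<forall>r\<in>R. \<forall>r'\<in>R. \<forall>w\<in>W. r' = w \<cdot> r \<longrightarrow> r' = r"
    and x: "x \<in> stab X (pts (F \<union> R))"
  shows "x ` pts F = pts F" "r \<in> R \<Longrightarrow> x (r z) = r z"
proof -
  have x': "x \<in> X" using x by (simp add: stab_def)
  have FRV: "F \<union> R \<subseteq> V" using F R by auto
  have z1: "\<^bold>1 z = z" using BijGroup_one_apply[OF z] .
  obtain c where c: "c \<in> F \<union> R" "x z = c z"
    and img: "\<And>d. d \<in> F \<union> R \<Longrightarrow> \<exists>w\<in>W. w \<cdot> d \<cdot> c \<in> F \<union> R \<and> x (d z) = (w \<cdot> d \<cdot> c) z"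
    using stab_pts_apply[OF FRV _ x] F(2) by blast
  have cV: "c \<in> V" using c FRV by auto
  \<comment> \<open>If the base point moved to a point of \<open>R\<close>, a second point of
    \<open>F\<close> would move into the same coset of \<open>W\<close>, hence to the same point of
    \<open>R\<close>, against injectivity.\<close>
  have cF: "c \<in> F"
  proof (rule ccontr)
    assume "c \<notin> F"
    hence cR: "c \<in> R" using c by simp
    obtain f where f: "f \<in> F" "f \<noteq> \<^bold>1" using F(3) by blast
    obtain w where w: "w \<in> W" "w \<cdot> f \<cdot> c \<in> F \<union> R" "x (f z) = (w \<cdot> f \<cdot> c) z" using img[of f] f by blast
    have wf: "w \<cdot> f \<in> W" using w f F WB(4) by blast
    have "w \<cdot> f \<cdot> c \<notin> W"
    proof
      assume a: "w \<cdot> f \<cdot> c \<in> W"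
      have "iv (w \<cdot> f) \<cdot> (w \<cdot> f \<cdot> c) \<in> W" using a wf WB(4,5) by blast
      moreover have "iv (w \<cdot> f) \<cdot> (w \<cdot> f \<cdot> c) = c"
        by (rule cancel[OF WB(2)[OF wf] VB(2)[OF cV]])
      ultimately show False using cR R(1) by auto
    qed
    hence "w \<cdot> f \<cdot> c \<in> R" using w F by blast
    hence "w \<cdot> f \<cdot> c = c" using R(2) cR wf by blast
    hence "x (f z) = x z" using w c by simp
    hence "f z = \<^bold>1 z"
      using Bij_inj_on[OF XB(2)[OF x']] VB(6) f(1) F(1) z z1 by (metis Int_iff inj_onD subsetD)
    thus False using V_eqI[OF _ VB(3) z] f F by auto
  qed
  have cW: "c \<in> W" using cF F by auto
  show "x ` pts F = pts F"
  proof (rule image_eq_subset_card[OF XB(2)[OF x'] _ fin])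
    show "pts F \<subseteq> b" using F pts_subset by auto
    show "x ` pts F \<subseteq> pts F"
    proof clarify
      fix f assume f: "f \<in> F"
      obtain w where w: "w \<in> W" "w \<cdot> f \<cdot> c \<in> F \<union> R" "x (f z) = (w \<cdot> f \<cdot> c) z" using img[of f] f by blast
      have "w \<cdot> f \<cdot> c \<in> W" using w(1) f F cW WB(4) by blast
      hence "w \<cdot> f \<cdot> c \<in> F" using w R by blast
      thus "x (f z) \<in> pts F" using w by simp
    qed
  qed
  show "x (r z) = r z" if r: "r \<in> R"
  proof -
    obtain w where w: "w \<in> W" "w \<cdot> r \<cdot> c \<in> F \<union> R" "x (r z) = (w \<cdot> r \<cdot> c) z" using img[of r] r by blast
    have rV: "r \<in> V" using r R by auto
    \<comment> \<open>Now c lies in \<open>W\<close>, so the image of r stays in the coset of r,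
      where \<open>R\<close> has no other element.\<close>
    have e: "w \<cdot> r \<cdot> c = (w \<cdot> c) \<cdot> r"
      using comm[OF rV cV] w(1) WB(2)[OF w(1)] VB(2)[OF rV] VB(2)[OF cV] by (simp add: G.m_assoc)
    have wc: "w \<cdot> c \<in> W" using w cW WB(4) by blast
    have "(w \<cdot> c) \<cdot> r \<notin> W"
    proof
      assume a: "(w \<cdot> c) \<cdot> r \<in> W"
      have "iv (w \<cdot> c) \<cdot> (w \<cdot> c \<cdot> r) \<in> W" using a wc WB(4,5) by blast
      moreover have "iv (w \<cdot> c) \<cdot> (w \<cdot> c \<cdot> r) = r"
        by (rule cancel[OF WB(2)[OF wc] VB(2)[OF rV]])
      ultimately show False using r R(1) by auto
    qed
    hence "(w \<cdot> c) \<cdot> r \<in> R" using w e F by auto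
    hence "(w \<cdot> c) \<cdot> r = r" using R(2) r wc by blast
    thus ?thesis using w e by simp
  qed
qed


text \<open>With \<open>W\<close> trivial, \<open>X\<close> centralises \<open>V\<close>. A
  permutation commuting with a regular abelian group belongs to it, so \<open>X\<close> is contained
  in \<open>W\<close>.\<close>

lemma X_trivial: "W = {\<^bold>1} \<Longrightarrow> X = {\<^bold>1}"
proof -
  assume W1: "W = {\<^bold>1}"
  have "x = \<^bold>1" if x: "x \<in> X" for x
  proof -
    obtain c where c: "c \<in> V" "c z = x z" using trans[OF XB(6)[OF x z]] by blast
    have "x y = c y" if y: "y \<in> b" for y
    proof -
      obtain v where v: "v \<in> V" "v z = y" using trans[OF y] by blast
      have "x (v z) = (x \<cdot> v \<cdot> iv x) (x z)" using conj_apply[OF x v(1) z] .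
      also have "x \<cdot> v \<cdot> iv x = v" using conj_in_coset[OF x v(1)] VB(2)[OF v(1)] W1 by auto
      also have "v (x z) = (v \<cdot> c) z" using ap[OF VB(2)[OF v(1)] VB(2)[OF c(1)] z] c by simp
      also have "\<dots> = c (v z)"
        using ap[OF VB(2)[OF c(1)] VB(2)[OF v(1)] z] comm[OF v(1) c(1)] by simp
      finally show ?thesis using v by simp
    qed
    hence "x = c" by (rule Bij_eqI[OF XB(2)[OF x] VB(2)[OF c(1)]])
    hence "x \<in> W" using x c by simp
    thus ?thesis using W1 by simp
  qed
  thus ?thesis using XB(3) by blast
qed

text \<open>The stabiliser fixes the points of \<open>R\<close> and permutes those of
  \<open>F\<close>. An element fixing the latter too fixes points that generate \<open>V\<close> and
  is trivial, so the bound for nilpotent groups applies on the points of \<open>F\<close>.\<close>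

lemma tame_frame:
  assumes F: "F \<subseteq> W" "\<^bold>1 \<in> F" "\<exists>f\<in>F. f \<noteq> \<^bold>1"
    and R: "R \<subseteq> V - W" "\<forall>r\<in>R. \<forall>r'\<in>R. \<forall>w\<in>W. r' = w \<cdot> r \<longrightarrow> r' = r"
    and gen: "\<forall>U. subgroup U (BijGroup b) \<longrightarrow> F \<union> R \<subseteq> U \<longrightarrow> V \<subseteq> U"
    and triv: "\<And>w. w \<in> W \<Longrightarrow> w ` pts (F \<union> R) = pts (F \<union> R) \<Longrightarrow> w = \<^bold>1"
    and card: "2 ^ (card F - 1) \<le> card W"
  shows "tame (BijGroup b) X (stab X (pts (F \<union> R)))"
proof (rule tame_of_nilpotent_le_W[OF _ triv])
  have FV: "F \<subseteq> V" and FRV: "F \<union> R \<subseteq> V" using F R by auto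
  show "pts (F \<union> R) \<subseteq> b" using pts_subset[OF FRV] .
  fix N assume N: "subgroup N (BijGroup b)" "N \<subseteq> stab X (pts (F \<union> R))"
    "nilpotent_group (BijGroup b\<lparr>carrier := N\<rparr>)"
  note sf = stab_frame[OF F R]
  have "card N \<le> 2 ^ (card (pts F) - 1)"
  proof (rule nilpotent_card_le_of_faithful[OF N(1,3) fin pts_subset[OF FV]])
    show "pts F \<noteq> {}" using F by blast
    fix g assume g: "g \<in> N"
    have gs: "g \<in> stab X (pts (F \<union> R))" using g N(2) by blast
    show "g ` pts F = pts F" by (rule sf(1)[OF gs])
    assume fx: "\<And>x. x \<in> pts F \<Longrightarrow> g x = x"
    show "g = \<^bold>1"
    proof (rule eq_one_of_fixed[OF _ _ FRV _ gen])
      show "g \<in> X" using gs by (simp add: stab_def)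
      have "\<^bold>1 z \<in> pts F" using F(2) by (rule imageI)
      thus "g z = z" using fx[of z] BijGroup_one_apply[OF z] by simp
      show "g (d z) = d z" if "d \<in> F \<union> R" for d
        using that fx[of "d z"] sf(2)[OF gs, of d] by blast
    qed
  qed
  thus "card N \<le> card W" using card card_pts[OF FV] by simp
qed

lemma maximal_subgroup:
  assumes "card b \<ge> 2"
  obtains U v where "subgroup U (BijGroup b)" "U \<subseteq> V" "v \<in> V" "v \<notin> U"
    "generate (BijGroup b) (insert v U) = V"
proof -
  let ?A = "{U. subgroup U (BijGroup b) \<and> U \<subset> V}"
  have "V \<noteq> {\<^bold>1}" using card_V assms by auto
  hence "{\<^bold>1} \<in> ?A" using VB(3) G.triv_subgroup by blast
  moreover have "finite ?A" using finV by (auto intro: finite_subset[of _ "Pow V"])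
  ultimately obtain U where U: "U \<in> ?A" "\<forall>A\<in>?A. U \<subseteq> A \<longrightarrow> U = A"
    using finite_has_maximal[of ?A] by auto
  then obtain v where v: "v \<in> V" "v \<notin> U" by auto
  have U': "subgroup U (BijGroup b)" "U \<subseteq> V" using U by auto
  note ad = G.adjoin_element[OF V finV U' v]
  have "generate (BijGroup b) (insert v U) = V"
    using U(2) ad(1-3) v by (metis (mono_tags, lifting) insert_subset mem_Collect_eq psubsetI)
  thus ?thesis using that U' v by blast
qed

text \<open>If \<open>W\<close> is proper, \<open>F\<close> consists of the identity and generators
  of \<open>W\<close>, and \<open>R\<close> of generators of \<open>V\<close> modulo
  \<open>W\<close>; an element of \<open>W\<close> preserving the set fixes a point of
  \<open>R\<close> and is trivial by regularity. If \<open>W\<close> is \<open>V\<close>, there is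
  no room for \<open>R\<close> and the asymmetry must come from \<open>F\<close>. The last
  conclusion gives the exact size in exponent 2, for comparison with half of
  \<open>b\<close>.\<close>

lemma exists_frame:
  assumes b3: "card b \<ge> 3" and W1: "W \<noteq> {\<^bold>1}"
  obtains F R where "F \<subseteq> W" "\<^bold>1 \<in> F" "\<exists>f\<in>F. f \<noteq> \<^bold>1" "R \<subseteq> V - W"
    "\<forall>r\<in>R. \<forall>r'\<in>R. \<forall>w\<in>W. r' = w \<cdot> r \<longrightarrow> r' = r"
    "\<forall>U. subgroup U (BijGroup b) \<longrightarrow> F \<union> R \<subseteq> U \<longrightarrow> V \<subseteq> U"
    "\<And>w. w \<in> W \<Longrightarrow> w ` pts (F \<union> R) = pts (F \<union> R) \<Longrightarrow> w = \<^bold>1"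
    "2 ^ (card F - 1) \<le> card W"
    "(\<forall>v\<in>V. v \<cdot> v = \<^bold>1) \<longrightarrow> 2 ^ (card (F \<union> R) - 1) = card b"
proof (cases "W = V")
  case False
  note finW = finite_subset[OF Int_lower2 finV, of X]
  have one: "{\<^bold>1} \<subseteq> W" using WB(3) by simp
  have commW: "\<forall>x\<in>W. \<forall>y\<in>W. x \<cdot> y = y \<cdot> x" using commV by blast
  obtain F where F: "F \<subseteq> W - {\<^bold>1}"
    "\<forall>U'. subgroup U' (BijGroup b) \<longrightarrow> {\<^bold>1} \<subseteq> U' \<longrightarrow> F \<subseteq> U' \<longrightarrow> W \<subseteq> U'"
    "card {\<^bold>1} * 2 ^ card F \<le> card W"
    "(\<forall>v\<in>W. v \<cdot> v = \<^bold>1) \<longrightarrow> card {\<^bold>1} * 2 ^ card F = card W"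
    by (rule G.independent_generators[OF W finW commW G.triv_subgroup one]) (rule that; assumption)
  obtain R where R: "R \<subseteq> V - W"
    "\<forall>r\<in>R. \<forall>r'\<in>R. \<forall>w\<in>W. r' = w \<cdot> r \<longrightarrow> r' = r"
    "\<forall>U. subgroup U (BijGroup b) \<longrightarrow> W \<subseteq> U \<longrightarrow> R \<subseteq> U \<longrightarrow> V \<subseteq> U"
    "(\<forall>v\<in>V. v \<cdot> v = \<^bold>1) \<longrightarrow> card W * 2 ^ card R = card V"
    by (rule G.independent_generators[OF V finV commV W Int_lower2]) (rule that; assumption)
  have finF: "finite F" "finite R" using F(1) R(1) finW finV finite_subset by (meson Diff_subset subset_trans)+
  have cF: "card (insert \<^bold>1 F) = Suc (card F)" using finF F(1) by (subst card_insert_disjoint) auto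
  have Fne: "F \<noteq> {}"
    using F(2)[rule_format, OF G.triv_subgroup] one W1 by blast
  have Rne: "R \<noteq> {}" using R(3)[rule_format, OF W order_refl] False by blast
  have i1: "insert \<^bold>1 F \<subseteq> W" using F(1) one by auto
  have i3: "\<exists>f\<in>insert \<^bold>1 F. f \<noteq> \<^bold>1" using F(1) Fne by auto
  show ?thesis
  proof (rule that[of "insert \<^bold>1 F" R, OF i1 _ i3 R(1,2)])
    show "\<forall>U. subgroup U (BijGroup b) \<longrightarrow> insert \<^bold>1 F \<union> R \<subseteq> U \<longrightarrow> V \<subseteq> U"
    proof (intro allI impI)
      fix U assume U: "subgroup U (BijGroup b)" "insert \<^bold>1 F \<union> R \<subseteq> U"
      show "V \<subseteq> U" using R(3)[rule_format, OF U(1) F(2)[rule_format, OF U(1)]] U(2) by simp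
    qed
    show "w = \<^bold>1" if w: "w \<in> W" "w ` pts (insert \<^bold>1 F \<union> R) = pts (insert \<^bold>1 F \<union> R)" for w
    proof -
      obtain r where r: "r \<in> R" using Rne by auto
      have "w \<in> stab X (pts (insert \<^bold>1 F \<union> R))" using w by (simp add: stab_def)
      from stab_frame(2)[OF i1 _ i3 R(1,2) this r] have "w (r z) = r z" by simp
      thus ?thesis using V_fixed_point[of w "r z"] w(1) r R(1) VB(6)[OF _ z] by blast
    qed
    show "2 ^ (card (insert \<^bold>1 F) - 1) \<le> card W" using F(3) cF by simp
    have "2 ^ (card (insert \<^bold>1 F \<union> R) - 1) = card b" if e: "\<forall>v\<in>V. v \<cdot> v = \<^bold>1"
    proof -
      have "card (insert \<^bold>1 F \<union> R) = Suc (card F) + card R"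
        using card_Un_disjoint[of "insert \<^bold>1 F" R] finF cF R(1) i1 by auto
      thus ?thesis using F(4) R(4) e card_V by (simp add: power_add)
    qed
    thus "(\<forall>v\<in>V. v \<cdot> v = \<^bold>1) \<longrightarrow> 2 ^ (card (insert \<^bold>1 F \<union> R) - 1) = card b" by blast
  qed auto
next
  case True
  have b2: "card b \<ge> 2" using b3 by simp
  \<comment> \<open>The set will be the identity, generators of a maximal subgroup \<open>U\<close>,
    and v. A single point off \<open>U\<close> breaks the translation symmetry.\<close>
  obtain U v where U: "subgroup U (BijGroup b)" "U \<subseteq> V" and v: "v \<in> V" "v \<notin> U"
    and gV: "generate (BijGroup b) (insert v U) = V"
    by (rule maximal_subgroup[OF b2])
  note UB = subgroup_BijD[OF U(1)]
  have one: "{\<^bold>1} \<subseteq> U" using UB(3) by simp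
  have finU: "finite U" using U(2) finV finite_subset by blast
  have commU: "\<forall>x\<in>U. \<forall>y\<in>U. x \<cdot> y = y \<cdot> x" using commV U(2) by blast
  obtain F where F: "F \<subseteq> U - {\<^bold>1}"
    "\<forall>U'. subgroup U' (BijGroup b) \<longrightarrow> {\<^bold>1} \<subseteq> U' \<longrightarrow> F \<subseteq> U' \<longrightarrow> U \<subseteq> U'"
    "card {\<^bold>1} * 2 ^ card F \<le> card U"
    "(\<forall>v\<in>U. v \<cdot> v = \<^bold>1) \<longrightarrow> card {\<^bold>1} * 2 ^ card F = card U"
    by (rule G.independent_generators[OF U(1) finU commU G.triv_subgroup one]) (rule that; assumption)
  note ad = G.adjoin_element[OF V finV U v, unfolded gV]
  let ?F = "insert v (insert \<^bold>1 F)"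
  have finF: "finite F" using F(1) finU finite_subset by blast
  have v1: "v \<noteq> \<^bold>1" using v one by auto
  have cF: "card ?F = Suc (Suc (card F))"
    using finF F(1) v one by (subst card_insert_disjoint; (subst card_insert_disjoint)?) auto
  have FV: "?F \<subseteq> V" using F(1) U(2) v VB(3) by auto
  show ?thesis
  proof (rule that[of ?F "{}"])
    show "?F \<subseteq> W" using FV True by simp
    show "\<exists>f\<in>?F. f \<noteq> \<^bold>1" using v1 by blast
    show "\<forall>U'. subgroup U' (BijGroup b) \<longrightarrow> ?F \<union> {} \<subseteq> U' \<longrightarrow> V \<subseteq> U'"
    proof (intro allI impI)
      fix U' assume U': "subgroup U' (BijGroup b)" "?F \<union> {} \<subseteq> U'"
      show "V \<subseteq> U'"
        using F(2)[rule_format, OF U'(1)] U'(2) G.generate_subgroup_incl[of "insert v U" U'] U'(1) gV by simp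
    qed
    have "2 * 2 ^ card F \<le> card V" using F(3) ad(4) by simp
    thus "2 ^ (card ?F - 1) \<le> card W" using cF True by simp
    show "(\<forall>v\<in>V. v \<cdot> v = \<^bold>1) \<longrightarrow> 2 ^ (card (?F \<union> {}) - 1) = card b"
      using F(4) U(2) ad(5)[OF commV] card_V cF v(1) by (auto simp: subset_iff)
    show "w = \<^bold>1" if w: "w \<in> W" "w ` pts (?F \<union> {}) = pts (?F \<union> {})" for w
    proof (rule ccontr)
      assume w1: "w \<noteq> \<^bold>1"
      have wV: "w \<in> V" using w by simp
      have st: "w \<cdot> d \<in> ?F" if "d \<in> ?F" for d
      proof -
        have dV: "d \<in> V" using that FV by blast
        have "w (d z) \<in> pts ?F" using w(2) that by auto
        hence "(w \<cdot> d) z \<in> pts ?F" using ap[OF VB(2)[OF wV] VB(2)[OF dV] z] by simp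
        thus ?thesis using pts_iff[OF VB(4)[OF wV dV] FV] by simp
      qed
      have canc: "x = y" if "x \<cdot> d = y \<cdot> d" "x \<in> V" "y \<in> V" "d \<in> V" for x y d
        using that VB(2) by simp
      have nU: "w \<cdot> d \<notin> U" if "d \<in> U" "w \<notin> U" for d
      proof
        assume "w \<cdot> d \<in> U"
        hence "w \<cdot> d \<cdot> iv d \<in> U" using that UB by blast
        thus False using that VB(2)[OF wV] UB(2) by (simp add: G.m_assoc)
      qed
      have nU': "w \<cdot> v \<notin> U" if "w \<in> U"
      proof
        assume "w \<cdot> v \<in> U"
        hence "iv w \<cdot> (w \<cdot> v) \<in> U" using that UB by blast
        thus False using cancel[OF VB(2)[OF wV] VB(2)[OF v(1)]] v by simp
      qed
      have FU: "insert \<^bold>1 F \<subseteq> U" using F(1) one by auto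
      \<comment> \<open>A translation from \<open>U\<close> preserves \<open>U\<close> and so fixes
        v. A translation from outside sends the identity and all of \<open>F\<close> to v, the only
        member off \<open>U\<close>; this leaves a group of order 2, against
        \<open>b3\<close>.\<close>
      show False
      proof (cases "w \<in> U")
        case True
        hence "w \<cdot> v = v" using st[of v] nU' FU by auto
        hence "w \<cdot> v = \<^bold>1 \<cdot> v" using VB(2)[OF v(1)] by simp
        thus False using canc[OF _ wV VB(3) v(1)] w1 by blast
      next
        case False
        have "w \<cdot> \<^bold>1 = v" using st[of "\<^bold>1"] nU[OF _ False, of "\<^bold>1"] one FU by auto
        hence wv: "w = v" using VB(2)[OF wV] by simp
        have "F = {}"
        proof (rule ccontr)
          assume "F \<noteq> {}"
          then obtain f where f: "f \<in> F" by auto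
          hence "f \<in> U" "f \<noteq> \<^bold>1" using F(1) by auto
          hence "v \<cdot> f = v" using st[of f] nU[OF _ False, of f] f FU wv by auto
          hence "iv v \<cdot> (v \<cdot> f) = iv v \<cdot> v" by simp
          hence "f = \<^bold>1" using cancel[OF VB(2)[OF v(1)] UB(2)[OF \<open>f \<in> U\<close>]] VB(2)[OF v(1)] by simp
          thus False using \<open>f \<noteq> \<^bold>1\<close> by simp
        qed
        hence "U = {\<^bold>1}" using F(2)[rule_format, OF G.triv_subgroup] one by blast
        have "v \<cdot> v = v \<or> v \<cdot> v = \<^bold>1" using st[of v] wv \<open>F = {}\<close> by auto
        moreover have "v \<cdot> v \<noteq> v"
        proof
          assume "v \<cdot> v = v"
          hence "v \<cdot> v = \<^bold>1 \<cdot> v" using VB(2)[OF v(1)] by simp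
          thus False using canc[OF _ v(1) VB(3) v(1)] v1 by blast
        qed
        ultimately have "v \<cdot> v = \<^bold>1" by simp
        hence "card V = 2" using ad(5)[OF commV] \<open>U = {\<^bold>1}\<close> by simp
        thus False using b3 card_V by simp
      qed
    qed
  qed auto
qed


section \<open>Three-point sets in degree 8\<close>

text \<open>In a Klein four-group any two distinct nontrivial elements generate, since with their
  product and the identity they exhaust it.\<close>

lemma square_one_closed_four:
  assumes A: "subgroup A (BijGroup b)" "A \<subseteq> V" "card A = 4" and sq: "\<forall>v\<in>V. v \<cdot> v = \<^bold>1"
    and e: "e \<in> A" "f \<in> A" "e \<noteq> \<^bold>1" "f \<noteq> \<^bold>1" "e \<noteq> f"
    and U: "subgroup U (BijGroup b)" "e \<in> U" "f \<in> U"
  shows "A \<subseteq> U"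
proof -
  note AB = subgroup_BijD[OF A(1)] and UB = subgroup_BijD[OF U(1)]
  have E: "e \<in> Bij b" "f \<in> Bij b" using AB(2) e by auto
  have se: "e \<cdot> e = \<^bold>1" using sq A(2) e(1) by blast
  have "e \<cdot> f \<noteq> e \<cdot> \<^bold>1" "e \<cdot> f \<noteq> \<^bold>1 \<cdot> f" "e \<cdot> f \<noteq> e \<cdot> e"
    using e(3-5) E by simp_all
  hence "e \<cdot> f \<noteq> e" "e \<cdot> f \<noteq> f" "e \<cdot> f \<noteq> \<^bold>1" using E se by simp_all
  hence "card {\<^bold>1, e, f, e \<cdot> f} = 4" using e(3-5) by auto
  moreover have "{\<^bold>1, e, f, e \<cdot> f} \<subseteq> A" using AB(3,4) e by auto
  moreover have "finite A" using A(3) card.infinite by fastforce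
  ultimately have "{\<^bold>1, e, f, e \<cdot> f} = A" using A(3) by (intro card_subset_eq) auto
  thus ?thesis using UB(3,4) U by blast
qed

lemma inv_mult_eq_one: "f \<in> Bij b \<Longrightarrow> g \<in> Bij b \<Longrightarrow> iv f \<cdot> g = \<^bold>1 \<Longrightarrow> g = f"
proof -
  assume f: "f \<in> Bij b" "g \<in> Bij b" "iv f \<cdot> g = \<^bold>1"
  have "g = f \<cdot> (iv f \<cdot> g)" using f(1,2) by (simp add: G.m_assoc[symmetric])
  also have "\<dots> = f" unfolding f(3) using f(1) by simp
  finally show ?thesis .
qed

text \<open>The quotient of \<open>V\<close> by \<open>W\<close> has order 4, and the set meets
  three of its cosets once each. A translation of a group of order 4 preserving three elements is
  trivial, so every coset is preserved and the points of the set are fixed; as \<open>W\<close> has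
  order 2, so is everything else.\<close>

lemma three_set_W2:
  assumes sq: "\<forall>v\<in>V. v \<cdot> v = \<^bold>1" and W2: "card W = 2" and R2: "card R = 2"
    and R: "R \<subseteq> V - W" "\<forall>r\<in>R. \<forall>r'\<in>R. \<forall>w\<in>W. r' = w \<cdot> r \<longrightarrow> r' = r"
      "\<forall>U. subgroup U (BijGroup b) \<longrightarrow> W \<subseteq> U \<longrightarrow> R \<subseteq> U \<longrightarrow> V \<subseteq> U"
  shows "card (insert \<^bold>1 R) = 3" "insert \<^bold>1 R \<subseteq> V"
    "tame (BijGroup b) X (stab X (pts (insert \<^bold>1 R)))"
proof -
  let ?D = "insert \<^bold>1 R"
  have finR: "finite R" using R2 card.infinite by fastforce
  have oneR: "\<^bold>1 \<notin> R" using R(1) WB(3) by auto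
  show "card ?D = 3" using finR oneR R2 by simp
  show DV: "?D \<subseteq> V" using R(1) VB(3) by auto
  obtain w0 where w0: "W = {\<^bold>1, w0}" "w0 \<noteq> \<^bold>1"
  proof -
    obtain p q where pq: "W = {p, q}" "p \<noteq> q" using W2 by (auto simp: card_2_iff)
    have "\<^bold>1 \<in> {p, q}" using WB(3) unfolding pq(1) .
    hence "p = \<^bold>1 \<or> q = \<^bold>1" by auto
    thus ?thesis using that[of q] that[of p] pq by auto
  qed
  have triv: "x = \<^bold>1" if x: "x \<in> stab X (pts ?D)" for x
  proof -
    have xX: "x \<in> X" using x by (simp add: stab_def)
    obtain c where c: "c \<in> ?D" "x z = c z"
      and img: "\<And>d. d \<in> ?D \<Longrightarrow> \<exists>w\<in>W. w \<cdot> d \<cdot> c \<in> ?D \<and> x (d z) = (w \<cdot> d \<cdot> c) z"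
      using stab_pts_apply[OF DV _ x] by blast
    have "c = \<^bold>1"
    proof (rule ccontr)
      assume c1: "c \<noteq> \<^bold>1"
      hence cR: "c \<in> R" using c by simp
      obtain s where s: "s \<in> R" "s \<noteq> c" "R = {c, s}"
      proof -
        obtain p q where pq: "R = {p, q}" "p \<noteq> q" using R2 by (auto simp: card_2_iff)
        hence "c = p \<or> c = q" using cR by simp
        thus ?thesis using that[of q] that[of p] pq by auto
      qed
      obtain w where w: "w \<in> W" "w \<cdot> s \<cdot> c \<in> ?D" using img[of s] s by blast
      have B: "w \<in> Bij b" "s \<in> Bij b" "c \<in> Bij b" using w WB(2) s cR R(1) VB(2) by auto
      have V3: "w \<in> V" "s \<in> V" "c \<in> V" using w s cR R(1) by auto
      \<comment> \<open>Modulo \<open>W\<close> the product s c would be trivial, c or s: then s and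
        c share a coset, or one of them lies in \<open>W\<close>.\<close>
      consider "w \<cdot> s \<cdot> c = \<^bold>1" | "w \<cdot> s \<cdot> c = c" | "w \<cdot> s \<cdot> c = s"
        using w(2) s(3) by auto
      thus False
      proof cases
        case 1
        hence "w \<cdot> s \<cdot> c = c \<cdot> c" using sq V3 by simp
        hence "c = w \<cdot> s" using B by simp
        hence "c = s" by (rule R(2)[rule_format, OF s(1) cR w(1)])
        thus False using s(2) by simp
      next
        case 2
        hence "w \<cdot> s \<cdot> c = \<^bold>1 \<cdot> c" using B by simp
        hence "w \<cdot> s = \<^bold>1" using G.right_cancel[of c "w \<cdot> s" "\<^bold>1"] B by simp
        hence "w \<cdot> s = s \<cdot> s" using sq V3 by simp
        hence "s = w" using B by simp
        thus False using w s R(1) by auto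
      next
        case 3
        have "w \<cdot> s \<cdot> c = (w \<cdot> c) \<cdot> s"
          using comm[OF V3(2,3)] B by (simp add: G.m_assoc)
        hence "(w \<cdot> c) \<cdot> s = \<^bold>1 \<cdot> s" using 3 B by simp
        hence "w \<cdot> c = \<^bold>1" using G.right_cancel[of s "w \<cdot> c" "\<^bold>1"] B by simp
        hence "w \<cdot> c = c \<cdot> c" using sq V3 by simp
        hence "c = w" using B by simp
        thus False using w cR R(1) by auto
      qed
    qed
    hence xz: "x z = z" using c BijGroup_one_apply[OF z] by simp
    have xR: "x (r z) = r z" if r: "r \<in> R" for r
    proof -
      obtain w where w: "w \<in> W" "w \<cdot> r \<cdot> \<^bold>1 \<in> ?D" "x (r z) = (w \<cdot> r \<cdot> \<^bold>1) z"
        using img[of r] r \<open>c = \<^bold>1\<close> by blast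
      have B: "w \<in> Bij b" "r \<in> Bij b" using w WB(2) r R(1) VB(2) by auto
      have "w \<cdot> r \<noteq> \<^bold>1"
      proof
        assume "w \<cdot> r = \<^bold>1"
        hence "w \<cdot> r = r \<cdot> r" using sq r R(1) by auto
        hence "w = r" using B by simp
        thus False using w r R(1) by auto
      qed
      hence "w \<cdot> r \<in> R" using w(2) B by simp
      hence "w \<cdot> r = r" by (rule R(2)[rule_format, OF r _ w(1)]) (rule refl)
      thus ?thesis using w(3) B by simp
    qed
    \<comment> \<open>The \<open>W\<close>-orbit of \<open>z\<close> is the pair \<open>z\<close>,
      \<open>w0 z\<close>, so fixing \<open>z\<close> fixes the other point.\<close>
    have xw0: "x (w0 z) = w0 z"
    proof -
      have w0V: "w0 \<in> V" using w0 by blast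
      obtain w where w: "w \<in> W" "x (w0 z) = (w \<cdot> w0 \<cdot> \<^bold>1) z"
        using apply_pt[OF xX w0V VB(3)] c(2) \<open>c = \<^bold>1\<close> by blast
      have "w \<cdot> w0 \<in> W" using w w0 WB(4) by blast
      hence "w \<cdot> w0 = \<^bold>1 \<or> w \<cdot> w0 = w0" using w0 by blast
      moreover have "x (w0 z) \<noteq> z"
      proof
        assume "x (w0 z) = z"
        hence "w0 z = z" using xz Bij_inj_on[OF XB(2)[OF xX]] VB(6)[OF w0V z] z by (metis inj_onD)
        thus False using V_fixed_point[OF w0V z] w0 by simp
      qed
      ultimately show ?thesis
        using w(2) BijGroup_one_apply[OF z] VB(2)[OF w0V] by auto
    qed
    show ?thesis
    proof (rule eq_one_of_fixed[OF xX xz, of "insert w0 R"])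
      show "insert w0 R \<subseteq> V" using w0 R(1) by auto
      show "x (d z) = d z" if "d \<in> insert w0 R" for d using that xR xw0 by blast
      show "\<forall>U. subgroup U (BijGroup b) \<longrightarrow> insert w0 R \<subseteq> U \<longrightarrow> V \<subseteq> U"
      proof (intro allI impI)
        fix U assume "subgroup U (BijGroup b)" "insert w0 R \<subseteq> U"
        thus "V \<subseteq> U" using R(3) w0(1) subgroup_BijD(3)[of U b] by auto
      qed
    qed
  qed
  show "tame (BijGroup b) X (stab X (pts ?D))"
  proof (rule tame_of_nilpotent_le_W[OF pts_subset[OF DV]])
    show "w = \<^bold>1" if "w \<in> W" "w ` pts ?D = pts ?D" for w
      using triv[of w] that unfolding stab_def by blast
    fix N assume "N \<subseteq> stab X (pts ?D)"
    hence "N \<subseteq> {\<^bold>1}" using triv by blast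
    hence "card N \<le> card {\<^bold>1}" by (intro card_mono) auto
    thus "card N \<le> card W" using W2 by simp
  qed
qed

text \<open>Two points are taken in the \<open>W\<close>-orbit of \<open>z\<close> and one outside
  it. The stabiliser then has at most 4 elements, which bounds its nilpotent subgroups by the order
  of \<open>W\<close>.\<close>

lemma three_set_W4:
  assumes sq: "\<forall>v\<in>V. v \<cdot> v = \<^bold>1" and W4: "card W = 4" and v: "v \<in> V - W"
    and gen: "\<forall>U. subgroup U (BijGroup b) \<longrightarrow> W \<subseteq> U \<longrightarrow> v \<in> U \<longrightarrow> V \<subseteq> U"
  shows "\<exists>D\<subseteq>V. card D = 3 \<and> tame (BijGroup b) X (stab X (pts D))"
proof -
  have finW: "finite W" using finV by simp
  have "\<not> W \<subseteq> {\<^bold>1}" using W4 card_mono[of "{\<^bold>1}" W] by auto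
  then obtain e where e: "e \<in> W" "e \<noteq> \<^bold>1" by auto
  have "\<not> W \<subseteq> {\<^bold>1, e}" using W4 card_mono[of "{\<^bold>1, e}" W] e by auto
  then obtain f where f: "f \<in> W" "f \<noteq> \<^bold>1" "f \<noteq> e" by auto
  let ?F = "{\<^bold>1, e}" and ?D = "{\<^bold>1, e} \<union> {v}"
  have vV: "v \<in> V" using v by simp
  have F: "?F \<subseteq> W" "\<^bold>1 \<in> ?F" "\<exists>f\<in>?F. f \<noteq> \<^bold>1" using e WB(3) by auto
  have R: "{v} \<subseteq> V - W" "\<forall>r\<in>{v}. \<forall>r'\<in>{v}. \<forall>w\<in>W. r' = w \<cdot> r \<longrightarrow> r' = r" using v by auto
  have DV: "?D \<subseteq> V" using F v by auto
  have FV: "?F \<subseteq> V" using F by auto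
  note sf = stab_frame[OF F R]
  have fV: "f \<in> V" using f by simp
  let ?S = "stab X (pts ?D)"
  note S = subgroup_stab[OF X pts_subset[OF DV]]
  note SB = subgroup_BijD[OF S]
  have xv: "x (v z) = v z" if "x \<in> ?S" for x using sf(2)[OF that] by simp
  have ez: "e z \<noteq> z" using V_fixed_point[of e z] e z by auto
  have pF: "pts ?F = {z, e z}" using BijGroup_one_apply[OF z] by auto
  \<comment> \<open>Two elements agreeing at \<open>z\<close> and \<open>f z\<close> differ by some
    g fixing both. It permutes the pair \<open>z\<close>, \<open>e z\<close>, so it fixes
    \<open>e z\<close> as well, and it fixes \<open>v z\<close> by
    \<open>stab_frame\<close>.\<close>
  have "inj_on (\<lambda>x. (x z, x (f z))) ?S"
  proof (rule inj_onI)
    fix x y assume x: "x \<in> ?S" and y: "y \<in> ?S" and eq: "(x z, x (f z)) = (y z, y (f z))"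
    define g where "g = iv y \<cdot> x"
    have g: "g \<in> ?S" using x y SB(4,5) g_def by simp
    have g': "g \<in> X" using g by (simp add: stab_def)
    have B: "x \<in> Bij b" "y \<in> Bij b" using SB(2) x y by auto
    have fx: "g p = p" if "x p = y p" "p \<in> b" for p
      using that ap[of "iv y" x p] B BijGroup_inv_apply(2)[OF B(2)] by (simp add: g_def)
    have gz: "g z = z" using fx[of z] eq z by simp
    have gf: "g (f z) = f z" using fx[of "f z"] eq VB(6)[OF fV z] by simp
    have "g (e z) \<in> {z, e z}" using sf(1)[OF g] unfolding pF by blast
    moreover have "g (e z) \<noteq> z"
      using gz ez Bij_inj_on[OF XB(2)[OF g']] VB(6)[of e z] e z by (metis Int_iff inj_onD)
    ultimately have ge: "g (e z) = e z" by simp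
    have "g = \<^bold>1"
    proof (rule eq_one_of_fixed[OF g' gz, of "{e, f, v}"])
      show "{e, f, v} \<subseteq> V" using e f v by auto
      show "g (d z) = d z" if "d \<in> {e, f, v}" for d using that ge gf xv[OF g] by auto
      show "\<forall>U. subgroup U (BijGroup b) \<longrightarrow> {e, f, v} \<subseteq> U \<longrightarrow> V \<subseteq> U"
      proof (intro allI impI)
        fix U assume U: "subgroup U (BijGroup b)" "{e, f, v} \<subseteq> U"
        have "W \<subseteq> U"
          by (rule square_one_closed_four[OF W Int_lower2 W4 sq e(1) f(1) e(2) f(2) _ U(1)])
            (use f U in auto)
        thus "V \<subseteq> U" using gen U by blast
      qed
    qed
    thus "x = y" using inv_mult_eq_one[OF B(2,1)] g_def by simp
  qed
  \<comment> \<open>There are two choices for the image of \<open>z\<close> and two for that of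
    \<open>f z\<close>, which stays in the \<open>W\<close>-orbit but off the pair.\<close>
  moreover have "(\<lambda>x. (x z, x (f z))) ` ?S \<subseteq> pts ?F \<times> (pts W - pts ?F)"
  proof clarify
    fix x assume x: "x \<in> ?S"
    have xX: "x \<in> X" using x by (simp add: stab_def)
    have "z \<in> pts ?F" unfolding pF by simp
    hence 1: "x z \<in> pts ?F" using sf(1)[OF x] by blast
    then obtain c where c: "c \<in> ?F" "x z = c z" by auto
    have cV: "c \<in> V" using c FV by auto
    obtain w where w: "w \<in> W" "x (f z) = (w \<cdot> f \<cdot> c) z" using apply_pt[OF xX fV cV c(2)] by blast
    have cW: "c \<in> W" using c(1) F(1) by blast
    have "w \<cdot> f \<cdot> c \<in> W" by (rule WB(4)[OF WB(4)[OF w(1) f(1)] cW])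
    hence 2: "x (f z) \<in> pts W" using w by simp
    have 3: "x (f z) \<notin> pts ?F"
    proof
      assume "x (f z) \<in> pts ?F"
      then obtain p where p: "p \<in> pts ?F" "x (f z) = x p" using sf(1)[OF x] by blast
      have "p \<in> b" using p(1) pts_subset[OF FV] by blast
      hence "f z = p" using p(2) Bij_inj_on[OF XB(2)[OF xX]] VB(6)[OF fV z] by (meson inj_onD)
      hence "f \<in> ?F" using p(1) pts_iff[OF fV FV] by simp
      thus False using f by simp
    qed
    show "x z \<in> pts ?F \<and> x (f z) \<in> pts W - pts ?F" using 1 2 3 by blast
  qed
  moreover have fp: "finite (pts ?F \<times> (pts W - pts ?F))" using finW by simp
  ultimately have "card ?S \<le> card (pts ?F \<times> (pts W - pts ?F))" by (intro card_inj_on_le)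
  also have "\<dots> = 4"
  proof -
    have "pts ?F \<subseteq> pts W" using F(1) by (rule image_mono)
    hence "card (pts W - pts ?F) = 2"
      using card_Diff_subset[of "pts ?F" "pts W"] card_pts[of W] card_pts[OF FV] W4 e by simp
    moreover have "card (pts ?F) = 2" using card_pts[OF FV] e by simp
    ultimately show ?thesis by (simp add: card_cartesian_product)
  qed
  finally have S4: "card ?S \<le> 4" .
  have finS: "finite ?S" using finX by (simp add: stab_def)
  have "tame (BijGroup b) X ?S"
  proof (rule tame_of_nilpotent_le_W[OF pts_subset[OF DV]])
    show "w = \<^bold>1" if "w \<in> W" "w ` pts ?D = pts ?D" for w
    proof -
      have "w \<in> ?S" using that by (simp add: stab_def)
      thus ?thesis using xv V_fixed_point[of w "v z"] that(1) VB(6)[OF vV z] by blast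
    qed
    fix N assume "N \<subseteq> ?S"
    thus "card N \<le> card W" using S4 W4 card_mono[OF finS, of N] by simp
  qed
  moreover have "card ?D = 3"
  proof -
    have "v \<noteq> \<^bold>1" "v \<noteq> e" using v F(1) by auto
    thus ?thesis using e by simp
  qed
  ultimately show ?thesis using DV by blast
qed

text \<open>The three points come from a subgroup \<open>U\<close> of order 4. Their stabiliser
  normalises \<open>U\<close>, preserves the four points off the \<open>U\<close>-orbit and acts
  faithfully on them, so its nilpotent subgroups have order at most 2^3, the order of
  \<open>W\<close>.\<close>

lemma three_set_W8:
  assumes sq: "\<forall>v\<in>V. v \<cdot> v = \<^bold>1" and V8: "card V = 8" and WV: "W = V"
  shows "\<exists>D\<subseteq>V. card D = 3 \<and> tame (BijGroup b) X (stab X (pts D))"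
proof -
  have b2: "card b \<ge> 2" using V8 card_V by simp
  obtain U v where U: "subgroup U (BijGroup b)" "U \<subseteq> V" and v: "v \<in> V" "v \<notin> U"
    and gV: "generate (BijGroup b) (insert v U) = V" by (rule maximal_subgroup[OF b2])
  note UB = subgroup_BijD[OF U(1)]
  have U4: "card U = 4"
    using G.adjoin_element(5)[OF V finV U v commV] sq v(1) V8 unfolding gV by simp
  have finU: "finite U" using U(2) finV finite_subset by blast
  have "\<not> U \<subseteq> {\<^bold>1}" using U4 card_mono[of "{\<^bold>1}" U] by auto
  then obtain e where e: "e \<in> U" "e \<noteq> \<^bold>1" by auto
  have "\<not> U \<subseteq> {\<^bold>1, e}" using U4 card_mono[of "{\<^bold>1, e}" U] e by auto
  then obtain f where f: "f \<in> U" "f \<noteq> \<^bold>1" "f \<noteq> e" by auto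
  note efU = square_one_closed_four[OF U U4 sq e(1) f(1) e(2) f(2) f(3)[symmetric]]
  let ?D = "{\<^bold>1, e, f}"
  have DU: "?D \<subseteq> U" using e f UB(3) by auto
  have DV: "?D \<subseteq> V" using DU U(2) by blast
  have eV: "e \<in> V" "f \<in> V" using DV by auto
  have eB: "e \<in> Bij b" "f \<in> Bij b" using eV VB(2) by auto
  have oneD: "\<^bold>1 \<in> ?D" by simp
  have ef: "e \<cdot> f \<notin> ?D" "f \<cdot> e \<notin> ?D"
  proof -
    have ee: "e \<cdot> e = \<^bold>1" using sq eV by blast
    have "e \<cdot> f \<noteq> e \<cdot> \<^bold>1" "e \<cdot> f \<noteq> \<^bold>1 \<cdot> f" "e \<cdot> f \<noteq> e \<cdot> e"
      using e f eB by simp_all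
    thus 1: "e \<cdot> f \<notin> ?D" using eB ee by simp
    thus "f \<cdot> e \<notin> ?D" using comm[OF eV] by simp
  qed
  \<comment> \<open>The remaining element of \<open>U\<close> is e f; every nontrivial candidate for
    s takes some member of \<open>?D\<close> to it.\<close>
  have transl: "s = \<^bold>1" if s: "s \<in> V" "s ` pts ?D \<subseteq> pts ?D" for s
  proof -
    have st: "s \<cdot> d \<in> ?D" if "d \<in> ?D" for d
    proof -
      have dV: "d \<in> V" using that DV by blast
      have "s (d z) \<in> pts ?D" using s(2) that by blast
      hence "(s \<cdot> d) z \<in> pts ?D" using ap[OF VB(2)[OF s(1)] VB(2)[OF dV] z] by simp
      thus ?thesis using pts_iff[OF VB(4)[OF s(1) dV] DV] by simp
    qed
    have "s \<in> ?D" using st[OF oneD] VB(2)[OF s(1)] by simp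
    thus ?thesis using st[of e] st[of f] ef by auto
  qed
  let ?S = "stab X (pts ?D)" and ?C = "b - pts U"
  \<comment> \<open>The elements of \<open>V\<close> that x conjugates into \<open>U\<close> form a
    subgroup. For x in the stabiliser it contains e and f, hence all of \<open>U\<close>.\<close>
  have UV: "subgroup {u \<in> V. x \<cdot> u \<cdot> iv x \<in> U} (BijGroup b)" if x: "x \<in> X" for x
  proof (rule subgroup_BijI[OF _ V])
    show "\<^bold>1 \<in> {u \<in> V. x \<cdot> u \<cdot> iv x \<in> U}" using VB(3) UB(3) XB(2)[OF x] by simp
    fix g assume g: "g \<in> {u \<in> V. x \<cdot> u \<cdot> iv x \<in> U}"
    hence "iv g = g" using sq VB(2) G.inv_equality[of g g] by simp
    thus "iv g \<in> {u \<in> V. x \<cdot> u \<cdot> iv x \<in> U}" using g by simp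
    fix h assume h: "h \<in> {u \<in> V. x \<cdot> u \<cdot> iv x \<in> U}"
    have gh: "g \<in> Bij b" "h \<in> Bij b" using g h VB(2) by auto
    have "iv x \<cdot> (x \<cdot> (h \<cdot> iv x)) = h \<cdot> iv x" using gh XB(2)[OF x] by (intro cancel) simp_all
    hence "x \<cdot> (g \<cdot> h) \<cdot> iv x = (x \<cdot> g \<cdot> iv x) \<cdot> (x \<cdot> h \<cdot> iv x)"
      using gh XB(2)[OF x] by (simp add: G.m_assoc)
    also have "\<dots> \<in> U" using g h UB(4) by blast
    finally show "g \<cdot> h \<in> {u \<in> V. x \<cdot> u \<cdot> iv x \<in> U}" using g h VB(4) by blast
  qed auto
  have SU: "x z \<in> pts ?D" "\<And>u. u \<in> U \<Longrightarrow> x \<cdot> u \<cdot> iv x \<in> U" if x: "x \<in> ?S" for x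
  proof -
    have xX: "x \<in> X" using x by (simp add: stab_def)
    have xD: "x (d z) \<in> pts ?D" if "d \<in> ?D" for d using x that unfolding stab_def by blast
    show xz: "x z \<in> pts ?D" using xD[OF oneD] BijGroup_one_apply[OF z] by simp
    then obtain c where c: "c \<in> ?D" "x z = c z" by blast
    have cU: "c \<in> U" using c DU by blast
    have cV: "c \<in> V" using cU U(2) by blast
    have "x \<cdot> d \<cdot> iv x \<in> U" if d: "d \<in> ?D" for d
    proof -
      have dV: "d \<in> V" using d DV by blast
      let ?d = "x \<cdot> d \<cdot> iv x"
      have d': "?d \<in> V" using nV[OF xX dV] .
      have "x (d z) = (?d \<cdot> c) z"
        using conj_apply[OF xX dV z] c(2) ap[OF VB(2)[OF d'] VB(2)[OF cV] z] by simp
      hence "?d \<cdot> c \<in> ?D" using xD[OF d] pts_iff[OF VB(4)[OF d' cV] DV] by simp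
      hence "?d \<cdot> c \<in> U" using DU by blast
      hence "?d \<cdot> c \<cdot> iv c \<in> U" using UB(4)[OF _ UB(5)[OF cU]] by blast
      moreover have "?d \<cdot> c \<cdot> iv c = ?d" using VB(2)[OF d'] VB(2)[OF cV] by (simp add: G.m_assoc)
      ultimately show ?thesis by simp
    qed
    hence "U \<subseteq> {u \<in> V. x \<cdot> u \<cdot> iv x \<in> U}" using efU[OF UV[OF xX]] eV by simp
    thus "\<And>u. u \<in> U \<Longrightarrow> x \<cdot> u \<cdot> iv x \<in> U" by blast
  qed
  have C4: "card ?C = 4"
    using card_Diff_subset[of "pts U" b] finU pts_subset[OF U(2)] card_pts[OF U(2)] U4 card_V V8 by simp
  have "tame (BijGroup b) X ?S"
  proof (rule tame_of_nilpotent_le_W[OF pts_subset[OF DV]])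
    show "w = \<^bold>1" if "w \<in> W" "w ` pts ?D = pts ?D" for w using transl[of w] that by blast
    fix N assume N: "subgroup N (BijGroup b)" "N \<subseteq> ?S" "nilpotent_group (BijGroup b\<lparr>carrier := N\<rparr>)"
    have "card N \<le> 2 ^ (card ?C - 1)"
    proof (rule nilpotent_card_le_of_faithful[OF N(1,3) fin])
      show "?C \<noteq> {}" using C4 by (metis card.empty zero_neq_numeral)
      fix g assume "g \<in> N"
      hence g: "g \<in> ?S" using N(2) by blast
      have gX: "g \<in> X" using g by (simp add: stab_def)
      obtain c where c: "c \<in> ?D" "g z = c z" using SU(1)[OF g] by blast
      have cV: "c \<in> V" and cU: "c \<in> U" using c DV DU by blast+
      have "g ` pts U \<subseteq> pts U"
      proof clarify
        fix u assume u: "u \<in> U"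
        have uV: "u \<in> V" using u U(2) by blast
        have "g (u z) = ((g \<cdot> u \<cdot> iv g) \<cdot> c) z"
          using conj_apply[OF gX uV z] c(2) ap[OF VB(2)[OF nV[OF gX uV]] VB(2)[OF cV] z] by simp
        thus "g (u z) \<in> pts U" using UB(4)[OF SU(2)[OF g u] cU] by simp
      qed
      hence "g ` pts U = pts U"
        by (rule image_eq_subset_card[OF XB(2)[OF gX] pts_subset[OF U(2)] fin])
      thus "g ` ?C = ?C"
        using inj_on_image_set_diff[OF Bij_inj_on[OF XB(2)[OF gX]], of b "pts U"]
          pts_subset[OF U(2)] Bij_image[OF XB(2)[OF gX]] by auto
      assume fx: "\<And>y. y \<in> ?C \<Longrightarrow> g y = y"
      have vz: "v z \<in> ?C" using VB(6)[OF v(1) z] pts_iff[OF v(1) U(2)] v(2) by simp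
      \<comment> \<open>Both \<open>v z\<close> and \<open>u (v z)\<close> lie off the
        \<open>U\<close>-orbit and are fixed by g, so g commutes with u by regularity.\<close>
      have cj: "g \<cdot> u \<cdot> iv g = u" if u: "u \<in> U" for u
      proof -
        have uV: "u \<in> V" using u U(2) by blast
        have "u \<cdot> v \<notin> U"
        proof
          assume "u \<cdot> v \<in> U"
          hence "iv u \<cdot> (u \<cdot> v) \<in> U" using u UB(4)[OF UB(5)[OF u]] by blast
          thus False using cancel[OF VB(2)[OF uV] VB(2)[OF v(1)]] v(2) by simp
        qed
        hence "(u \<cdot> v) z \<in> ?C"
          using VB(6)[OF VB(4)[OF uV v(1)] z] pts_iff[OF VB(4)[OF uV v(1)] U(2)] by simp
        hence "g (u (v z)) = u (v z)" using fx ap[OF VB(2)[OF uV] VB(2)[OF v(1)] z] by simp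
        hence "(g \<cdot> u \<cdot> iv g) (v z) = u (v z)"
          using conj_apply[OF gX uV VB(6)[OF v(1) z]] fx[OF vz] by simp
        thus ?thesis by (rule V_eqI[OF nV[OF gX uV] uV VB(6)[OF v(1) z]])
      qed
      \<comment> \<open>As g commutes with \<open>U\<close>, it acts on the three points as the
        translation by c, which \<open>transl\<close> forces to be trivial.\<close>
      have gd: "g (d z) = d (c z)" if d: "d \<in> ?D" for d
      proof -
        have "d \<in> V" "d \<in> U" using d DV DU by blast+
        thus ?thesis using conj_apply[OF gX _ z, of d] cj[of d] c(2) by simp
      qed
      have "c ` pts ?D \<subseteq> pts ?D"
      proof clarify
        fix d assume d: "d \<in> ?D"
        have dV: "d \<in> V" using d DV by blast
        have "c (d z) = d (c z)"
          using comm[OF cV dV] ap[OF VB(2)[OF cV] VB(2)[OF dV] z] ap[OF VB(2)[OF dV] VB(2)[OF cV] z] by simp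
        hence "c (d z) = g (d z)" using gd[OF d] by simp
        thus "c (d z) \<in> pts ?D" using g d unfolding stab_def by blast
      qed
      hence "c = \<^bold>1" by (rule transl[OF cV])
      hence cz: "c z = z" using BijGroup_one_apply[OF z] by simp
      have gz: "g z = z" using c cz by simp
      show "g = \<^bold>1"
      proof (rule eq_one_of_fixed[OF gX gz, of "{e, f, v}"])
        show "{e, f, v} \<subseteq> V" using eV v by auto
        show "g (d z) = d z" if "d \<in> {e, f, v}" for d
          using that gd[of e] gd[of f] cz fx[OF vz] by auto
        show "\<forall>U. subgroup U (BijGroup b) \<longrightarrow> {e, f, v} \<subseteq> U \<longrightarrow> V \<subseteq> U"
        proof (intro allI impI)
          fix U' assume U': "subgroup U' (BijGroup b)" "{e, f, v} \<subseteq> U'"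
          have "insert v U \<subseteq> U'" using efU[OF U'(1)] U'(2) by simp
          thus "V \<subseteq> U'" using G.generate_subgroup_incl[OF _ U'(1)] gV by blast
        qed
      qed
    qed blast
    thus "card N \<le> card W" unfolding C4 WV V8 by simp
  qed
  moreover have "card ?D = 3" using e f by simp
  ultimately show ?thesis using DV by blast
qed

text \<open>A set that is not half of \<open>b\<close> differs in size from its complement. In even
  degree 2^k a frame has k + 1 points, and 2 (k + 1) = 2^k only for k = 3; that exception is covered
  by the sets of size 3.\<close>

lemma exists_tame_not_half:
  assumes b3: "card b \<ge> 3" and par: "odd (card b) \<or> (\<forall>v\<in>V. v \<cdot> v = \<^bold>1)"
  shows "\<exists>D\<subseteq>b. 2 * card D \<noteq> card b \<and> tame (BijGroup b) X (stab X D)"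
proof (cases "W = {\<^bold>1}")
  case True
  have "card N * card (stab X {}) \<le> card X" if "N \<subseteq> stab X {}" for N
  proof -
    have "N \<subseteq> {\<^bold>1}" "stab X {} = {\<^bold>1}" using that X_trivial[OF True] by (auto simp: stab_def)
    thus ?thesis using card_mono[of "{\<^bold>1}" N] X_trivial[OF True] by simp
  qed
  hence "tame (BijGroup b) X (stab X {})" by (simp add: tame_def)
  moreover have "2 * card ({} :: 'a set) \<noteq> card b" using b3 by simp
  ultimately show ?thesis by blast
next
  case False
  show ?thesis
  proof (cases "card b = 8")
    case True
    hence sq: "\<forall>v\<in>V. v \<cdot> v = \<^bold>1" using par by simp
    obtain R where R: "R \<subseteq> V - W" "\<forall>r\<in>R. \<forall>r'\<in>R. \<forall>w\<in>W. r' = w \<cdot> r \<longrightarrow> r' = r"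
      "\<forall>U. subgroup U (BijGroup b) \<longrightarrow> W \<subseteq> U \<longrightarrow> R \<subseteq> U \<longrightarrow> V \<subseteq> U"
      "(\<forall>v\<in>V. v \<cdot> v = \<^bold>1) \<longrightarrow> card W * 2 ^ card R = card V"
      by (rule G.independent_generators[OF V finV commV W Int_lower2]) (rule that; assumption)
    have 8: "card W * 2 ^ card R = 8" using R(4) sq True card_V by simp
    have "card W > 1"
    proof -
      have "finite W" using finV by simp
      moreover have "{\<^bold>1} \<subset> W" using False WB(3) by blast
      ultimately show ?thesis using psubset_card_mono[of W "{\<^bold>1}"] by simp
    qed
    have "card R < 3"
    proof (rule ccontr)
      assume "\<not> card R < 3"
      hence "(2::nat) ^ 3 \<le> 2 ^ card R" by (intro power_increasing) auto
      hence "2 * (2::nat) ^ 3 \<le> card W * 2 ^ card R" using \<open>card W > 1\<close> by (intro mult_le_mono) auto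
      thus False using 8 by simp
    qed
    \<comment> \<open>The index of \<open>W\<close> in \<open>V\<close> is 1, 2 or 4, since index 8
      would make \<open>W\<close> trivial.\<close>
    then consider "card R = 0" | "card R = 1" | "card R = 2" by linarith
    hence "\<exists>D\<subseteq>V. card D = 3 \<and> tame (BijGroup b) X (stab X (pts D))"
    proof cases
      case 1
      have "card W = card V" using 8 1 card_V True by simp
      hence "W = V" using finV by (intro card_subset_eq) auto
      thus ?thesis using three_set_W8[OF sq] True card_V by simp
    next
      case 2
      then obtain v where v: "R = {v}" by (auto simp: card_1_singleton_iff)
      have "card W = 4" using 8 2 by simp
      moreover have "v \<in> V - W" using R(1) v by blast
      moreover have "\<forall>U. subgroup U (BijGroup b) \<longrightarrow> W \<subseteq> U \<longrightarrow> v \<in> U \<longrightarrow> V \<subseteq> U"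
        using R(3) unfolding v by blast
      ultimately show ?thesis by (rule three_set_W4[OF sq])
    next
      case 3
      have "card W = 2" using 8 3 by simp
      thus ?thesis using three_set_W2[OF sq _ 3 R(1,2,3)] by blast
    qed
    then obtain D where D: "D \<subseteq> V" "card D = 3" "tame (BijGroup b) X (stab X (pts D))" by blast
    have "2 * card (pts D) \<noteq> card b" using card_pts[OF D(1)] D(2) True by simp
    thus ?thesis using D(3) pts_subset[OF D(1)] by blast
  next
    case b8: False
    obtain F R where F: "F \<subseteq> W" "\<^bold>1 \<in> F" "\<exists>f\<in>F. f \<noteq> \<^bold>1" and R: "R \<subseteq> V - W"
      "\<forall>r\<in>R. \<forall>r'\<in>R. \<forall>w\<in>W. r' = w \<cdot> r \<longrightarrow> r' = r"
      and gen: "\<forall>U. subgroup U (BijGroup b) \<longrightarrow> F \<union> R \<subseteq> U \<longrightarrow> V \<subseteq> U"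
      and triv: "\<And>w. w \<in> W \<Longrightarrow> w ` pts (F \<union> R) = pts (F \<union> R) \<Longrightarrow> w = \<^bold>1"
      and c: "2 ^ (card F - 1) \<le> card W"
      and e: "(\<forall>v\<in>V. v \<cdot> v = \<^bold>1) \<longrightarrow> 2 ^ (card (F \<union> R) - 1) = card b"
      by (rule exists_frame[OF b3 False]) (rule that; assumption)
    have FRV: "F \<union> R \<subseteq> V" using F R by auto
    have "tame (BijGroup b) X (stab X (pts (F \<union> R)))" by (rule tame_frame[OF F R gen triv c])
    moreover have "2 * card (pts (F \<union> R)) \<noteq> card b"
    proof
      assume h: "2 * card (pts (F \<union> R)) = card b"
      hence "even (card b)" by (metis dvd_triv_left)
      hence k: "2 ^ (card (F \<union> R) - 1) = card b" using par e by blast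
      define k where "k = card (F \<union> R) - 1"
      have "card (F \<union> R) > 0" using h card_pts[OF FRV] b3 by simp
      hence k2: "2 * (k + 1) = (2::nat) ^ k" using h card_pts[OF FRV] k k_def by simp
      have "k < 4"
      proof (rule ccontr)
        assume "\<not> k < 4"
        then obtain j where j: "k = j + 4" by (metis add.commute le_Suc_ex linorder_not_less)
        define p where "p = (2::nat) ^ j"
        have "j + 1 \<le> p" using less_exp[of j] unfolding p_def by linarith
        moreover have "2 * (j + 5) = 16 * p" using k2 unfolding j p_def by (simp add: power_add)
        ultimately show False by presburger
      qed
      hence "k = 0 \<or> k = 1 \<or> k = 2 \<or> k = 3" by linarith
      hence "k = 3" using k2 by auto
      thus False using k k_def b8 by simp
    qed
    ultimately show ?thesis using pts_subset[OF FRV] by blast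
  qed
qed

end

section \<open>Assembling good sets over the orbits of an abelian normal subgroup\<close>

lemma tame_trivial: "L = {\<one>\<^bsub>G\<^esub>} \<Longrightarrow> tame G L (stab L D)" for G :: "('a \<Rightarrow> 'a) monoid"
proof -
  assume L: "L = {\<one>\<^bsub>G\<^esub>}"
  have "card N * card (stab L D) \<le> card L" if "N \<subseteq> stab L D" for N
  proof -
    have s: "stab L D \<subseteq> L" by (auto simp: stab_def)
    have "card N \<le> 1" "card (stab L D) \<le> 1"
      using card_mono[of L N] card_mono[of L "stab L D"] that s L by auto
    thus ?thesis using mult_le_mono[of "card N" 1 "card (stab L D)" 1] L by simp
  qed
  thus ?thesis by (simp add: tame_def)
qed

text \<open>This allows a set to be exchanged for its complement when its size lies on the wrong
  side of half the orbit.\<close>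

lemma stab_Diff:
  assumes "L \<subseteq> Bij S" "D \<subseteq> S"
  shows "stab L (S - D) = stab L D"
proof -
  have "g ` (S - D) = S - D \<longleftrightarrow> g ` D = D" if "g \<in> L" for g
  proof -
    have g: "g \<in> Bij S" using assms that by blast
    have 1: "g ` (S - D) = S - g ` D"
      using inj_on_image_set_diff[OF Bij_inj_on[OF g], of S D] assms(2) Bij_image[OF g] by auto
    have "g ` D \<subseteq> g ` S" by (rule image_mono[OF assms(2)])
    hence "S - (S - g ` D) = g ` D" "S - (S - D) = D"
      unfolding Bij_image[OF g] using assms(2) by (simp_all add: double_diff)
    thus ?thesis unfolding 1 by metis
  qed
  thus ?thesis unfolding stab_def by (intro Collect_cong conj_cong refl)
qed

lemma subgroup_Bij: "subgroup (Bij S) (BijGroup S)"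
  using group.subgroup_self[OF group_BijGroup, of S] by simp

text \<open>Induct on the set \<open>B\<close> of orbits that \<open>L\<close> may move: restricting
  \<open>L\<close> to one of them gives a regular pair, and the kernel of the restriction moves only
  the others. The arbitrary predicate \<open>Q\<close> prescribes, orbit by orbit, on which side of
  half the intersection has to lie.\<close>

lemma tame_orbitwise:
  assumes fin: "finite S" and M: "subgroup M (BijGroup S)"
    and comm: "\<forall>m\<in>M. \<forall>n\<in>M. m \<otimes>\<^bsub>BijGroup S\<^esub> n = n \<otimes>\<^bsub>BijGroup S\<^esub> m"
    and par: "odd (card M) \<or> (\<forall>m\<in>M. m \<otimes>\<^bsub>BijGroup S\<^esub> m = \<one>\<^bsub>BijGroup S\<^esub>)"
    and d: "\<forall>x\<in>S. card (porb M x) = d" "d \<ge> 3"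
    and B: "finite B" "B \<subseteq> porb M ` S"
    and L: "subgroup L (BijGroup S)" "\<forall>l\<in>L. \<forall>x\<in>S. l x \<in> porb M x"
      "\<forall>l\<in>L. \<forall>m\<in>M. l \<otimes>\<^bsub>BijGroup S\<^esub> m \<otimes>\<^bsub>BijGroup S\<^esub> inv\<^bsub>BijGroup S\<^esub> l \<in> M"
      "\<forall>m\<in>M. \<forall>l\<in>L. m \<otimes>\<^bsub>BijGroup S\<^esub> l \<otimes>\<^bsub>BijGroup S\<^esub> inv\<^bsub>BijGroup S\<^esub> m \<in> L"
      "\<forall>l\<in>L. \<forall>x\<in>S - \<Union>B. l x = x"
  shows "\<exists>D\<subseteq>\<Union>B. tame (BijGroup S) L (stab L D) \<and>
    (\<forall>b\<in>B. (Q b \<longleftrightarrow> 2 * card (D \<inter> b) < d) \<and> 2 * card (D \<inter> b) \<noteq> d)"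
  using B L
proof (induction B arbitrary: L rule: finite_induct)
  case empty
  have "l = \<one>\<^bsub>BijGroup S\<^esub>" if "l \<in> L" for l
    using Bij_eq_one_iff[of l S] subgroup_BijD(2)[OF empty.prems(2) that] empty.prems(6) that by simp
  hence "L = {\<one>\<^bsub>BijGroup S\<^esub>}" using subgroup_BijD(3)[OF empty.prems(2)] by blast
  from tame_trivial[OF this] show ?case by blast
next
  case (insert b B)
  let ?G = "BijGroup S" and ?H = "BijGroup b"
  interpret G: group ?G by (rule group_BijGroup)
  interpret H: group ?H by (rule group_BijGroup)
  note L = insert.prems(2) and pres = insert.prems(3) and nM = insert.prems(4)
    and nL = insert.prems(5) and fixed = insert.prems(6)
  note LB = subgroup_BijD[OF L] and MB = subgroup_BijD[OF M]
  obtain x0 where x0: "x0 \<in> S" "b = porb M x0" using insert.prems(1) by auto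
  have bS: "b \<subseteq> S" using porb_subset[OF M x0(1)] x0 by simp
  have finb: "finite b" using bS fin finite_subset by blast
  have x0b: "x0 \<in> b" using porb_self[OF M] x0 by simp
  have cb: "card b = d" using d(1) x0 by simp
  have Bdisj: "b \<inter> b' = {}" if b': "b' \<in> B" for b'
  proof -
    obtain y where y: "y \<in> S" "b' = porb M y" using insert.prems(1) b' by auto
    have "porb M x0 \<noteq> porb M y" using insert.hyps(2) b' x0 y by auto
    thus ?thesis using porb_disjoint[OF M x0(1) y(1)] x0 y by simp
  qed
  have Lb: "l ` b = b" if l: "l \<in> L" for l
  proof (rule image_eq_subset_card[OF LB(2)[OF l] bS fin])
    show "l ` b \<subseteq> b"
    proof (rule image_subsetI)
      fix y assume y: "y \<in> b"
      hence "porb M y = porb M x0" using porb_eq[OF M x0(1)] x0(2) by simp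
      thus "l y \<in> b" using pres l y bS x0(2) by blast
    qed
  qed
  have Mb: "m ` b = b" if "m \<in> M" for m using porb_mem_image[OF M that x0(1)] x0(2) by simp
  \<comment> \<open>The stabiliser of \<open>b\<close> in the full symmetric group is a common
    domain of the restriction map for \<open>M\<close> and \<open>L\<close>, so conjugates of one by
    the other are respected.\<close>
  let ?A = "stab (Bij S) b" and ?r = "\<lambda>g. restrict g b"
  have A: "subgroup ?A ?G" by (rule subgroup_stab[OF subgroup_Bij bS])
  have LA: "L \<subseteq> ?A" using LB(1) Lb by (auto simp: stab_def)
  have MA: "M \<subseteq> ?A" using MB(1) Mb by (auto simp: stab_def)
  have homA: "?r \<in> hom (?G\<lparr>carrier := ?A\<rparr>) ?H" by (rule restrict_hom[OF A bS]) (simp add: stab_def)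
  have homL: "?r \<in> hom (?G\<lparr>carrier := L\<rparr>) ?H" by (rule restrict_hom[OF L bS Lb])
  interpret r: group_hom "?G\<lparr>carrier := ?A\<rparr>" ?H ?r
    using G.subgroup_imp_group[OF A] homA H.group_axioms by (simp add: group_hom_def group_hom_axioms_def)
  have rm: "?r (f \<otimes>\<^bsub>?G\<^esub> g) = ?r f \<otimes>\<^bsub>?H\<^esub> ?r g" if "f \<in> ?A" "g \<in> ?A" for f g
    using r.hom_mult[of f g] that by simp
  have ri: "?r (inv\<^bsub>?G\<^esub> f) = inv\<^bsub>?H\<^esub> (?r f)" if "f \<in> ?A" for f
    using r.hom_inv[of f] that G.m_inv_consistent[OF A that] by simp
  note AB = subgroup_BijD[OF A]
  have rc: "?r (f \<otimes>\<^bsub>?G\<^esub> g \<otimes>\<^bsub>?G\<^esub> inv\<^bsub>?G\<^esub> f) = ?r f \<otimes>\<^bsub>?H\<^esub> ?r g \<otimes>\<^bsub>?H\<^esub> inv\<^bsub>?H\<^esub> (?r f)"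
    if "f \<in> ?A" "g \<in> ?A" for f g
    using rm[OF AB(4)[OF that] AB(5)[OF that(1)]] rm[OF that] ri[OF that(1)] by simp
  let ?V = "?r ` M" and ?X = "?r ` L"
  have V: "subgroup ?V ?H"
    using r.subgroup_img_is_subgroup[OF G.subgroup_incl[OF M A MA]] .
  have X: "subgroup ?X ?H"
    using r.subgroup_img_is_subgroup[OF G.subgroup_incl[OF L A LA]] .
  interpret RP: regular_pair b ?V ?X x0
  proof (rule regular_pair.intro)
    show "finite b" by (rule finb)
    show "x0 \<in> b" by (rule x0b)
    show "subgroup ?V ?H" by (rule V)
    show "subgroup ?X ?H" by (rule X)
    show "v \<otimes>\<^bsub>?H\<^esub> w = w \<otimes>\<^bsub>?H\<^esub> v" if vw: "v \<in> ?V" "w \<in> ?V" for v w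
    proof -
      obtain m n where mn: "m \<in> M" "n \<in> M" "v = ?r m" "w = ?r n" using vw by blast
      have "m \<otimes>\<^bsub>?G\<^esub> n = n \<otimes>\<^bsub>?G\<^esub> m" using comm mn by blast
      thus ?thesis using rm[of m n] rm[of n m] mn MA by (metis subsetD)
    qed
    show "\<exists>v\<in>?V. v x0 = y" if "y \<in> b" for y
      using that x0b unfolding x0(2) by (auto simp: porb_def)
    show "v \<otimes>\<^bsub>?H\<^esub> x \<otimes>\<^bsub>?H\<^esub> inv\<^bsub>?H\<^esub> v \<in> ?X" if vx: "v \<in> ?V" "x \<in> ?X" for v x
    proof -
      obtain m l where ml: "m \<in> M" "l \<in> L" "v = ?r m" "x = ?r l" using vx by blast
      have "m \<otimes>\<^bsub>?G\<^esub> l \<otimes>\<^bsub>?G\<^esub> inv\<^bsub>?G\<^esub> m \<in> L" using nL ml by blast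
      hence "?r (m \<otimes>\<^bsub>?G\<^esub> l \<otimes>\<^bsub>?G\<^esub> inv\<^bsub>?G\<^esub> m) \<in> ?X" by (rule imageI)
      thus ?thesis unfolding ml(3,4) using rc[OF subsetD[OF MA ml(1)] subsetD[OF LA ml(2)]] by simp
    qed
    show "x \<otimes>\<^bsub>?H\<^esub> v \<otimes>\<^bsub>?H\<^esub> inv\<^bsub>?H\<^esub> x \<in> ?V" if vx: "x \<in> ?X" "v \<in> ?V" for v x
    proof -
      obtain m l where ml: "m \<in> M" "l \<in> L" "v = ?r m" "x = ?r l" using vx by blast
      have "l \<otimes>\<^bsub>?G\<^esub> m \<otimes>\<^bsub>?G\<^esub> inv\<^bsub>?G\<^esub> l \<in> M" using nM ml by blast
      hence "?r (l \<otimes>\<^bsub>?G\<^esub> m \<otimes>\<^bsub>?G\<^esub> inv\<^bsub>?G\<^esub> l) \<in> ?V" by (rule imageI)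
      thus ?thesis unfolding ml(3,4) using rc[OF subsetD[OF LA ml(2)] subsetD[OF MA ml(1)]] by simp
    qed
  qed
  have par': "odd (card b) \<or> (\<forall>v\<in>?V. v \<otimes>\<^bsub>?H\<^esub> v = \<one>\<^bsub>?H\<^esub>)"
    using par
  proof
    assume "odd (card M)"
    \<comment> \<open>The restriction of \<open>M\<close> to \<open>b\<close> is regular, so the
      size of \<open>b\<close> is the order of an image of \<open>M\<close>.\<close>
    moreover have "card b dvd card M"
      using card_hom_image_kernel[OF group_BijGroup group_BijGroup homA A M MA] RP.card_V
        finite_Bij[OF fin] by (simp add: stab_def)
    ultimately show ?thesis by (meson dvd_trans)
  next
    assume sq: "\<forall>m\<in>M. m \<otimes>\<^bsub>?G\<^esub> m = \<one>\<^bsub>?G\<^esub>"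
    have "?r m \<otimes>\<^bsub>?H\<^esub> ?r m = \<one>\<^bsub>?H\<^esub>" if "m \<in> M" for m
      using rm[of m m] that MA sq r.hom_one by auto
    thus ?thesis by blast
  qed
  obtain D0 where D0: "D0 \<subseteq> b" "2 * card D0 \<noteq> d" "tame ?H ?X (stab ?X D0)"
    using RP.exists_tame_not_half[OF _ par'] cb d(2) by auto
  \<comment> \<open>Passing to the complement reverses the comparison with d/2; equality is excluded
    by the choice of \<open>D0\<close>.\<close>
  define D1 where "D1 = (if Q b \<longleftrightarrow> 2 * card D0 < d then D0 else b - D0)"
  have D1: "D1 \<subseteq> b" "2 * card D1 \<noteq> d" "Q b \<longleftrightarrow> 2 * card D1 < d" "tame ?H ?X (stab ?X D1)"
  proof -
    have "card (b - D0) = d - card D0" "card D0 \<le> d"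
      using card_Diff_subset[of D0 b] card_mono[OF finb D0(1)] finite_subset[OF D0(1) finb] D0(1) cb by auto
    thus "D1 \<subseteq> b" "2 * card D1 \<noteq> d" "Q b \<longleftrightarrow> 2 * card D1 < d"
      using D0(1,2) unfolding D1_def by auto
    show "tame ?H ?X (stab ?X D1)"
      using D0(3) stab_Diff[OF RP.XB(1) D0(1)] by (simp add: D1_def)
  qed
  \<comment> \<open>The pointwise stabiliser of \<open>b\<close> in \<open>L\<close>, to which the
    induction hypothesis will be applied.\<close>
  define L' where "L' = {l \<in> L. ?r l = \<one>\<^bsub>?H\<^esub>}"
  have L'_iff: "l \<in> L' \<longleftrightarrow> l \<in> L \<and> (\<forall>y\<in>b. l y = y)" for l
    by (simp only: L'_def mem_Collect_eq restrict_eq_one_iff)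
  have L'L: "L' \<subseteq> L" by (auto simp: L'_def)
  have L': "subgroup L' ?G"
  proof (rule subgroup_BijI[OF L'L L])
    show "\<one>\<^bsub>?G\<^esub> \<in> L'" using LB(3) bS BijGroup_one_apply[of _ S] unfolding L'_iff by blast
    fix f assume f: "f \<in> L'"
    show "inv\<^bsub>?G\<^esub> f \<in> L'"
      unfolding L'_iff
    proof (intro conjI ballI)
      show "inv\<^bsub>?G\<^esub> f \<in> L" using f L'L LB(5) by blast
      fix y assume y: "y \<in> b"
      hence "f y = y" using f unfolding L'_iff by blast
      thus "(inv\<^bsub>?G\<^esub> f) y = y"
        using BijGroup_inv_apply(2)[of f S y] f L'L LB(2) y bS by (metis subsetD)
    qed
    fix g assume g: "g \<in> L'"
    show "f \<otimes>\<^bsub>?G\<^esub> g \<in> L'"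
      unfolding L'_iff
    proof (intro conjI ballI)
      show "f \<otimes>\<^bsub>?G\<^esub> g \<in> L" using f g L'L LB(4) by blast
      fix y assume y: "y \<in> b"
      have "f y = y" "g y = y" using f g y unfolding L'_iff by blast+
      thus "(f \<otimes>\<^bsub>?G\<^esub> g) y = y"
        using BijGroup_mult_apply[of f S g y] f g L'L LB(2) y bS by (simp add: subset_iff)
    qed
  qed
  have "\<exists>D\<subseteq>\<Union>B. tame ?G L' (stab L' D) \<and>
    (\<forall>b\<in>B. (Q b \<longleftrightarrow> 2 * card (D \<inter> b) < d) \<and> 2 * card (D \<inter> b) \<noteq> d)"
  proof (rule insert.IH[OF _ L'])
    show "B \<subseteq> porb M ` S" using insert.prems(1) by simp
    show "\<forall>l\<in>L'. \<forall>x\<in>S. l x \<in> porb M x" using pres L'L by blast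
    show "\<forall>l\<in>L'. \<forall>m\<in>M. l \<otimes>\<^bsub>?G\<^esub> m \<otimes>\<^bsub>?G\<^esub> inv\<^bsub>?G\<^esub> l \<in> M" using nM L'L by blast
    show "\<forall>l\<in>L'. \<forall>x\<in>S - \<Union>B. l x = x"
    proof (intro ballI)
      fix l x assume l: "l \<in> L'" and x: "x \<in> S - \<Union>B"
      show "l x = x"
      proof (cases "x \<in> b")
        case True thus ?thesis using l unfolding L'_iff by blast
      next
        case False
        hence "x \<in> S - \<Union>(insert b B)" using x by simp
        thus ?thesis using fixed l L'L by blast
      qed
    qed
    show "\<forall>m\<in>M. \<forall>l\<in>L'. m \<otimes>\<^bsub>?G\<^esub> l \<otimes>\<^bsub>?G\<^esub> inv\<^bsub>?G\<^esub> m \<in> L'"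
    proof (intro ballI)
      fix m l assume m: "m \<in> M" and l: "l \<in> L'"
      have a: "m \<in> ?A" "l \<in> ?A" using m l L'L LA MA by auto
      have "?r l = \<one>\<^bsub>?H\<^esub>" using l by (simp add: L'_def)
      moreover have "?r m \<in> carrier ?H" using r.hom_closed[of m] a by simp
      ultimately have "?r (m \<otimes>\<^bsub>?G\<^esub> l \<otimes>\<^bsub>?G\<^esub> inv\<^bsub>?G\<^esub> m) = \<one>\<^bsub>?H\<^esub>"
        using rc[OF a] H.r_one[of "?r m"] H.r_inv[of "?r m"] by simp
      moreover have "m \<otimes>\<^bsub>?G\<^esub> l \<otimes>\<^bsub>?G\<^esub> inv\<^bsub>?G\<^esub> m \<in> L" using nL m l L'L by blast
      ultimately show "m \<otimes>\<^bsub>?G\<^esub> l \<otimes>\<^bsub>?G\<^esub> inv\<^bsub>?G\<^esub> m \<in> L'" by (simp add: L'_def)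
    qed
  qed
  then obtain D' where D': "D' \<subseteq> \<Union>B" "tame ?G L' (stab L' D')"
    "\<forall>b\<in>B. (Q b \<longleftrightarrow> 2 * card (D' \<inter> b) < d) \<and> 2 * card (D' \<inter> b) \<noteq> d" by blast
  let ?D = "D1 \<union> D'"
  have bD': "b \<inter> D' = {}" using D'(1) Bdisj by blast
  have Db: "?D \<inter> b = D1" "?D - b = D'" using bD' D1(1) by blast+
  have BS: "\<Union>B \<subseteq> S" using insert.prems(1) porb_subset[OF M] by blast
  have DS: "?D \<subseteq> S" using D1(1) D'(1) bS BS by blast
  have split: "g ` (?D \<inter> b) = g ` ?D \<inter> b" "g ` (?D - b) = g ` ?D - b" if g: "g \<in> L" for g
  proof -
    have "?D - b \<subseteq> S" using DS by blast
    thus "g ` (?D \<inter> b) = g ` ?D \<inter> b" "g ` (?D - b) = g ` ?D - b"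
      using inj_on_image_Int[OF Bij_inj_on[OF LB(2)[OF g]] DS bS]
        inj_on_image_set_diff[OF Bij_inj_on[OF LB(2)[OF g]] _ bS, of ?D] Lb[OF g] by simp_all
  qed
  have "tame ?G L (stab L ?D)"
  proof (rule tame_extension[OF group_BijGroup group_BijGroup homL L])
    show "subgroup (stab L ?D) ?G" by (rule subgroup_stab[OF L DS])
    show "stab L ?D \<subseteq> L" by (auto simp: stab_def)
    show "finite L" using finite_Bij[OF fin] LB(1) finite_subset by blast
    show "tame ?H ?X (stab ?X D1)" by (rule D1(4))
    show "finite (stab ?X D1)" unfolding stab_def using RP.finX by simp
    show "?r ` stab L ?D \<subseteq> stab ?X D1"
    proof (rule image_subsetI)
      fix g assume "g \<in> stab L ?D"
      hence g: "g \<in> L" "g ` ?D = ?D" by (auto simp: stab_def)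
      have "g ` D1 = D1" using split(1)[OF g(1)] g(2) Db(1) by simp
      moreover have "?r g ` D1 = g ` D1" using D1(1) by (intro image_cong) auto
      ultimately have "?r g ` D1 = D1" by simp
      thus "?r g \<in> stab ?X D1" using g(1) by (simp add: stab_def)
    qed
    \<comment> \<open>Elements fixing \<open>b\<close> pointwise preserve \<open>D1\<close>
      automatically, so only the condition on \<open>D'\<close> remains.\<close>
    have "{g \<in> stab L ?D. ?r g = \<one>\<^bsub>?H\<^esub>} = stab L' D'"
    proof -
      have "g ` ?D = ?D \<longleftrightarrow> g ` D' = D'" if g: "g \<in> L'" for g
      proof
        assume "g ` ?D = ?D"
        thus "g ` D' = D'" using split(2)[of g] g L'L Db(2) by auto
      next
        assume a: "g ` D' = D'"
        have "g ` D1 = D1" using g D1(1) unfolding L'_iff by force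
        thus "g ` ?D = ?D" using a by (simp add: image_Un)
      qed
      thus ?thesis by (auto simp: stab_def L'_def)
    qed
    thus "tame ?G {g \<in> L. ?r g = \<one>\<^bsub>?H\<^esub>} {g \<in> stab L ?D. ?r g = \<one>\<^bsub>?H\<^esub>}"
      using D'(2) by (simp add: L'_def)
  qed
  moreover have "?D \<subseteq> \<Union>(insert b B)" using D1(1) D'(1) by blast
  moreover have "(Q c \<longleftrightarrow> 2 * card (?D \<inter> c) < d) \<and> 2 * card (?D \<inter> c) \<noteq> d"
    if c: "c \<in> insert b B" for c
  proof (cases "c = b")
    case True thus ?thesis using D1(2,3) Db(1) by simp
  next
    case False
    hence "c \<in> B" using c by simp
    moreover have "?D \<inter> c = D' \<inter> c" using Bdisj[OF \<open>c \<in> B\<close>] D1(1) by blast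
    ultimately show ?thesis using D'(3) by simp
  qed
  ultimately show ?case by blast
qed

section \<open>Abelian normal subgroups of solvable groups\<close>

text \<open>The last nontrivial term \<open>A\<close> of the derived series is abelian and normal.
  If it contains involutions, its elements with trivial square form a normal subgroup of exponent 2;
  otherwise its order is odd.\<close>

lemma (in group) solvable_abelian_normal:
  assumes fin: "finite (carrier G)" and solv: "solvable G" and nt: "carrier G \<noteq> {\<one>}"
  obtains M where "subgroup M G" "M \<noteq> {\<one>}" "\<forall>g\<in>carrier G. \<forall>m\<in>M. g \<otimes> m \<otimes> inv g \<in> M"
    "\<forall>m\<in>M. \<forall>n\<in>M. m \<otimes> n = n \<otimes> m" "odd (card M) \<or> (\<forall>m\<in>M. m \<otimes> m = \<one>)"
proof -
  let ?D = "\<lambda>n. (derived G ^^ n) (carrier G)"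
  obtain n where n: "?D n = {\<one>}" "\<And>m. m < n \<Longrightarrow> ?D m \<noteq> {\<one>}"
    using solv exists_least_iff[of "\<lambda>n. ?D n = {\<one>}"] by (auto simp: solvable_iff_trivial_derived_seq)
  then obtain k where k: "n = Suc k" using nt by (cases n) auto
  define A where "A = ?D k"
  have nrm: "?D i \<lhd> G" for i
    by (induction i) (simp_all add: normal_self derived_is_normal)
  have A: "A \<lhd> G" "A \<noteq> {\<one>}" "derived G A = {\<one>}" using nrm[of k] n k by (auto simp: A_def)
  note AG = normal_imp_subgroup[OF A(1)]
  have comm: "m \<otimes> n = n \<otimes> m" if mn: "m \<in> A" "n \<in> A" for m n
  proof -
    have c: "m \<in> carrier G" "n \<in> carrier G" using mn subgroup.mem_carrier[OF AG] by auto
    have "m \<otimes> n \<otimes> inv m \<otimes> inv n \<in> derived G A"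
      unfolding derived_def using mn by (intro generate.incl) blast
    hence "m \<otimes> n \<otimes> inv m \<otimes> inv n = \<one>" using A(3) by simp
    hence "m \<otimes> n \<otimes> inv (n \<otimes> m) = \<one>" using c by (simp add: inv_mult_group m_assoc)
    hence "inv (inv (n \<otimes> m)) = m \<otimes> n" using c by (intro inv_equality) auto
    thus ?thesis using c by simp
  qed
  have conj: "g \<otimes> m \<otimes> inv g \<in> A" if "g \<in> carrier G" "m \<in> A" for g m
    using normal.inv_op_closed2[OF A(1) that] .
  define A2 where "A2 = {a \<in> A. a \<otimes> a = \<one>}"
  have A2A: "A2 \<subseteq> A" by (auto simp: A2_def)
  have A2G: "A2 \<subseteq> carrier G" using A2A subgroup.subset[OF AG] by blast
  show thesis
  proof (cases "A2 = {\<one>}")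
    case False
    have "subgroup A2 G"
    proof (rule subgroupI[OF A2G])
      show "A2 \<noteq> {}" using subgroup.one_closed[OF AG] by (auto simp: A2_def)
      fix a assume a: "a \<in> A2"
      hence "inv a = a" using A2G by (intro inv_equality) (auto simp: A2_def)
      thus "inv a \<in> A2" using a by simp
      fix b assume b: "b \<in> A2"
      have c: "a \<in> carrier G" "b \<in> carrier G" using a b A2G by auto
      have aa: "a \<otimes> a = \<one>" "b \<otimes> b = \<one>" using a b by (auto simp: A2_def)
      have "(a \<otimes> b) \<otimes> (a \<otimes> b) = a \<otimes> (b \<otimes> a) \<otimes> b" using c by (simp add: m_assoc)
      also have "b \<otimes> a = a \<otimes> b" using comm a b A2A by blast
      also have "a \<otimes> (a \<otimes> b) \<otimes> b = (a \<otimes> a) \<otimes> (b \<otimes> b)" using c by (simp add: m_assoc)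
      finally have "(a \<otimes> b) \<otimes> (a \<otimes> b) = \<one>" using aa by simp
      thus "a \<otimes> b \<in> A2" using a b subgroup.m_closed[OF AG] by (simp add: A2_def)
    qed
    moreover have "\<forall>g\<in>carrier G. \<forall>m\<in>A2. g \<otimes> m \<otimes> inv g \<in> A2"
    proof (intro ballI)
      fix g m assume g: "g \<in> carrier G" and m: "m \<in> A2"
      have c: "m \<in> carrier G" using m A2G by blast
      have "inv g \<otimes> (g \<otimes> (m \<otimes> inv g)) = m \<otimes> inv g" using g c by (simp add: m_assoc[symmetric])
      hence "(g \<otimes> m \<otimes> inv g) \<otimes> (g \<otimes> m \<otimes> inv g) = g \<otimes> (m \<otimes> m) \<otimes> inv g"
        using g c by (simp add: m_assoc)
      hence "(g \<otimes> m \<otimes> inv g) \<otimes> (g \<otimes> m \<otimes> inv g) = \<one>" using m g by (simp add: A2_def)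
      thus "g \<otimes> m \<otimes> inv g \<in> A2" using conj[OF g, of m] m by (simp add: A2_def)
    qed
    moreover have "\<forall>m\<in>A2. \<forall>n\<in>A2. m \<otimes> n = n \<otimes> m" using comm A2A by blast
    moreover have "\<forall>m\<in>A2. m \<otimes> m = \<one>" by (auto simp: A2_def)
    ultimately show thesis using that[of A2] False by blast
  next
    case True
    have "odd (card A)"
    proof
      assume "even (card A)"
      \<comment> \<open>The form \<open>2 ^ 1 * q\<close> suits \<open>sylow_thm\<close>; the
        resulting subgroup of order 2 supplies a nontrivial element of \<open>A2\<close>.\<close>
      then obtain q where q: "card A = 2 ^ 1 * q" by auto
      interpret A': group "G\<lparr>carrier := A\<rparr>" by (rule subgroup_imp_group[OF AG])
      have finA: "finite A" using subgroup.subset[OF AG] fin finite_subset by blast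
      obtain H where H: "subgroup H (G\<lparr>carrier := A\<rparr>)" "card H = 2 ^ 1"
        using sylow_thm[of 2 "G\<lparr>carrier := A\<rparr>" 1 q] q finA A'.group_axioms by (auto simp: order_def)
      have one: "\<one> \<in> H" using subgroup.one_closed[OF H(1)] by simp
      have HA: "H \<subseteq> A" using subgroup.subset[OF H(1)] by simp
      obtain h where h: "h \<in> H" "h \<noteq> \<one>" "H \<subseteq> {\<one>, h}"
      proof -
        obtain p r where pr: "H = {p, r}" "p \<noteq> r" using H(2) by (auto simp: card_2_iff)
        have "\<one> = p \<or> \<one> = r" using one pr(1) by simp
        thus thesis using that[of p] that[of r] pr by auto
      qed
      have hG: "h \<in> carrier G" using h HA subgroup.mem_carrier[OF AG] by blast
      have "h \<otimes> h \<in> H" using subgroup.m_closed[OF H(1) h(1) h(1)] by simp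
      moreover have "h \<otimes> h \<noteq> h" using h(2) hG by simp
      ultimately have "h \<in> A2" using h HA by (auto simp: A2_def)
      thus False using True h(2) by simp
    qed
    thus thesis using that[of A] AG A(2) conj comm by blast
  qed
qed

section \<open>The induction on the degree\<close>

text \<open>Transitivity is inherited by the action on the \<open>M\<close>-orbits, and it makes
  these orbits equally large, so that one threshold d/2 serves them all.\<close>

lemma exists_tame_set:
  assumes "finite S" "subgroup P (BijGroup S)" "solvable (BijGroup S\<lparr>carrier := P\<rparr>)"
    and "\<forall>x\<in>S. \<forall>y\<in>S. \<exists>g\<in>P. g x = y"
  shows "\<exists>D\<subseteq>S. tame (BijGroup S) P (stab P D)"
  using assms
proof (induction "card S" arbitrary: S P rule: less_induct)
  case less
  note fin = less.prems(1) and P = less.prems(2) and solv = less.prems(3) and trans = less.prems(4)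
  let ?G = "BijGroup S"
  interpret G: group ?G by (rule group_BijGroup)
  interpret P: group "?G\<lparr>carrier := P\<rparr>" by (rule G.subgroup_imp_group[OF P])
  note PB = subgroup_BijD[OF P]
  have finP: "finite P" using finite_Bij[OF fin] PB(1) finite_subset by blast
  show ?case
  proof (cases "P = {\<one>\<^bsub>?G\<^esub>}")
    case True
    from tame_trivial[OF this, of "{}"] show ?thesis by blast
  next
    case False
    obtain M where M': "subgroup M (?G\<lparr>carrier := P\<rparr>)" "M \<noteq> {\<one>\<^bsub>?G\<^esub>}"
      and nrm': "\<forall>g\<in>P. \<forall>m\<in>M. g \<otimes>\<^bsub>?G\<^esub> m \<otimes>\<^bsub>?G\<^esub> inv\<^bsub>?G\<lparr>carrier := P\<rparr>\<^esub> g \<in> M"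
      and comm: "\<forall>m\<in>M. \<forall>n\<in>M. m \<otimes>\<^bsub>?G\<^esub> n = n \<otimes>\<^bsub>?G\<^esub> m"
      and par: "odd (card M) \<or> (\<forall>m\<in>M. m \<otimes>\<^bsub>?G\<^esub> m = \<one>\<^bsub>?G\<^esub>)"
      using P.solvable_abelian_normal[OF _ solv] finP False by auto
    have M: "subgroup M ?G" by (rule G.incl_subgroup[OF P M'(1)])
    note MB = subgroup_BijD[OF M]
    have MP: "M \<subseteq> P" using subgroup.subset[OF M'(1)] by simp
    have nrm: "\<forall>g\<in>P. \<forall>m\<in>M. g \<otimes>\<^bsub>?G\<^esub> m \<otimes>\<^bsub>?G\<^esub> inv\<^bsub>?G\<^esub> g \<in> M"
    proof (intro ballI)
      fix g m assume gm: "g \<in> P" "m \<in> M"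
      show "g \<otimes>\<^bsub>?G\<^esub> m \<otimes>\<^bsub>?G\<^esub> inv\<^bsub>?G\<^esub> g \<in> M"
        using nrm'[rule_format, OF gm] unfolding G.m_inv_consistent[OF P gm(1)] .
    qed
    let ?R = "prep M ` S" and ?h = "pquot M S"
    note hom = pquot_hom[OF M P nrm]
    note orb_im = porb_image[OF M P nrm]
    have RS: "?R \<subseteq> S" using prep_in_S[OF M] by blast
    have finR: "finite ?R" using fin by simp
    obtain m x1 where m: "m \<in> M" and x1: "x1 \<in> S" "m x1 \<noteq> x1"
    proof -
      obtain m where "m \<in> M" "m \<noteq> \<one>\<^bsub>?G\<^esub>" using M'(2) MB(3) by blast
      thus thesis using that Bij_eq_one_iff[OF MB(2)] by blast
    qed
    define d where "d = card (porb M x1)"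
    have d: "\<forall>x\<in>S. card (porb M x) = d"
    proof
      fix x assume x: "x \<in> S"
      obtain g where g: "g \<in> P" "g x1 = x" using trans x1(1) x by blast
      have "porb M x = g ` porb M x1" using orb_im[OF g(1) x1(1)] g(2) by simp
      thus "card (porb M x) = d"
        using card_image[OF inj_on_subset[OF Bij_inj_on[OF PB(2)[OF g(1)]] porb_subset[OF M x1(1)]]]
        by (simp add: d_def)
    qed
    have mx: "m x1 \<in> porb M x1" using m by (auto simp: porb_def)
    have d2: "d \<ge> 2"
    proof -
      have "card {x1, m x1} \<le> d"
        unfolding d_def using mx porb_self[OF M x1(1)] finite_subset[OF porb_subset[OF M x1(1)] fin]
        by (intro card_mono) auto
      thus ?thesis using x1(2) by simp
    qed
    have "prep M (m x1) = prep M x1" using porb_eq[OF M x1(1) mx] unfolding prep_def by simp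
    hence "\<not> inj_on (prep M) S" using x1 PB(6)[OF subsetD[OF MP m] x1(1)] by (auto simp: inj_on_def)
    hence lt: "card ?R < card S"
      using card_image_le[OF fin, of "prep M"] eq_card_imp_inj_on[OF fin, of "prep M"] by fastforce
    let ?H = "BijGroup ?R"
    interpret H: group ?H by (rule group_BijGroup)
    interpret h: group_hom "?G\<lparr>carrier := P\<rparr>" ?H ?h
      using hom P.group_axioms H.group_axioms by (simp add: group_hom_def group_hom_axioms_def)
    have P': "subgroup (?h ` P) ?H" using h.img_is_subgroup by simp
    interpret h': group_hom "?G\<lparr>carrier := P\<rparr>" "?H\<lparr>carrier := ?h ` P\<rparr>" ?h
      using hom P.group_axioms H.subgroup_imp_group[OF P']
      by (auto simp: group_hom_def group_hom_axioms_def hom_def)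
    have solv': "solvable (?H\<lparr>carrier := ?h ` P\<rparr>)"
      by (rule h'.surj_hom_imp_solvable[OF _ solv]) simp
    have hx: "?h g (prep M x) = prep M (g x)" if "g \<in> P" "x \<in> S" for g x
      by (rule pquot_prep[OF M P nrm that])
    have "\<forall>x\<in>?R. \<forall>y\<in>?R. \<exists>g\<in>?h ` P. g x = y"
    proof (intro ballI)
      fix u v assume "u \<in> ?R" "v \<in> ?R"
      then obtain x y where xy: "x \<in> S" "y \<in> S" "u = prep M x" "v = prep M y" by blast
      then obtain g where g: "g \<in> P" "g x = y" using trans by blast
      have "?h g u = v" using hx[OF g(1) xy(1)] xy g(2) by simp
      thus "\<exists>g\<in>?h ` P. g u = v" using g(1) by blast
    qed
    from less.hyps[OF lt finR P' solv' this]
    obtain T where T: "T \<subseteq> ?R" "tame ?H (?h ` P) (stab (?h ` P) T)" by blast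
    define K where "K = {g \<in> P. ?h g = \<one>\<^bsub>?H\<^esub>}"
    have K_iff: "g \<in> K \<longleftrightarrow> g \<in> P \<and> (\<forall>x\<in>S. g x \<in> porb M x)" for g
      using pquot_eq_one_iff[OF M P nrm] by (auto simp: K_def)
    have KP: "K \<subseteq> P" by (auto simp: K_def)
    have K: "subgroup K ?G"
    proof -
      have "subgroup K (?G\<lparr>carrier := P\<rparr>)" using h.subgroup_kernel by (simp add: kernel_def K_def)
      thus ?thesis by (rule G.incl_subgroup[OF P])
    qed
    note KB = subgroup_BijD[OF K]
    have finK: "finite K" using KP finP finite_subset by blast
    have MK: "M \<subseteq> K"
    proof
      fix m assume "m \<in> M"
      thus "m \<in> K" using MP by (auto simp: K_iff porb_def)
    qed
    \<comment> \<open>If \<open>sep\<close> allows the orbits marked by \<open>T\<close> to be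
      recovered from \<open>D\<close>, the stabiliser of \<open>D\<close> acts inside that of
      \<open>T\<close>, and \<open>tame_extension\<close> joins the quotient to the kernel
      \<open>K\<close>.\<close>
    have lift: "tame ?G P (stab P D)"
      if DS: "D \<subseteq> S" and DK: "tame ?G K (stab K D)"
        and sep: "\<And>g x. g \<in> stab P D \<Longrightarrow> x \<in> S \<Longrightarrow> prep M x \<in> T \<longleftrightarrow> prep M (g x) \<in> T" for D
    proof (rule tame_extension[OF group_BijGroup group_BijGroup hom P _ _ finP T(2)])
      show "subgroup (stab P D) ?G" by (rule subgroup_stab[OF P DS])
      show "stab P D \<subseteq> P" by (auto simp: stab_def)
      show "finite (stab (?h ` P) T)" using finP by (simp add: stab_def)
      show "?h ` stab P D \<subseteq> stab (?h ` P) T"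
      proof (rule image_subsetI)
        fix g assume g: "g \<in> stab P D"
        have gP: "g \<in> P" using g by (simp add: stab_def)
        have "?h g ` T \<subseteq> T"
        proof (rule image_subsetI)
          fix t assume t: "t \<in> T"
          then obtain x where x: "x \<in> S" "t = prep M x" using T(1) by blast
          show "?h g t \<in> T" using sep[OF g x(1)] t x(2) hx[OF gP x(1)] by simp
        qed
        moreover have "?h g \<in> Bij ?R" using h.hom_closed[of g] gP by simp
        ultimately have "?h g ` T = T" using image_eq_subset_card[OF _ T(1) finR] by blast
        thus "?h g \<in> stab (?h ` P) T" using gP by (simp add: stab_def)
      qed
      have "{g \<in> stab P D. ?h g = \<one>\<^bsub>?H\<^esub>} = stab K D" by (auto simp: stab_def K_def)
      thus "tame ?G {g \<in> P. ?h g = \<one>\<^bsub>?H\<^esub>} {g \<in> stab P D. ?h g = \<one>\<^bsub>?H\<^esub>}"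
        using DK by (simp add: K_def)
    qed
    have prep_orb: "prep M ` porb M x = {prep M x}" if x: "x \<in> S" for x
    proof -
      have "prep M y = prep M x" if "y \<in> porb M x" for y
        using porb_eq[OF M x that] unfolding prep_def by simp
      thus ?thesis using porb_self[OF M x] by blast
    qed
    have im_orb: "g ` (D \<inter> porb M x) = D \<inter> porb M (g x)"
      if g: "g \<in> stab P D" and D: "D \<subseteq> S" and x: "x \<in> S" for g D x
    proof -
      have gP: "g \<in> P" "g ` D = D" using g by (auto simp: stab_def)
      show ?thesis
        using inj_on_image_Int[OF Bij_inj_on[OF PB(2)[OF gP(1)]] D porb_subset[OF M x]]
          orb_im[OF gP(1) x] gP(2) by simp
    qed
    show ?thesis
    proof (cases "d = 2")
      case False
      hence d3: "d \<ge> 3" using d2 by simp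
      \<comment> \<open>An orbit is to receive less than half of its points exactly when its
        representative is in \<open>T\<close>.\<close>
      define Q where "Q b \<longleftrightarrow> prep M ` b \<inter> T \<noteq> {}" for b
      have "\<exists>D\<subseteq>\<Union>(porb M ` S). tame ?G K (stab K D) \<and>
        (\<forall>b\<in>porb M ` S. (Q b \<longleftrightarrow> 2 * card (D \<inter> b) < d) \<and> 2 * card (D \<inter> b) \<noteq> d)"
      proof (rule tame_orbitwise[OF fin M comm par d d3 _ order_refl K])
        show "finite (porb M ` S)" using fin by simp
        show "\<forall>l\<in>K. \<forall>x\<in>S. l x \<in> porb M x" using K_iff by blast
        show "\<forall>l\<in>K. \<forall>m\<in>M. l \<otimes>\<^bsub>?G\<^esub> m \<otimes>\<^bsub>?G\<^esub> inv\<^bsub>?G\<^esub> l \<in> M" using nrm KP by blast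
        show "\<forall>m\<in>M. \<forall>l\<in>K. m \<otimes>\<^bsub>?G\<^esub> l \<otimes>\<^bsub>?G\<^esub> inv\<^bsub>?G\<^esub> m \<in> K"
        proof (intro ballI)
          fix m l assume "m \<in> M" "l \<in> K"
          hence "m \<in> K" "l \<in> K" using MK by blast+
          thus "m \<otimes>\<^bsub>?G\<^esub> l \<otimes>\<^bsub>?G\<^esub> inv\<^bsub>?G\<^esub> m \<in> K" using KB(4)[OF KB(4) KB(5)] by simp
        qed
        show "\<forall>l\<in>K. \<forall>x\<in>S - \<Union>(porb M ` S). l x = x" using porb_self[OF M] by blast
      qed
      then obtain D where D: "D \<subseteq> \<Union>(porb M ` S)" "tame ?G K (stab K D)"
        and sz: "\<forall>b\<in>porb M ` S. Q b \<longleftrightarrow> 2 * card (D \<inter> b) < d" by blast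
      have DS: "D \<subseteq> S" using D(1) porb_subset[OF M] by blast
      have "tame ?G P (stab P D)"
      proof (rule lift[OF DS D(2)])
        fix g x assume g: "g \<in> stab P D" and x: "x \<in> S"
        have gP: "g \<in> P" using g by (simp add: stab_def)
        have gx: "g x \<in> S" by (rule PB(6)[OF gP x])
        have "D \<inter> porb M x \<subseteq> S" using DS by blast
        hence "card (D \<inter> porb M (g x)) = card (D \<inter> porb M x)"
          unfolding im_orb[OF g DS x, symmetric]
          by (intro card_image inj_on_subset[OF Bij_inj_on[OF PB(2)[OF gP]]])
        hence "Q (porb M x) \<longleftrightarrow> Q (porb M (g x))" using sz x gx by simp
        thus "prep M x \<in> T \<longleftrightarrow> prep M (g x) \<in> T"
          using prep_orb[OF x] prep_orb[OF gx] by (simp add: Q_def)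
      qed
      thus ?thesis using DS by blast
    next
      case True
      \<comment> \<open>In an orbit of size 2 a single point is exactly half, so size cannot mark
        the orbit when one point is taken. Sets of representatives are used instead; whether they
        meet an orbit is the mark.\<close>
      have rep_inter: "A \<inter> porb M x = (if prep M x \<in> A then {prep M x} else {})"
        if A: "A \<subseteq> ?R" and x: "x \<in> S" for A x
      proof -
        have sub: "A \<inter> porb M x \<subseteq> {prep M x}"
        proof
          fix y assume "y \<in> A \<inter> porb M x"
          hence y: "y \<in> A" "y \<in> porb M x" by auto
          obtain u where u: "u \<in> S" "y = prep M u" using y(1) A by blast
          have "y = prep M y" unfolding u(2) by (rule prep_prep[OF M u(1), symmetric])
          also have "prep M y \<in> prep M ` porb M x" using y(2) by (rule imageI)
          hence "prep M y = prep M x" unfolding prep_orb[OF x] by (rule singletonD)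
          finally show "y \<in> {prep M x}" by (rule ssubst) (rule singletonI)
        qed
        show ?thesis
        proof (cases "prep M x \<in> A")
          case True
          hence "prep M x \<in> A \<inter> porb M x" using prep_in[OF M x] by (rule IntI)
          thus ?thesis using sub True by (simp add: subset_antisym)
        next
          case False
          thus ?thesis using sub by auto
        qed
      qed
      have stabK: "g (prep M x) = prep M x" if g: "g \<in> stab K A" and A: "A \<subseteq> ?R" and x: "x \<in> S"
        and a: "prep M x \<in> A" for g A x
      proof -
        have px: "prep M x \<in> S" by (rule prep_in_S[OF M x])
        have "g (prep M x) \<in> A" using g a unfolding stab_def by blast
        moreover have "g (prep M x) \<in> porb M x"
          using g px K_iff porb_prep[OF M x] unfolding stab_def by blast
        ultimately show ?thesis using rep_inter[OF A x] a by auto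
      qed
      \<comment> \<open>An element of both stabilisers fixes every representative, and with it the
        only other point of each orbit.\<close>
      have triv: "stab K A \<inter> stab K (?R - A) = {\<one>\<^bsub>?G\<^esub>}" if A: "A \<subseteq> ?R" for A
      proof (intro equalityI subsetI)
        fix g assume g: "g \<in> stab K A \<inter> stab K (?R - A)"
        have gK: "g \<in> K" using g by (simp add: stab_def)
        have fx: "g (prep M x) = prep M x" if x: "x \<in> S" for x
          using stabK[of g A x] stabK[of g "?R - A" x] g A x by blast
        have "g x = x" if x: "x \<in> S" for x
        proof (rule ccontr)
          assume ne: "g x \<noteq> x"
          hence px: "prep M x \<noteq> x" using fx[OF x] by auto
          have "g x \<noteq> prep M x"
            using inj_onD[OF Bij_inj_on[OF KB(2)[OF gK]], of x "prep M x"] fx[OF x] x prep_in_S[OF M x] px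
            by auto
          hence "card {x, prep M x, g x} = 3" using ne px by auto
          moreover have "{x, prep M x, g x} \<subseteq> porb M x"
            using porb_self[OF M x] prep_in[OF M x] K_iff gK x by blast
          moreover have "finite (porb M x)" using finite_subset[OF porb_subset[OF M x] fin] .
          ultimately have "3 \<le> card (porb M x)" using card_mono by metis
          thus False using d x True by simp
        qed
        thus "g \<in> {\<one>\<^bsub>?G\<^esub>}" using Bij_eq_one_iff[OF KB(2)[OF gK]] by blast
      next
        fix g assume "g \<in> {\<one>\<^bsub>?G\<^esub>}"
        thus "g \<in> stab K A \<inter> stab K (?R - A)"
          using subgroup_BijD(3)[OF subgroup_stab[OF K, of A]]
            subgroup_BijD(3)[OF subgroup_stab[OF K, of "?R - A"]] A RS by blast
      qed
      have sub: "subgroup (stab K A) ?G" if "A \<subseteq> ?R" for A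
        using subgroup_stab[OF K] that RS by blast
      have prod: "card (stab K A) * card (stab K (?R - A)) \<le> card K" if A: "A \<subseteq> ?R" for A
        by (rule G.card_mult_le_of_trivial_Int[OF sub[OF A] sub[OF Diff_subset] K _ _ finK triv[OF A]])
          (auto simp: stab_def)
      \<comment> \<open>The two stabilisers have orders with product at most that of
        \<open>K\<close>, so the smaller order has square at most that. This bounds all subgroups,
        nilpotent or not.\<close>
      obtain A where A: "A = T \<or> A = ?R - T" "card (stab K A) * card (stab K A) \<le> card K"
      proof (cases "card (stab K T) \<le> card (stab K (?R - T))")
        case True
        hence "card (stab K T) * card (stab K T) \<le> card K"
          using prod[OF T(1)] mult_le_mono2[OF True, of "card (stab K T)"] by linarith
        thus thesis using that by blast
      next
        case False
        hence "card (stab K (?R - T)) * card (stab K (?R - T)) \<le> card K"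
          using prod[OF T(1)] mult_le_mono1[of "card (stab K (?R - T))" "card (stab K T)" "card (stab K (?R - T))"]
          by linarith
        thus thesis using that by blast
      qed
      have AR: "A \<subseteq> ?R" using A(1) T(1) by blast
      have AS: "A \<subseteq> S" using AR RS by blast
      have "tame ?G P (stab P A)"
      proof (rule lift[OF AS])
        have "card N * card (stab K A) \<le> card K" if "N \<subseteq> stab K A" for N
        proof -
          have "card N \<le> card (stab K A)"
            by (rule card_mono[OF _ that]) (use finK in \<open>simp add: stab_def\<close>)
          thus ?thesis using A(2) mult_le_mono1 le_trans by blast
        qed
        thus "tame ?G K (stab K A)" by (simp add: tame_def)
        fix g x assume g: "g \<in> stab P A" and x: "x \<in> S"
        have gx: "g x \<in> S" using g PB(6) x by (simp add: stab_def)
        \<comment> \<open>An element stabilising \<open>A\<close> preserves the family of orbits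
          that meet \<open>A\<close>, and \<open>T\<close> is \<open>A\<close> or its complement
          among the representatives.\<close>
        have "A \<inter> porb M x = {} \<longleftrightarrow> A \<inter> porb M (g x) = {}"
          unfolding im_orb[OF g AS x, symmetric] by simp
        hence "prep M x \<in> A \<longleftrightarrow> prep M (g x) \<in> A"
          using rep_inter[OF AR x] rep_inter[OF AR gx] by (auto split: if_splits)
        thus "prep M x \<in> T \<longleftrightarrow> prep M (g x) \<in> T" using A(1) x gx by auto
      qed
      thus ?thesis using AS by blast
    qed
  qed
qed

section \<open>From products of orders to the abundance ratio\<close>

theorem theorem1p5:
  fixes \<Omega> :: "'a set" and P :: "('a \<Rightarrow> 'a) set"
  assumes "finite \<Omega>"
    and "subgroup P (BijGroup \<Omega>)"
    and "solvable (perm_group \<Omega> P)"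
    and "transitive_action (perm_group \<Omega> P) \<Omega> (\<lambda>g. g)"
  shows "\<exists>\<Delta>. \<Delta> \<subseteq> \<Omega> \<and> abundant (perm_group \<Omega> P) \<Delta>"
proof -
  interpret transitive_action "perm_group \<Omega> P" \<Omega> "\<lambda>g. g" by (rule assms(4))
  interpret B: group "BijGroup \<Omega>" by (rule group_BijGroup)
  interpret PG: group "perm_group \<Omega> P" by (rule B.subgroup_imp_group[OF assms(2)])
  have "\<forall>x\<in>\<Omega>. \<forall>y\<in>\<Omega>. \<exists>g\<in>P. g x = y" using unique_orbit by simp
  then obtain D where D: "D \<subseteq> \<Omega>" "tame (BijGroup \<Omega>) P (stab P D)"
    using exists_tame_set[OF assms(1-3)] by blast
  let ?S = "stab P D"
  have S_eq: "setwise_stabilizer (perm_group \<Omega> P) D = ?S"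
    by (simp add: setwise_stabilizer_def stabilizer_def stab_def)
  have S: "subgroup ?S (BijGroup \<Omega>)" by (rule subgroup_stab[OF assms(2) D(1)])
  have SP: "?S \<subseteq> P" by (auto simp: stab_def)
  have finS: "finite ?S"
    using finite_Bij[OF assms(1)] subgroup_BijD(1)[OF S] finite_subset by blast
  have S0: "card ?S > 0" using finS subgroup_BijD(3)[OF S] by (auto simp: card_gt_0_iff)
  let ?O = "{card N | N. subgroup N (perm_group \<Omega> ?S) \<and>
    nilpotent_group (perm_group \<Omega> ?S\<lparr>carrier := N\<rparr>)}"
  let ?c = "card (rcosets\<^bsub>perm_group \<Omega> P\<^esub> ?S)"
  \<comment> \<open>By Lagrange's theorem the inequality in \<open>tame\<close> can be divided by
    the order of the stabiliser.\<close>
  have index: "?c * card ?S = card P"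
    using PG.lagrange[OF B.subgroup_incl[OF S assms(2) SP]] by (simp add: order_def)
  have le: "k \<le> ?c" if "k \<in> ?O" for k
  proof -
    obtain N where N: "k = card N" "subgroup N (perm_group \<Omega> ?S)"
      "nilpotent_group (BijGroup \<Omega>\<lparr>carrier := N\<rparr>)" using \<open>k \<in> ?O\<close> by auto
    have "subgroup N (BijGroup \<Omega>)" by (rule B.incl_subgroup[OF S N(2)])
    moreover have "N \<subseteq> ?S" using subgroup.subset[OF N(2)] by simp
    ultimately have "card N * card ?S \<le> ?c * card ?S"
      unfolding index using tameD[OF D(2)] N(3) by blast
    thus ?thesis using S0 N(1) by simp
  qed
  interpret SG: group "perm_group \<Omega> ?S" by (rule B.subgroup_imp_group[OF S])
  \<comment> \<open>\<open>Max\<close> is meaningful only on a finite nonempty set; finiteness comes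
    from the bound \<open>le\<close> itself.\<close>
  have "finite ?O"
    by (rule finite_subset[of _ "{..?c}"]) (use le in auto)
  moreover have "?O \<noteq> {}"
  proof -
    have "nilpotent_group (perm_group \<Omega> ?S\<lparr>carrier := {\<one>\<^bsub>BijGroup \<Omega>\<^esub>}\<rparr>)"
      unfolding nilpotent_group_def by (rule exI[of _ 0]) simp
    thus ?thesis using SG.triv_subgroup by auto
  qed
  ultimately have "max_nilpotent_order (perm_group \<Omega> ?S) \<le> ?c"
    unfolding max_nilpotent_order_def using le by simp
  hence "abundant (perm_group \<Omega> P) D"
    unfolding abundant_iff[OF assms(1,2) D(1)] S_eq .
  thus ?thesis using D(1) by blast
qed

end
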